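(* Let $P$ be an isonemal prefabric of order greater than $4$. Lattice units of $P$ (for a suitable choice of lattice unit of its symmetry group) can be the regions of a net of an isonemal woven cube if and only if $P$ is of species $33$, $34$, $37$, $38$ or $39$.
   Context: The plane $E$ is tessellated by unit squares called cells, with horizontal and vertical sides. The strands are the vertical columns of cells (warps) and the horizontal rows of cells (wefts). A prefabric assigns to each cell which of the two strands crossing there is uppermost. A symmetry is a pair $(g,\epsilon)$, where $g$ is an isometry of $E$ mapping the tessellation by cells to itself and $\epsilon\in\{e,\tau\}$: if $\epsilon=e$, $g$ carries the uppermost strand at each cell $c$ to the uppermost strand at $g(c)$; if $\epsilon=\tau$, $g$ carries the uppermost strand at $c$ to the lowermost strand at $g(c)$. The symmetries form the group $G$; $G_1$ is the planar group of all $g$ occurring in $G$. The prefabric is isonemal if $G$ is transitive on the strands. Its order is the least positive integer $n$ such that the over-under sequence along the strands repeats every $n$ cells. A rotation $g\in G_1$ is called preserving if $(g,e)\in G$ and reversing if $(g,\tau)\in G$. For a group $G_1$ of type $p4$, a lattice unit is a square whose side vectors generate the translation subgroup and whose corners are centres of quarter-turns (its centre is then also one, and the mid-points of its sides are centres of half-turns). Lattice units are not unique: either of the two translation classes of quarter-turn centres may be used for the corners. Levels: a level-$1$ unit is a square on the hypotenuse of a right triangle with horizontal and vertical sides relatively prime positive integers of opposite parity, with corners all at cell corners or all at cell centres. A unit of level $n+1$ is a square escribing a unit of level $n$, i.e. having the corners of the level-$n$ unit as the mid-points of its sides. Species (all with $G_1$ of type $p4$, for the full symmetry group): $39$: level-$1$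 lattice unit, quarter-turns at cell centres reversing and those at cell corners preserving. $34$: level-$2$ lattice unit with centre and corners at cell corners, all quarter-turns preserving. $33$: level-$3$ or level-$4$ lattice unit with centre and corners at cell corners, all quarter-turns preserving. $38$ (resp. $37$): level-$3$ (resp. level-$4$) lattice unit with centre and corners at cell corners, the quarter-turns at the centre being of one kind (preserving or reversing) and those at the corners of the other kind. Woven cubes. A net is an edge-to-edge arrangement in $E$ of six squares (the regions) that folds to the surface of a cube, the regions becoming the faces; the part of the prefabric lying in the net is carried onto the cube, strands continuing, with their over-and-under relations, across the edges of the cube. The result is an isonemal woven cube if the following hold. (i) The strands and their over-under relations match across all edges of the cube, and the six faces are woven the same way: each region of the net is related to the others by translations or rotations that are symmetries of the prefabric. (ii) The weaving of the cube is invariant, possibly in combination with $\tau$ (interchange of the outer and inner sides), under all rotations of the cube about its $4$-fold, $3$-fold and $2$-fold axes, and these are collectively transitive on the strands of the cube. In particular, the centre of each region is a centre of quarter-turn symmetry, the mid-points of the sides of each region are centres of half-turn symmetry, and the corners of the regions are at cell corners. Reflective symmetries of the cube are not considered. (iii) Conversely, the centres of rotational symmetry of the prefabric lying in the net are confined to the centres of regions, the corners of regions and the mid-points of sides of regions, so that the regions of the net are lattice units of the prefabric. Prefabrics with more symmetry than groups of type $p4$ are ruled out by this definition. *)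

theory Defs
  imports "HOL-Analysis.Analysis"
begin

definition warp :: "int \<Rightarrow> complex set" where
  "warp i = {z. of_int i \<le> Re z \<and> Re z \<le> of_int i + 1}"

definition weft :: "int \<Rightarrow> complex set" where
  "weft j = {z. of_int j \<le> Im z \<and> Im z \<le> of_int j + 1}"

definition strands :: "complex set set" where
  "strands = range warp \<union> range weft"

definition cell :: "int \<Rightarrow> int \<Rightarrow> complex set" where
  "cell i j = warp i \<inter> weft j"

definition cells :: "complex set set" where
  "cells = {cell i j | i j. True}"

definition cell_corners :: "complex set" where
  "cell_corners = {Complex (of_int i) (of_int j) | i j. True}"

definition cell_centres :: "complex set" where
  "cell_centres = {Complex (of_int i + 1/2) (of_int j + 1/2) | i j. True}"

text \<open>\<open>P i j\<close> holds iff warp \<open>i\<close> is uppermost where it crosses weft \<open>j\<close>.\<close>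

type_synonym prefabric = "int \<Rightarrow> int \<Rightarrow> bool"

definition uppermost :: "prefabric \<Rightarrow> int \<Rightarrow> int \<Rightarrow> complex set" where
  "uppermost P i j = (if P i j then warp i else weft j)"

definition lowermost :: "prefabric \<Rightarrow> int \<Rightarrow> int \<Rightarrow> complex set" where
  "lowermost P i j = (if P i j then weft j else warp i)"

text \<open>\<open>Keep\<close> and \<open>Tau\<close> are the two values $e$ and $\tau$ of the second component of a symmetry.\<close>

datatype side_action = Keep | Tau

definition plane_isometry :: "(complex \<Rightarrow> complex) \<Rightarrow> bool" where
  "plane_isometry g \<longleftrightarrow> (\<forall>x y. dist (g x) (g y) = dist x y)"

definition carries :: "prefabric \<Rightarrow> (complex \<Rightarrow> complex) \<Rightarrow> side_action \<Rightarrow> int \<Rightarrow> int \<Rightarrow> bool" where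
  "carries P g \<epsilon> i j \<longleftrightarrow>
     (\<exists>i' j'. g ` cell i j = cell i' j' \<and>
        g ` uppermost P i j =
          (case \<epsilon> of Keep \<Rightarrow> uppermost P i' j' | Tau \<Rightarrow> lowermost P i' j'))"

definition symmetries :: "prefabric \<Rightarrow> ((complex \<Rightarrow> complex) \<times> side_action) set" where
  "symmetries P = {(g, \<epsilon>). plane_isometry g \<and> (\<lambda>c. g ` c) ` cells = cells \<and>
     (\<forall>i j. carries P g \<epsilon> i j)}"

definition planar_group :: "prefabric \<Rightarrow> (complex \<Rightarrow> complex) set" where
  "planar_group P = fst ` symmetries P"

definition isonemal :: "prefabric \<Rightarrow> bool" where
  "isonemal P \<longleftrightarrow>
     (\<forall>s\<in>strands. \<forall>t\<in>strands. \<exists>g\<in>planar_group P. g ` s = t)"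

definition repeats_every :: "prefabric \<Rightarrow> nat \<Rightarrow> bool" where
  "repeats_every P n \<longleftrightarrow>
     (\<forall>i j. P i (j + int n) = P i j \<and> P (i + int n) j = P i j)"

definition has_order :: "prefabric \<Rightarrow> nat \<Rightarrow> bool" where
  "has_order P n \<longleftrightarrow> 0 < n \<and> repeats_every P n \<and>
     (\<forall>m. 0 < m \<and> repeats_every P m \<longrightarrow> n \<le> m)"

definition translation :: "complex \<Rightarrow> complex \<Rightarrow> complex" where
  "translation t = (\<lambda>z. z + t)"

definition rotation :: "complex \<Rightarrow> complex \<Rightarrow> complex \<Rightarrow> complex" where
  "rotation c u = (\<lambda>z. c + u * (z - c))"

abbreviation quarter_turn :: "complex \<Rightarrow> complex \<Rightarrow> complex" where
  "quarter_turn c \<equiv> rotation c \<i>"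

abbreviation half_turn :: "complex \<Rightarrow> complex \<Rightarrow> complex" where
  "half_turn c \<equiv> rotation c (-1)"

definition rotation_centres :: "prefabric \<Rightarrow> complex set" where
  "rotation_centres P = {c. \<exists>u. norm u = 1 \<and> u \<noteq> 1 \<and> rotation c u \<in> planar_group P}"

definition preserving :: "prefabric \<Rightarrow> complex \<Rightarrow> bool" where
  "preserving P c \<longleftrightarrow> (quarter_turn c, Keep) \<in> symmetries P"

definition reversing :: "prefabric \<Rightarrow> complex \<Rightarrow> bool" where
  "reversing P c \<longleftrightarrow> (quarter_turn c, Tau) \<in> symmetries P"

definition square_lattice :: "complex \<Rightarrow> complex set" where
  "square_lattice v = {of_int m * v + of_int n * (\<i> * v) | m n. True}"

text \<open>The standard group of type p4, in arbitrary position and at arbitrary scale: a translation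
  lattice spanned by perpendicular vectors \<open>v\<close>, \<open>\<i> * v\<close> of equal length, extended by the powers of
  one quarter-turn.\<close>

definition type_p4 :: "(complex \<Rightarrow> complex) set \<Rightarrow> bool" where
  "type_p4 \<Gamma> \<longleftrightarrow>
     (\<exists>c v. v \<noteq> 0 \<and>
        \<Gamma> = {translation t \<circ> rotation c (\<i> ^ k) | t k. t \<in> square_lattice v})"

text \<open>A square is given by a corner \<open>p\<close> and the side vector \<open>v\<close> leaving it with the square on the
  left. Each square has four such descriptions; nothing below depends on which one is used.\<close>

type_synonym square = "complex \<times> complex"

definition region :: "square \<Rightarrow> complex set" where
  "region = (\<lambda>(p, v). {p + of_real s * v + of_real t * (\<i> * v) | s t.
     0 \<le> s \<and> s \<le> 1 \<and> 0 \<le> t \<and> t \<le> 1})"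

definition corners :: "square \<Rightarrow> complex set" where
  "corners = (\<lambda>(p, v). {p, p + v, p + v + \<i> * v, p + \<i> * v})"

definition centre :: "square \<Rightarrow> complex" where
  "centre = (\<lambda>(p, v). p + (v + \<i> * v) / 2)"

definition midpoints :: "square \<Rightarrow> complex set" where
  "midpoints = (\<lambda>(p, v).
     {p + v / 2, p + v + \<i> * v / 2, p + v / 2 + \<i> * v, p + \<i> * v / 2})"

definition sides :: "square \<Rightarrow> complex set set" where
  "sides = (\<lambda>(p, v).
     {closed_segment p (p + v), closed_segment (p + v) (p + v + \<i> * v),
      closed_segment (p + v + \<i> * v) (p + \<i> * v), closed_segment (p + \<i> * v) p})"

definition lattice_unit :: "prefabric \<Rightarrow> square \<Rightarrow> bool" where
  "lattice_unit P S \<longleftrightarrow>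
     type_p4 (planar_group P) \<and>
     snd S \<noteq> 0 \<and>
     {t. translation t \<in> planar_group P} = square_lattice (snd S) \<and>
     (\<forall>c\<in>corners S. quarter_turn c \<in> planar_group P)"

inductive level :: "nat \<Rightarrow> square \<Rightarrow> bool" where
  level_1: "\<lbrakk>\<bar>Re v\<bar> = real a; \<bar>Im v\<bar> = real b; 0 < a; 0 < b; coprime a b; odd (a + b);
      corners (p, v) \<subseteq> cell_corners \<or> corners (p, v) \<subseteq> cell_centres\<rbrakk>
    \<Longrightarrow> level 1 (p, v)"
| level_Suc: "\<lbrakk>level n S; midpoints T = corners S\<rbrakk> \<Longrightarrow> level (Suc n) T"

definition at_cell_corners :: "square \<Rightarrow> bool" where
  "at_cell_corners S \<longleftrightarrow> centre S \<in> cell_corners \<and> corners S \<subseteq> cell_corners"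

definition all_preserving :: "prefabric \<Rightarrow> bool" where
  "all_preserving P \<longleftrightarrow> (\<forall>c. quarter_turn c \<in> planar_group P \<longrightarrow> preserving P c)"

definition mixed_kinds :: "prefabric \<Rightarrow> square \<Rightarrow> bool" where
  "mixed_kinds P S \<longleftrightarrow>
     (preserving P (centre S) \<and> (\<forall>c\<in>corners S. reversing P c)) \<or>
     (reversing P (centre S) \<and> (\<forall>c\<in>corners S. preserving P c))"

definition species33 :: "prefabric \<Rightarrow> bool" where
  "species33 P \<longleftrightarrow>
     (\<exists>S. lattice_unit P S \<and> (level 3 S \<or> level 4 S) \<and> at_cell_corners S) \<and> all_preserving P"

definition species34 :: "prefabric \<Rightarrow> bool" where
  "species34 P \<longleftrightarrow>
     (\<exists>S. lattice_unit P S \<and> level 2 S \<and> at_cell_corners S) \<and> all_preserving P"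

definition species37 :: "prefabric \<Rightarrow> bool" where
  "species37 P \<longleftrightarrow>
     (\<exists>S. lattice_unit P S \<and> level 4 S \<and> at_cell_corners S \<and> mixed_kinds P S)"

definition species38 :: "prefabric \<Rightarrow> bool" where
  "species38 P \<longleftrightarrow>
     (\<exists>S. lattice_unit P S \<and> level 3 S \<and> at_cell_corners S \<and> mixed_kinds P S)"

definition species39 :: "prefabric \<Rightarrow> bool" where
  "species39 P \<longleftrightarrow>
     (\<exists>S. lattice_unit P S \<and> level 1 S) \<and>
     (\<forall>c\<in>cell_centres. quarter_turn c \<in> planar_group P \<longrightarrow> reversing P c) \<and>
     (\<forall>c\<in>cell_corners. quarter_turn c \<in> planar_group P \<longrightarrow> preserving P c)"

definition cube :: "real \<Rightarrow> (real ^ 3) set" where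
  "cube r = {x. \<forall>k. \<bar>x $ k\<bar> \<le> r}"

definition cube_faces :: "real \<Rightarrow> (real ^ 3) set set" where
  "cube_faces r = {{x \<in> cube r. x $ k = s} | k s. s = r \<or> s = - r}"

definition cube_rotations :: "real \<Rightarrow> (real ^ 3 ^ 3) set" where
  "cube_rotations r = {\<rho>. rotation_matrix \<rho> \<and> (\<lambda>x. \<rho> *v x) ` cube r = cube r}"

definition edge_to_edge :: "square \<Rightarrow> square \<Rightarrow> bool" where
  "edge_to_edge A B \<longleftrightarrow>
     region A \<inter> region B = {} \<or>
     (\<exists>x \<in> corners A \<inter> corners B. region A \<inter> region B = {x}) \<or>
     region A \<inter> region B \<in> sides A \<inter> sides B"

definition side_adjacency :: "square set \<Rightarrow> (square \<times> square) set" where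
  "side_adjacency N =
     {(A, B). A \<in> N \<and> B \<in> N \<and> region A \<inter> region B \<in> sides A \<inter> sides B}"

text \<open>The map \<open>f\<close> folds the net onto the surface of the cube of edge length \<open>2 * r\<close>. As \<open>f\<close> is a
  single function on the union of the regions, a side common to two regions is a hinge. Whether the
  upper side of the prefabric becomes the outside or the inside of the cube is left open; the two
  foldings differ by the map \<open>x \<mapsto> - x\<close> of space.\<close>

definition net_folding :: "square set \<Rightarrow> real \<Rightarrow> (complex \<Rightarrow> real ^ 3) \<Rightarrow> bool" where
  "net_folding N r f \<longleftrightarrow>
     0 < r \<and> card N = 6 \<and> (\<forall>A\<in>N. snd A \<noteq> 0) \<and>
     (\<forall>A\<in>N. \<forall>B\<in>N. A \<noteq> B \<longrightarrow> edge_to_edge A B) \<and>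
     (\<forall>A\<in>N. \<forall>B\<in>N. (A, B) \<in> (side_adjacency N)\<^sup>*) \<and>
     (\<forall>A\<in>N. \<forall>x\<in>region A. \<forall>y\<in>region A. dist (f x) (f y) = dist x y) \<and>
     bij_betw (\<lambda>A. f ` region A) N (cube_faces r)"

text \<open>For regions \<open>A\<close>, \<open>B\<close> folded to adjacent faces, \<open>h\<close> is the isometry laying \<open>B\<close> flat beside \<open>A\<close>
  in the plane, so that the two sides forming the common edge of the cube coincide. It is the
  identity if \<open>A\<close> and \<open>B\<close> already share that side in the net.\<close>

definition unfolding_isometry ::
  "(complex \<Rightarrow> real ^ 3) \<Rightarrow> square \<Rightarrow> square \<Rightarrow> (complex \<Rightarrow> complex) \<Rightarrow> bool" where
  "unfolding_isometry f A B h \<longleftrightarrow>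
     A \<noteq> B \<and> f ` region A \<inter> f ` region B \<noteq> {} \<and>
     plane_isometry h \<and>
     (\<forall>y\<in>region B. f y \<in> f ` region A \<longrightarrow> h y \<in> region A \<and> f (h y) = f y) \<and>
     region A \<inter> h ` region B = {x \<in> region A. f x \<in> f ` region B}"

text \<open>Strands crossing a common edge continue as strands, and the cells cut by the edge are
  completed to cells with the same strand uppermost on both faces.\<close>

definition matches_across_edges :: "prefabric \<Rightarrow> square set \<Rightarrow> (complex \<Rightarrow> real ^ 3) \<Rightarrow> bool" where
  "matches_across_edges P N f \<longleftrightarrow>
     (\<forall>A\<in>N. \<forall>B\<in>N. A \<noteq> B \<and> f ` region A \<inter> f ` region B \<noteq> {} \<longrightarrow>
        (\<exists>h. unfolding_isometry f A B h \<and>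
           (\<forall>t\<in>strands. interior t \<inter> {y \<in> region B. f y \<in> f ` region A} \<noteq> {} \<longrightarrow>
              h ` t \<in> strands) \<and>
           (\<forall>i j. interior (cell i j) \<inter> {y \<in> region B. f y \<in> f ` region A} \<noteq> {} \<longrightarrow>
              carries P h Keep i j)))"

definition woven_alike :: "prefabric \<Rightarrow> square set \<Rightarrow> bool" where
  "woven_alike P N \<longleftrightarrow>
     (\<forall>A\<in>N. \<forall>B\<in>N. \<exists>g\<in>planar_group P.
        ((\<exists>t. g = translation t) \<or> (\<exists>c u. norm u = 1 \<and> g = rotation c u)) \<and>
        g ` region A = region B)"

text \<open>The rotation \<open>\<rho>\<close> of the cube, expressed in the plane of the net, takes \<open>A\<close> to \<open>B\<close> by \<open>g\<close>.\<close>

definition induces ::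
  "(complex \<Rightarrow> real ^ 3) \<Rightarrow> real ^ 3 ^ 3 \<Rightarrow> square \<Rightarrow> square \<Rightarrow> (complex \<Rightarrow> complex) \<Rightarrow> bool" where
  "induces f \<rho> A B g \<longleftrightarrow>
     plane_isometry g \<and> g ` region A = region B \<and> (\<forall>x\<in>region A. f (g x) = \<rho> *v f x)"

definition weaving_invariant ::
  "prefabric \<Rightarrow> square set \<Rightarrow> (complex \<Rightarrow> real ^ 3) \<Rightarrow> real ^ 3 ^ 3 \<Rightarrow> side_action \<Rightarrow> bool" where
  "weaving_invariant P N f \<rho> \<epsilon> \<longleftrightarrow>
     (\<forall>A\<in>N. \<exists>B\<in>N. \<exists>g. induces f \<rho> A B g \<and>
        (\<forall>i j. interior (cell i j) \<inter> interior (region A) \<noteq> {} \<longrightarrow> carries P g \<epsilon> i j))"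

text \<open>A strand of the cube consists of pieces; the piece \<open>(A, t)\<close> is the part of the strand \<open>t\<close> of
  the plane in the region \<open>A\<close>.\<close>

definition pieces :: "square set \<Rightarrow> (square \<times> complex set) set" where
  "pieces N = {(A, t). A \<in> N \<and> t \<in> strands \<and> interior t \<inter> interior (region A) \<noteq> {}}"

definition continues ::
  "square set \<Rightarrow> (complex \<Rightarrow> real ^ 3) \<Rightarrow> square \<times> complex set \<Rightarrow> square \<times> complex set \<Rightarrow> bool"
  where
  "continues N f x y \<longleftrightarrow> x \<in> pieces N \<and> y \<in> pieces N \<and>
     (\<exists>h. unfolding_isometry f (fst x) (fst y) h \<and> h ` snd y = snd x \<and>
        interior (snd x) \<inter> (region (fst x) \<inter> h ` region (fst y)) \<noteq> {})"

definition cube_strands ::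
  "square set \<Rightarrow> (complex \<Rightarrow> real ^ 3) \<Rightarrow> (square \<times> complex set) set set" where
  "cube_strands N f = {{y. (continues N f)\<^sup>*\<^sup>* x y} | x. x \<in> pieces N}"

definition rotate_strand ::
  "square set \<Rightarrow> (complex \<Rightarrow> real ^ 3) \<Rightarrow> real ^ 3 ^ 3 \<Rightarrow>
     (square \<times> complex set) set \<Rightarrow> (square \<times> complex set) set" where
  "rotate_strand N f \<rho> S =
     {(B, g ` t) | A B g t. (A, t) \<in> S \<and> B \<in> N \<and> induces f \<rho> A B g}"

text \<open>Every rotation of the cube other than the identity is about a 4-fold, 3-fold or 2-fold axis.\<close>

definition isonemal_woven_cube ::
  "prefabric \<Rightarrow> square set \<Rightarrow> real \<Rightarrow> (complex \<Rightarrow> real ^ 3) \<Rightarrow> bool" where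
  "isonemal_woven_cube P N r f \<longleftrightarrow>
     net_folding N r f \<and>
     matches_across_edges P N f \<and>
     woven_alike P N \<and>
     (\<forall>\<rho>\<in>cube_rotations r. \<exists>\<epsilon>. weaving_invariant P N f \<rho> \<epsilon>) \<and>
     (\<forall>S\<in>cube_strands N f. \<forall>T\<in>cube_strands N f.
        \<exists>\<rho>\<in>cube_rotations r. rotate_strand N f \<rho> S = T) \<and>
     (\<forall>A\<in>N. quarter_turn (centre A) \<in> planar_group P \<and>
        (\<forall>m\<in>midpoints A. half_turn m \<in> planar_group P) \<and>
        corners A \<subseteq> cell_corners) \<and>
     rotation_centres P \<inter> (\<Union>A\<in>N. region A) \<subseteq>
        (\<Union>A\<in>N. {centre A} \<union> corners A \<union> midpoints A) \<and>
     (\<forall>A\<in>N. lattice_unit P A)"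

end

theory Submission
  imports Defs
begin

text \<open>Both sides of the equivalence say the same thing: \<open>P\<close> has a lattice unit
  \<open>(p, v)\<close> with all corners at cell corners and with preserving quarter-turns
  there. The quarter-turn centres form two classes under the translations, the corners and the
  centres of such a unit, and the kind of the quarter-turns at the centres is left free.

  A woven cube has preserving corners. At a vertex of the cube three regions meet. Follow the
  rotation of the cube about that vertex, which takes one face to the next, by laying the next
  face flat beside the first one: the result is a quarter-turn of the plane about the corner.
  Laying flat preserves the cells along the edge because the weaving matches there, and the
  rotation is preserving because its third power is the identity; so the quarter-turn is
  preserving (\<open>preserving_corner_of_woven_cube\<close>). This needs an edge that cuts the
  interior of a cell; since the order is greater than 4, the sides of units are not parallel to
  the strands.

  Preserving corners determine the species. The translations move a warp by multiples of the
  greatest common divisor of the components of \<open>v\<close>, and the half-turns contribute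
  one reflection of the warps, so isonemality makes this divisor 1 or 2
  (\<open>isonemal_gcd\<close>). The commutator of a quarter-turn with a translation is a
  preserving translation, so the order is at most 4 unless the components of \<open>v\<close>
  are non-zero and of different absolute value (\<open>nondegenerate_side\<close>). The divisor
  and the parities of the components then leave the levels 1 to 4. At level 1 the centre of the
  unit is a cell centre, and a quarter-turn there exchanges the two strands of a cell, so it is
  reversing. At level 2 the mid-points of the sides are cell centres, and half-turns there are
  preserving, so that the quarter-turn at the centre must be of the same kind as those at the
  corners. At levels 3 and 4 both kinds remain (\<open>species_of_preserving_corner\<close>).
  Conversely each of the five species has a unit with preserving corners, possibly after
  exchanging corners and centres (\<open>preserving_corner_of_species\<close>).

  A unit with preserving corners yields a woven cube. Colour the corners of the square grid of
  units like a chessboard, and the vertices of the cube by the two tetrahedra inscribed in it;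
  the folding of a cross of six units respects these colours. A motion of the group that keeps
  the colours is preserving, and all motions that exchange them are of one kind
  (\<open>move_kind\<close>). So the motions by which a rotation of the cube acts on the six
  faces are all of the kind that belongs to its effect on the tetrahedra
  (\<open>move_exists\<close>), and a motion that lays one face flat beside another is
  preserving, as it fixes a vertex of the cube (\<open>unfolding_exists\<close>). Finally,
  rolling the cube along a strand of the plane shows that a strand of the cube continues over
  its faces as the strand of the plane does over the units; so the transitivity of the group on
  the strands of the plane carries over to the cube (\<open>roll_along_strand\<close>,
  \<open>strands_transitive\<close>).\<close>

section \<open>Gaussian integers\<close>

lemma cell_corners_iff: "z \<in> cell_corners \<longleftrightarrow> Re z \<in> \<int> \<and> Im z \<in> \<int>"
  unfolding cell_corners_def by (auto simp: complex_eq_iff elim!: Ints_cases)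

lemma cell_corners_closed [simp, intro]:
  "0 \<in> cell_corners" "1 \<in> cell_corners" "\<i> \<in> cell_corners" "of_int m \<in> cell_corners"
  "a \<in> cell_corners \<Longrightarrow> - a \<in> cell_corners"
  "a \<in> cell_corners \<Longrightarrow> cnj a \<in> cell_corners"
  "a \<in> cell_corners \<Longrightarrow> b \<in> cell_corners \<Longrightarrow> a + b \<in> cell_corners"
  "a \<in> cell_corners \<Longrightarrow> b \<in> cell_corners \<Longrightarrow> a - b \<in> cell_corners"
  "a \<in> cell_corners \<Longrightarrow> b \<in> cell_corners \<Longrightarrow> a * b \<in> cell_corners"
  by (auto simp: cell_corners_iff)

lemma cell_centres_iff: "z \<in> cell_centres \<longleftrightarrow> Re z - 1/2 \<in> \<int> \<and> Im z - 1/2 \<in> \<int>"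
proof
  assume "Re z - 1/2 \<in> \<int> \<and> Im z - 1/2 \<in> \<int>"
  then obtain i j where "Re z - 1/2 = of_int i" "Im z - 1/2 = of_int j"
    by (auto elim!: Ints_cases)
  then have "z = Complex (of_int i + 1/2) (of_int j + 1/2)"
    by (simp add: complex_eq_iff)
  then show "z \<in> cell_centres"
    unfolding cell_centres_def by blast
qed (auto simp: cell_centres_def)

lemma square_lattice_eq: "square_lattice v = (\<lambda>q. q * v) ` cell_corners"
proof (intro subset_antisym subsetI)
  fix t assume "t \<in> square_lattice v"
  then obtain m n where "t = (of_int m + of_int n * \<i>) * v"
    unfolding square_lattice_def by (auto simp: algebra_simps)
  then show "t \<in> (\<lambda>q. q * v) ` cell_corners" by blast
next
  fix t assume "t \<in> (\<lambda>q. q * v) ` cell_corners"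
  then obtain m n where "t = Complex (of_int m) (of_int n) * v"
    unfolding cell_corners_def by blast
  then have "t = of_int m * v + of_int n * (\<i> * v)"
    by (simp add: Complex_eq algebra_simps)
  then show "t \<in> square_lattice v"
    unfolding square_lattice_def by blast
qed

definition units :: "complex set" where
  "units = {1, \<i>, -1, -\<i>}"

lemma units_closed [simp, intro]:
  "1 \<in> units" "\<i> \<in> units" "-1 \<in> units" "-\<i> \<in> units"
  "c \<in> units \<Longrightarrow> d \<in> units \<Longrightarrow> c * d \<in> units"
  "c \<in> units \<Longrightarrow> cnj c \<in> units"
  "c \<in> units \<Longrightarrow> - c \<in> units"
  by (auto simp: units_def)

lemma units_cnj [simp]: "c \<in> units \<Longrightarrow> c * cnj c = 1" "c \<in> units \<Longrightarrow> cnj c * c = 1"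
  by (auto simp: units_def)

lemma units_corner [simp, intro]: "c \<in> units \<Longrightarrow> c \<in> cell_corners"
  by (auto simp: units_def)

lemma units_norm [simp]: "c \<in> units \<Longrightarrow> norm c = 1"
  by (auto simp: units_def)

lemma units_nonzero [simp]: "c \<in> units \<Longrightarrow> c \<noteq> 0"
  by (auto simp: units_def)

lemma power_ii_units [simp, intro]: "\<i> ^ k \<in> units"
  by (induction k) auto

lemma units_power_ii: "c \<in> units \<Longrightarrow> \<exists>k. c = \<i> ^ k"
proof -
  have "\<i> ^ 0 = 1" "\<i> ^ 1 = \<i>" "\<i> ^ 2 = -1" "\<i> ^ 3 = -\<i>"
    by (auto simp: eval_nat_numeral)
  then show "c \<in> units \<Longrightarrow> \<exists>k. c = \<i> ^ k"
    unfolding units_def by (metis empty_iff insert_iff)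
qed

text \<open>This makes the choice of the base point of the group immaterial: moving the centre of a rotation
  by \<open>u\<close> through \<open>1/(1 - \<i>)\<close> times a lattice vector changes it by a
  lattice translation.\<close>

lemma units_diff_dvd: "c \<in> units \<Longrightarrow> \<exists>q\<in>cell_corners. 1 - c = (1 - \<i>) * q"
proof -
  assume "c \<in> units"
  moreover have "1 - 1 = (1 - \<i>) * 0" "1 - \<i> = (1 - \<i>) * 1" "1 - -1 = (1 - \<i>) * (1 + \<i>)"
    "1 - -\<i> = (1 - \<i>) * \<i>"
    by (auto simp: algebra_simps)
  ultimately show ?thesis
    unfolding units_def by (metis cell_corners_closed(1,2,3,7) empty_iff insert_iff)
qed

section \<open>Isometries of the plane\<close>

text \<open>Normalised to fix 0 and 1, the isometry preserves real parts, because the distances from 0 and 1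
  determine them, and imaginary parts up to sign. The sign is the same everywhere since the
  products of imaginary parts are preserved too.\<close>

lemma plane_isometry_form:
  assumes "plane_isometry g"
  obtains u b where "norm u = 1" "g = (\<lambda>z. u * z + b) \<or> g = (\<lambda>z. u * cnj z + b)"
proof -
  define u where "u = g 1 - g 0"
  have d: "norm (g x - g y) = norm (x - y)" for x y
    using assms by (simp add: plane_isometry_def dist_norm)
  have u: "norm u = 1"
    using d[of 1 0] by (simp add: u_def)
  define k where "k z = cnj u * (g z - g 0)" for z
  have cu: "cnj u * u = 1" "u * cnj u = 1"
    using u by (metis complex_norm_square mult.commute of_real_1 power_one)+
  have kd: "norm (k x - k y) = norm (x - y)" for x y
  proof -
    have "k x - k y = cnj u * (g x - g y)" by (simp add: k_def algebra_simps)
    then show ?thesis using d u by (simp add: norm_mult)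
  qed
  have k01: "k 0 = 0" "k 1 = 1"
    using cu by (auto simp: k_def u_def)
  have sq: "(Re (k x) - Re (k y))\<^sup>2 + (Im (k x) - Im (k y))\<^sup>2 = (Re x - Re y)\<^sup>2 + (Im x - Im y)\<^sup>2" for x y
    using kd[of x y] by (metis cmod_power2 minus_complex.simps)
  have re: "Re (k z) = Re z" and im: "(Im (k z))\<^sup>2 = (Im z)\<^sup>2" for z
  proof -
    have "(Re (k z))\<^sup>2 + (Im (k z))\<^sup>2 = (Re z)\<^sup>2 + (Im z)\<^sup>2"
      using sq[of z 0] k01 by simp
    moreover have "(Re (k z) - 1)\<^sup>2 + (Im (k z))\<^sup>2 = (Re z - 1)\<^sup>2 + (Im z)\<^sup>2"
      using sq[of z 1] k01 by simp
    ultimately show "Re (k z) = Re z" "(Im (k z))\<^sup>2 = (Im z)\<^sup>2"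
      by (auto simp: power2_eq_square algebra_simps)
  qed
  have g: "g z = u * k z + g 0" for z
    using cu by (simp add: k_def mult.assoc[symmetric])
  have imm: "Im (k x) * Im (k y) = Im x * Im y" for x y
    using sq[of x y] re[of x] re[of y] im[of x] im[of y]
    by (simp add: power2_eq_square algebra_simps)
  have "k \<i> = \<i> \<or> k \<i> = -\<i>"
    using re[of \<i>] im[of \<i>] by (auto simp: complex_eq_iff power2_eq_1_iff)
  then show thesis
  proof
    assume "k \<i> = \<i>"
    then have "k z = z" for z
      using re[of z] imm[of z \<i>] by (simp add: complex_eq_iff)
    then show thesis using that[of u "g 0"] u g by (metis ext)
  next
    assume "k \<i> = -\<i>"
    then have "k z = cnj z" for z
      using re[of z] imm[of z \<i>] by (simp add: complex_eq_iff)
    then show thesis using that[of u "g 0"] u g by (metis ext)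
  qed
qed

lemma plane_isometry_affine:
  assumes "norm u = 1" shows "plane_isometry (\<lambda>z. u * z + b)"
proof -
  have "u * x + b - (u * y + b) = u * (x - y)" for x y by (simp add: algebra_simps)
  then show ?thesis
    unfolding plane_isometry_def dist_norm using assms by (simp add: norm_mult)
qed

lemma plane_isometry_comp:
  "plane_isometry g \<Longrightarrow> plane_isometry h \<Longrightarrow> plane_isometry (g \<circ> h)"
  by (simp add: plane_isometry_def)

lemma plane_isometry_bij: assumes "plane_isometry g" shows "bij g"
proof (rule bijI)
  show "inj g" using assms unfolding plane_isometry_def inj_def by (metis dist_eq_0_iff)
  obtain u b where u: "norm u = 1" and g: "g = (\<lambda>z. u * z + b) \<or> g = (\<lambda>z. u * cnj z + b)"
    using plane_isometry_form[OF assms] .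
  have "u \<noteq> 0" using u by auto
  then have "g ((y - b) / u) = y \<or> g (cnj ((y - b) / u)) = y" for y
    using g by auto
  then show "surj g" by (metis surjI surj_def)
qed

lemma plane_isometry_ball:
  assumes "plane_isometry g" shows "g ` ball x e = ball (g x) e"
proof (intro subset_antisym subsetI)
  fix y assume "y \<in> ball (g x) e"
  moreover obtain z where "y = g z"
    using plane_isometry_bij[OF assms] by (metis bij_pointE)
  ultimately show "y \<in> g ` ball x e"
    using assms by (auto simp: plane_isometry_def)
qed (use assms in \<open>auto simp: plane_isometry_def\<close>)

lemma plane_isometry_interior:
  assumes "plane_isometry g" shows "interior (g ` X) = g ` interior X"
proof (intro subset_antisym subsetI)
  fix y assume "y \<in> interior (g ` X)"
  then obtain e where e: "e > 0" "ball y e \<subseteq> g ` X"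
    by (auto simp: mem_interior)
  obtain z where z: "y = g z"
    using plane_isometry_bij[OF assms] by (metis bij_pointE)
  have "g ` ball z e \<subseteq> g ` X"
    using e z plane_isometry_ball[OF assms] by auto
  then have "ball z e \<subseteq> X"
    using plane_isometry_bij[OF assms] by (simp add: bij_def inj_image_subset_iff)
  then have "z \<in> interior X"
    using e by (auto simp: mem_interior)
  then show "y \<in> g ` interior X"
    using z by blast
next
  fix y assume "y \<in> g ` interior X"
  then obtain z e where e: "e > 0" "ball z e \<subseteq> X" "y = g z"
    by (auto simp: mem_interior)
  then have "ball y e \<subseteq> g ` X"
    using plane_isometry_ball[OF assms, of z e] by blast
  then show "y \<in> interior (g ` X)"
    using e by (auto simp: mem_interior)
qed

section \<open>Symmetries of a prefabric\<close>

lemma warp_iff: "z \<in> warp i \<longleftrightarrow> of_int i \<le> Re z \<and> Re z \<le> of_int i + 1"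
  by (simp add: warp_def)

lemma weft_iff: "z \<in> weft j \<longleftrightarrow> of_int j \<le> Im z \<and> Im z \<le> of_int j + 1"
  by (simp add: weft_def)

lemma cell_iff: "z \<in> cell i j \<longleftrightarrow> z \<in> warp i \<and> z \<in> weft j"
  by (simp add: cell_def)

lemma warp_neq_weft: "warp i \<noteq> weft j"
proof -
  have "Complex (of_int i) (of_int j + 2) \<in> warp i" "Complex (of_int i) (of_int j + 2) \<notin> weft j"
    by (simp_all add: warp_iff weft_iff)
  then show ?thesis by blast
qed

lemma warp_inject: "warp i = warp i' \<longleftrightarrow> i = i'"
proof
  assume eq: "warp i = warp i'"
  have "of_int i \<in> warp i" "of_int i' \<in> warp i'" by (auto simp: warp_iff)
  then have "of_int i \<in> warp i'" "of_int i' \<in> warp i" using eq by blast+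
  then show "i = i'" by (simp add: warp_iff)
qed simp

lemma weft_inject: "weft j = weft j' \<longleftrightarrow> j = j'"
proof
  assume eq: "weft j = weft j'"
  have "Complex 0 (of_int j) \<in> weft j" "Complex 0 (of_int j') \<in> weft j'" by (auto simp: weft_iff)
  then have "Complex 0 (of_int j) \<in> weft j'" "Complex 0 (of_int j') \<in> weft j" using eq by blast+
  then show "j = j'" by (simp add: weft_iff)
qed simp

lemmas strand_inject [simp] = warp_inject weft_inject warp_neq_weft warp_neq_weft[symmetric]

lemma cell_inject [simp]: "cell i j = cell i' j' \<longleftrightarrow> i = i' \<and> j = j'"
proof
  assume eq: "cell i j = cell i' j'"
  have "Complex (of_int i) (of_int j) \<in> cell i j" "Complex (of_int i') (of_int j') \<in> cell i' j'"
    by (auto simp: cell_iff warp_iff weft_iff)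
  then have "Complex (of_int i) (of_int j) \<in> cell i' j'" "Complex (of_int i') (of_int j') \<in> cell i j"
    using eq by blast+
  then show "i = i' \<and> j = j'" by (simp add: cell_iff warp_iff weft_iff)
qed simp

text \<open>The two strands of a cell determine each other in metric terms: the weft consists of the points
  whose nearest point on the warp lies in the cell. Hence an isometry that maps the cell to a
  cell and one of its strands to a strand handles the other strand as well, which is what makes
  symmetries compose.\<close>

lemma nearest_warp:
  "weft j = {z. \<exists>c\<in>cell i j. \<forall>w\<in>warp i. dist z c \<le> dist z w}"
proof (intro subset_antisym subsetI)
  fix z assume z: "z \<in> weft j"
  define x where "x = max (of_int i) (min (Re z) (of_int i + 1))"
  have "dist z (Complex x (Im z)) \<le> dist z w" if "w \<in> warp i" for w
  proof -
    have "dist z (Complex x (Im z)) = \<bar>Re z - x\<bar>"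
      by (simp add: dist_norm cmod_def)
    also have "\<dots> \<le> \<bar>Re z - Re w\<bar>"
      using that by (auto simp: warp_iff x_def)
    also have "\<dots> \<le> dist z w"
      using abs_Re_le_cmod[of "z - w"] by (simp add: dist_norm)
    finally show ?thesis .
  qed
  moreover have "Complex x (Im z) \<in> cell i j"
    using z by (auto simp: cell_iff warp_iff weft_iff x_def)
  ultimately show "z \<in> {z. \<exists>c\<in>cell i j. \<forall>w\<in>warp i. dist z c \<le> dist z w}" by blast
next
  fix z assume "z \<in> {z. \<exists>c\<in>cell i j. \<forall>w\<in>warp i. dist z c \<le> dist z w}"
  then obtain c where c: "c \<in> cell i j" "\<forall>w\<in>warp i. dist z c \<le> dist z w" by blast
  then have "dist z c \<le> dist z (Complex (Re c) (Im z))"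
    by (auto simp: cell_iff warp_iff)
  also have "\<dots> = \<bar>Re z - Re c\<bar>"
    by (simp add: dist_norm cmod_def)
  finally have "(dist z c)\<^sup>2 \<le> (Re z - Re c)\<^sup>2"
    by (simp add: abs_le_square_iff[symmetric])
  then have "Im z = Im c"
    by (simp add: dist_norm cmod_power2 sum_power2_le_zero_iff)
  then show "z \<in> weft j" using c by (auto simp: cell_iff weft_iff)
qed

lemma nearest_weft:
  "warp i = {z. \<exists>c\<in>cell i j. \<forall>w\<in>weft j. dist z c \<le> dist z w}"
proof (intro subset_antisym subsetI)
  fix z assume z: "z \<in> warp i"
  define y where "y = max (of_int j) (min (Im z) (of_int j + 1))"
  have "dist z (Complex (Re z) y) \<le> dist z w" if "w \<in> weft j" for w
  proof -
    have "dist z (Complex (Re z) y) = \<bar>Im z - y\<bar>"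
      by (simp add: dist_norm cmod_def)
    also have "\<dots> \<le> \<bar>Im z - Im w\<bar>"
      using that by (auto simp: weft_iff y_def)
    also have "\<dots> \<le> dist z w"
      using abs_Im_le_cmod[of "z - w"] by (simp add: dist_norm)
    finally show ?thesis .
  qed
  moreover have "Complex (Re z) y \<in> cell i j"
    using z by (auto simp: cell_iff warp_iff weft_iff y_def)
  ultimately show "z \<in> {z. \<exists>c\<in>cell i j. \<forall>w\<in>weft j. dist z c \<le> dist z w}" by blast
next
  fix z assume "z \<in> {z. \<exists>c\<in>cell i j. \<forall>w\<in>weft j. dist z c \<le> dist z w}"
  then obtain c where c: "c \<in> cell i j" "\<forall>w\<in>weft j. dist z c \<le> dist z w" by blast
  then have "dist z c \<le> dist z (Complex (Re z) (Im c))"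
    by (auto simp: cell_iff weft_iff)
  also have "\<dots> = \<bar>Im z - Im c\<bar>"
    by (simp add: dist_norm cmod_def)
  finally have "(dist z c)\<^sup>2 \<le> (Im z - Im c)\<^sup>2"
    by (simp add: abs_le_square_iff[symmetric])
  then have "Re z = Re c"
    by (simp add: dist_norm cmod_power2 sum_power2_le_zero_iff)
  then show "z \<in> warp i" using c by (auto simp: cell_iff warp_iff)
qed

definition nearest :: "complex set \<Rightarrow> complex set \<Rightarrow> complex set" where
  "nearest C U = {z. \<exists>c\<in>C. \<forall>w\<in>U. dist z c \<le> dist z w}"

lemma nearest_strand:
  "nearest (cell i j) (uppermost P i j) = lowermost P i j"
  "nearest (cell i j) (lowermost P i j) = uppermost P i j"
  unfolding nearest_def uppermost_def lowermost_def
  using nearest_warp[of j i] nearest_weft[of i j] by auto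

lemma nearest_isometry:
  assumes "plane_isometry g"
  shows "nearest (g ` C) (g ` U) = g ` nearest C U"
proof -
  have d: "dist (g x) (g y) = dist x y" for x y
    using assms by (simp add: plane_isometry_def)
  show ?thesis
  proof (intro subset_antisym subsetI)
    fix y assume y: "y \<in> nearest (g ` C) (g ` U)"
    obtain z where "y = g z"
      using plane_isometry_bij[OF assms] by (metis bij_pointE)
    with y show "y \<in> g ` nearest C U"
      by (auto simp: nearest_def d)
  next
    fix y assume "y \<in> g ` nearest C U"
    then obtain z c where "y = g z" "c \<in> C" "\<forall>w\<in>U. dist z c \<le> dist z w"
      by (auto simp: nearest_def)
    then have "g c \<in> g ` C" "\<forall>w\<in>g ` U. dist y (g c) \<le> dist y w" by (auto simp: d)
    then show "y \<in> nearest (g ` C) (g ` U)" unfolding nearest_def by blast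
  qed
qed

definition kind_comp :: "side_action \<Rightarrow> side_action \<Rightarrow> side_action" where
  "kind_comp \<epsilon> \<epsilon>' = (if \<epsilon> = \<epsilon>' then Keep else Tau)"

lemma kind_comp_simps [simp]:
  "kind_comp Keep \<epsilon> = \<epsilon>" "kind_comp \<epsilon> Keep = \<epsilon>" "kind_comp \<epsilon> \<epsilon> = Keep" "kind_comp \<epsilon> (kind_comp \<epsilon> \<epsilon>') = \<epsilon>'"
  by (cases \<epsilon>; cases \<epsilon>'; simp add: kind_comp_def)+

lemma upper_neq_lower [simp]: "uppermost P i j \<noteq> lowermost P i j" "lowermost P i j \<noteq> uppermost P i j"
  by (auto simp: uppermost_def lowermost_def)

lemma carriesE:
  assumes "carries P g \<epsilon> i j" "plane_isometry g"
  obtains i' j' where "g ` cell i j = cell i' j'"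
    "g ` uppermost P i j = (case \<epsilon> of Keep \<Rightarrow> uppermost P i' j' | Tau \<Rightarrow> lowermost P i' j')"
    "g ` lowermost P i j = (case \<epsilon> of Keep \<Rightarrow> lowermost P i' j' | Tau \<Rightarrow> uppermost P i' j')"
proof -
  obtain i' j' where *: "g ` cell i j = cell i' j'"
    "g ` uppermost P i j = (case \<epsilon> of Keep \<Rightarrow> uppermost P i' j' | Tau \<Rightarrow> lowermost P i' j')"
    using assms unfolding carries_def by blast
  have "g ` lowermost P i j = nearest (g ` cell i j) (g ` uppermost P i j)"
    using nearest_isometry[OF assms(2)] nearest_strand by metis
  also have "\<dots> = (case \<epsilon> of Keep \<Rightarrow> lowermost P i' j' | Tau \<Rightarrow> uppermost P i' j')"
    using * nearest_strand by (cases \<epsilon>) simp_all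
  finally show thesis using that * by blast
qed

lemma carries_comp:
  assumes "plane_isometry g" "plane_isometry h"
    and "carries P g \<epsilon> i j" "g ` cell i j = cell i' j'" "carries P h \<epsilon>' i' j'"
  shows "carries P (h \<circ> g) (kind_comp \<epsilon>' \<epsilon>) i j"
proof -
  have 1: "g ` uppermost P i j = (case \<epsilon> of Keep \<Rightarrow> uppermost P i' j' | Tau \<Rightarrow> lowermost P i' j')"
    using assms(3,4) unfolding carries_def by auto
  obtain i'' j'' where 2: "h ` cell i' j' = cell i'' j''"
    "h ` uppermost P i' j' = (case \<epsilon>' of Keep \<Rightarrow> uppermost P i'' j'' | Tau \<Rightarrow> lowermost P i'' j'')"
    "h ` lowermost P i' j' = (case \<epsilon>' of Keep \<Rightarrow> lowermost P i'' j'' | Tau \<Rightarrow> uppermost P i'' j'')"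
    using carriesE[OF assms(5,2)] by metis
  have "(h \<circ> g) ` cell i j = cell i'' j''"
    using assms(4) 2(1) by (metis image_comp)
  moreover have "(h \<circ> g) ` uppermost P i j =
      (case kind_comp \<epsilon>' \<epsilon> of Keep \<Rightarrow> uppermost P i'' j'' | Tau \<Rightarrow> lowermost P i'' j'')"
    unfolding image_comp[symmetric] using 1 2(2,3) by (cases \<epsilon>; cases \<epsilon>') (simp_all add: kind_comp_def del: image_comp image_image)
  ultimately show ?thesis unfolding carries_def by blast
qed

lemma carries_unique:
  assumes "carries P g \<epsilon> i j" "carries P g \<epsilon>' i j" shows "\<epsilon> = \<epsilon>'"
  using assms unfolding carries_def by (cases \<epsilon>; cases \<epsilon>') auto

lemma carries_id: "carries P id Keep i j"
  unfolding carries_def by auto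

lemma symmetriesD:
  assumes "(g, \<epsilon>) \<in> symmetries P"
  shows "plane_isometry g" "(\<lambda>c. g ` c) ` cells = cells" "carries P g \<epsilon> i j" "g \<in> planar_group P"
  using assms by (auto simp: symmetries_def planar_group_def image_iff) 

lemma symmetries_comp:
  assumes "(g, \<epsilon>) \<in> symmetries P" "(h, \<epsilon>') \<in> symmetries P"
  shows "(h \<circ> g, kind_comp \<epsilon>' \<epsilon>) \<in> symmetries P"
proof -
  note g = symmetriesD[OF assms(1)] and h = symmetriesD[OF assms(2)]
  have "(\<lambda>c. (h \<circ> g) ` c) ` cells = (\<lambda>c. h ` c) ` ((\<lambda>c. g ` c) ` cells)"
    by (simp add: image_image)
  then have "(\<lambda>c. (h \<circ> g) ` c) ` cells = cells"
    using g(2) h(2) by simp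
  moreover have "carries P (h \<circ> g) (kind_comp \<epsilon>' \<epsilon>) i j" for i j
  proof -
    obtain i' j' where "g ` cell i j = cell i' j'"
      using carriesE[OF g(3,1)] by metis
    then show ?thesis using carries_comp[OF g(1) h(1) g(3) _ h(3)] by blast
  qed
  ultimately show ?thesis
    using plane_isometry_comp[OF h(1) g(1)] by (auto simp: symmetries_def)
qed

lemma symmetries_unique:
  "(g, \<epsilon>) \<in> symmetries P \<Longrightarrow> (g, \<epsilon>') \<in> symmetries P \<Longrightarrow> \<epsilon> = \<epsilon>'"
  using symmetriesD(3) carries_unique by metis

lemma symmetries_id: "(id, Keep) \<in> symmetries P"
  by (auto simp: symmetries_def plane_isometry_def carries_id)

lemma planar_groupE:
  assumes "g \<in> planar_group P" obtains \<epsilon> where "(g, \<epsilon>) \<in> symmetries P"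
  using assms by (auto simp: planar_group_def)

lemma planar_group_iso: "g \<in> planar_group P \<Longrightarrow> plane_isometry g"
  by (metis planar_groupE symmetriesD(1))

text \<open>The composite with the inverse is the identity, which is preserving; so the inverse can only
  have the kind of \<open>g\<close>.\<close>

lemma symmetries_inverse:
  assumes "(g, \<epsilon>) \<in> symmetries P" "h \<in> planar_group P" "h \<circ> g = id"
  shows "(h, \<epsilon>) \<in> symmetries P"
proof -
  obtain \<epsilon>' where h: "(h, \<epsilon>') \<in> symmetries P" using assms planar_groupE by metis
  have "(id, kind_comp \<epsilon>' \<epsilon>) \<in> symmetries P" using symmetries_comp[OF assms(1) h] assms(3) by simp
  then have "kind_comp \<epsilon>' \<epsilon> = Keep" using symmetries_id symmetries_unique by metis
  then have "\<epsilon>' = \<epsilon>" by (auto simp: kind_comp_def split: if_splits)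
  then show ?thesis using h by simp
qed

text \<open>Every strand is uppermost or lowermost at some cell.\<close>

lemma planar_group_strands:
  assumes "g \<in> planar_group P" "t \<in> strands" shows "g ` t \<in> strands"
proof -
  obtain \<epsilon> where g: "(g, \<epsilon>) \<in> symmetries P" using assms planar_groupE by metis
  have t: "\<exists>i j. t = uppermost P i j \<or> t = lowermost P i j"
    using assms(2) unfolding strands_def uppermost_def lowermost_def
    by (auto split: if_splits)
  have s: "uppermost P i j \<in> strands" "lowermost P i j \<in> strands" for i j
    by (auto simp: strands_def uppermost_def lowermost_def)
  obtain i j where "t = uppermost P i j \<or> t = lowermost P i j" using t by blast
  then show ?thesis
    using carriesE[OF symmetriesD(3)[OF g] symmetriesD(1)[OF g], of i j] s
    by (cases \<epsilon>) (metis side_action.case)+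
qed

section \<open>The planar group of a lattice unit\<close>

text \<open>The group is given with some centre \<open>c\<close> of quarter-turns. As the quarter-turn about
  \<open>p\<close> belongs to it, \<open>(1 - \<i>) * (c - p)\<close> is a lattice vector, and
  hence so is \<open>(1 - u) * (c - p)\<close> for every unit \<open>u\<close>; so
  \<open>p\<close> can take the place of \<open>c\<close>.\<close>

lemma planar_group_lattice_unit:
  assumes "lattice_unit P (p, v)"
  shows "planar_group P = {\<lambda>z. p + u * (z - p) + q * v | u q. u \<in> units \<and> q \<in> cell_corners}"
proof -
  obtain c w where w: "w \<noteq> 0" and
    G: "planar_group P = {translation t \<circ> rotation c (\<i> ^ k) | t k. t \<in> square_lattice w}"
    using assms unfolding lattice_unit_def type_p4_def by blast
  have T: "{t. translation t \<in> planar_group P} = square_lattice v"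
    and Q: "quarter_turn p \<in> planar_group P"
    using assms by (auto simp: lattice_unit_def corners_def)
  have G': "g \<in> planar_group P \<longleftrightarrow> (\<exists>t u. g = (\<lambda>z. c + u * (z - c) + t) \<and> u \<in> units \<and> t \<in> square_lattice w)" for g
    unfolding G translation_def rotation_def comp_def using units_power_ii power_ii_units by blast
  have "translation t \<in> planar_group P \<longleftrightarrow> t \<in> square_lattice w" for t
  proof
    assume "translation t \<in> planar_group P"
    then obtain t' u where e: "(\<lambda>z. z + t) = (\<lambda>z. c + u * (z - c) + t')" "t' \<in> square_lattice w"
      unfolding G' translation_def by blast
    have "c + t = c + t'" using fun_cong[OF e(1), of c] by simp
    then show "t \<in> square_lattice w" using e by simp
  next
    assume "t \<in> square_lattice w"
    then show "translation t \<in> planar_group P"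
      unfolding G' translation_def by (intro exI[of _ t] exI[of _ 1]) (auto simp: algebra_simps)
  qed
  then have lat: "square_lattice w = square_lattice v" using T by auto
  obtain u0 t0 where e: "(\<lambda>z. p + \<i> * (z - p)) = (\<lambda>z. c + u0 * (z - c) + t0)" "t0 \<in> square_lattice v"
    using Q unfolding G' rotation_def lat by blast
  have e': "p + \<i> * (z - p) = c + u0 * (z - c) + t0" for z using fun_cong[OF e(1)] .
  have "u0 = \<i>" using e'[of 1] e'[of 0] by (auto simp: algebra_simps)
  then have pc: "(1 - \<i>) * (c - p) + t0 = 0" using e'[of c] by (simp add: algebra_simps)
  obtain q0 where q0: "q0 \<in> cell_corners" "t0 = q0 * v" using e(2) by (auto simp: square_lattice_eq)
  have cp: "\<exists>q\<in>cell_corners. (1 - u) * (c - p) = q * v" if u: "u \<in> units" for u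
  proof -
    obtain q where q: "q \<in> cell_corners" "1 - u = (1 - \<i>) * q" using units_diff_dvd u by blast
    have "(1 - u) * (c - p) = q * ((1 - \<i>) * (c - p))" using q by simp
    also have "(1 - \<i>) * (c - p) = - q0 * v" using pc q0 by (simp add: eq_neg_iff_add_eq_0)
    finally have "(1 - u) * (c - p) = (q * (- q0)) * v" by simp
    then show ?thesis using q q0 by blast
  qed
  show ?thesis
  proof (intro subset_antisym subsetI)
    fix g assume "g \<in> planar_group P"
    then obtain t u where g: "g = (\<lambda>z. c + u * (z - c) + t)" "u \<in> units" "t \<in> square_lattice v"
      unfolding G' lat by blast
    then obtain q where q: "q \<in> cell_corners" "t = q * v" by (auto simp: square_lattice_eq)
    obtain q' where q': "q' \<in> cell_corners" "(1 - u) * (c - p) = q' * v" using cp g by blast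
    have "g = (\<lambda>z. p + u * (z - p) + (q + q') * v)"
    proof
      fix z
      have "g z = p + u * (z - p) + ((1 - u) * (c - p) + t)" by (simp add: g algebra_simps)
      then show "g z = p + u * (z - p) + (q + q') * v" unfolding q'(2) q(2) by (simp add: algebra_simps)
    qed
    then show "g \<in> {\<lambda>z. p + u * (z - p) + q * v | u q. u \<in> units \<and> q \<in> cell_corners}"
      using g q q' by blast
  next
    fix g assume "g \<in> {\<lambda>z. p + u * (z - p) + q * v | u q. u \<in> units \<and> q \<in> cell_corners}"
    then obtain u q where g: "g = (\<lambda>z. p + u * (z - p) + q * v)" "u \<in> units" "q \<in> cell_corners" by blast
    obtain q' where q': "q' \<in> cell_corners" "(1 - u) * (c - p) = q' * v" using cp g by blast
    have "g = (\<lambda>z. c + u * (z - c) + (q - q') * v)"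
    proof
      fix z
      have "g z = c + u * (z - c) + (q * v - (1 - u) * (c - p))" by (simp add: g algebra_simps)
      then show "g z = c + u * (z - c) + (q - q') * v" unfolding q'(2) by (simp add: algebra_simps)
    qed
    moreover have "(q - q') * v \<in> square_lattice v" using g q' by (auto simp: square_lattice_eq)
    ultimately show "g \<in> planar_group P" unfolding G' lat using g by blast
  qed
qed

lemma planar_groupI:
  assumes "lattice_unit P (p, v)" "u \<in> units" "q \<in> cell_corners" "\<And>z. g z = p + u * (z - p) + q * v"
  shows "g \<in> planar_group P"
  unfolding planar_group_lattice_unit[OF assms(1)] using assms(2-4) by blast

lemma planar_groupD:
  assumes "lattice_unit P (p, v)" "g \<in> planar_group P"
  obtains u q where "u \<in> units" "q \<in> cell_corners" "\<And>z. g z = p + u * (z - p) + q * v"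
  using assms(2) unfolding planar_group_lattice_unit[OF assms(1)] by blast

lemma lattice_unit_nonzero: "lattice_unit P (p, v) \<Longrightarrow> v \<noteq> 0"
  by (simp add: lattice_unit_def)

lemma translation_in_group_iff:
  assumes "lattice_unit P (p, v)"
  shows "translation t \<in> planar_group P \<longleftrightarrow> (\<exists>q\<in>cell_corners. t = q * v)"
  using assms by (auto simp: lattice_unit_def square_lattice_eq)

text \<open>The quarter-turn centres form a lattice spanned by half a diagonal of the unit: a quarter-turn
  about \<open>c\<close> is \<open>z \<mapsto> p + \<i> * (z - p)\<close> followed by the
  translation by \<open>(1 - \<i>) * (c - p)\<close>, and
  \<open>(1 - \<i>) * (1 + \<i>) / 2 = 1\<close>.\<close>

lemma quarter_turn_in_group_iff:
  assumes "lattice_unit P (p, v)"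
  shows "quarter_turn c \<in> planar_group P \<longleftrightarrow> (\<exists>q\<in>cell_corners. c = p + q * ((1 + \<i>) / 2 * v))"
proof
  assume "quarter_turn c \<in> planar_group P"
  then obtain u q where u: "u \<in> units" and q: "q \<in> cell_corners"
    and e: "\<And>z. c + \<i> * (z - c) = p + u * (z - p) + q * v"
    using planar_groupD[OF assms] unfolding rotation_def by metis
  have "u = \<i>" using e[of 1] e[of 0] by (auto simp: algebra_simps)
  then have "(1 - \<i>) * (c - p) = q * v" using e[of p] by (simp add: algebra_simps)
  then have "(1 + \<i>) / 2 * ((1 - \<i>) * (c - p)) = (1 + \<i>) / 2 * (q * v)" by simp
  also have "(1 + \<i>) / 2 * ((1 - \<i>) * (c - p)) = c - p"
    by (simp add: complex_eq_iff field_simps)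
  finally have "c = p + (1 + \<i>) / 2 * (q * v)" by (metis add.commute diff_add_cancel)
  then have "c = p + q * ((1 + \<i>) / 2 * v)" by (simp only: mult.left_commute)
  then show "\<exists>q\<in>cell_corners. c = p + q * ((1 + \<i>) / 2 * v)" using q by blast
next
  assume "\<exists>q\<in>cell_corners. c = p + q * ((1 + \<i>) / 2 * v)"
  then obtain q where q: "q \<in> cell_corners" "c = p + q * ((1 + \<i>) / 2 * v)" by blast
  have "(1 - \<i>) * ((1 + \<i>) / 2) = 1" by (simp add: algebra_simps complex_eq_iff)
  then have "(1 - \<i>) * (c - p) = q * v" using q by (simp add: mult.left_commute mult.assoc[symmetric])
  then have "rotation c \<i> z = p + \<i> * (z - p) + q * v" for z
    by (simp add: rotation_def algebra_simps)
  then show "quarter_turn c \<in> planar_group P" using planar_groupI[OF assms _ q(1)] by blast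
qed

text \<open>Any quarter-turn centre will do as a corner; odd \<open>q\<close> exchanges the two classes of
  centres.\<close>

lemma lattice_unitI:
  assumes "lattice_unit P (p, v)" "q \<in> cell_corners"
  shows "lattice_unit P (p + q * ((1 + \<i>) / 2 * v), v)"
proof -
  have "\<exists>q'\<in>cell_corners. c = p + q' * ((1 + \<i>) / 2 * v)"
    if "c \<in> corners (p + q * ((1 + \<i>) / 2 * v), v)" for c
  proof -
    have *: "v = (1 - \<i>) * ((1 + \<i>) / 2 * v)" by (simp add: algebra_simps complex_eq_iff)
    have "\<exists>d\<in>cell_corners. c = p + q * ((1 + \<i>) / 2 * v) + d * v"
      using that unfolding corners_def
      by (auto intro: bexI[of _ 0] bexI[of _ 1] bexI[of _ \<i>] bexI[of _ "1 + \<i>"] simp: algebra_simps)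
    then obtain d where d: "d \<in> cell_corners" "c = p + q * ((1 + \<i>) / 2 * v) + d * v" by blast
    have "d * v = d * (1 - \<i>) * ((1 + \<i>) / 2 * v)" using * by (metis mult.assoc)
    then have "c = p + (q + d * (1 - \<i>)) * ((1 + \<i>) / 2 * v)"
      using d by (simp only: distrib_right add.assoc)
    moreover have "q + d * (1 - \<i>) \<in> cell_corners" using assms(2) d by auto
    ultimately show ?thesis by blast
  qed
  then show ?thesis
    using assms(1) quarter_turn_in_group_iff[OF assms(1)] by (auto simp: lattice_unit_def)
qed

text \<open>The translation is the commutator of the quarter-turn about \<open>p\<close> with the
  translation by \<open>q * v\<close>. Each of the two occurs twice, so its kind cancels.\<close>

lemma even_translation_preserving:
  assumes "lattice_unit P (p, v)" "q \<in> cell_corners"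
  shows "(translation ((\<i> - 1) * q * v), Keep) \<in> symmetries P"
proof -
  have "quarter_turn p \<in> planar_group P"
    using assms by (auto simp: lattice_unit_def corners_def)
  then obtain \<epsilon> where Q: "(quarter_turn p, \<epsilon>) \<in> symmetries P" using planar_groupE by metis
  have Q': "(rotation p (-\<i>), \<epsilon>) \<in> symmetries P"
    using Q by (rule symmetries_inverse)
      (auto simp: rotation_def fun_eq_iff algebra_simps intro!: planar_groupI[OF assms(1), of "-\<i>" 0])
  obtain \<epsilon>' where T: "(translation (q * v), \<epsilon>') \<in> symmetries P"
    using translation_in_group_iff[OF assms(1)] assms(2) planar_groupE by metis
  have "translation (- q * v) \<in> planar_group P"
    using translation_in_group_iff[OF assms(1)] assms(2) by blast
  then have T': "(translation (- q * v), \<epsilon>') \<in> symmetries P"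
    using T by (intro symmetries_inverse[OF T]) (auto simp: translation_def)
  have "(quarter_turn p \<circ> (translation (q * v) \<circ> (rotation p (-\<i>) \<circ> translation (- q * v))),
      kind_comp \<epsilon> (kind_comp \<epsilon>' (kind_comp \<epsilon> \<epsilon>'))) \<in> symmetries P"
    by (intro symmetries_comp Q Q' T T')
  moreover have "kind_comp \<epsilon> (kind_comp \<epsilon>' (kind_comp \<epsilon> \<epsilon>')) = Keep"
    by (cases \<epsilon>; cases \<epsilon>') (auto simp: kind_comp_def)
  moreover have "quarter_turn p \<circ> (translation (q * v) \<circ> (rotation p (-\<i>) \<circ> translation (- q * v)))
      = translation ((\<i> - 1) * q * v)"
    by (auto simp: rotation_def translation_def fun_eq_iff algebra_simps)
  ultimately show ?thesis by simp
qed

text \<open>Conjugation by a translation does not change the kind.\<close>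

lemma preserving_translate:
  assumes "lattice_unit P (p, v)" "q \<in> cell_corners" "(quarter_turn c, \<epsilon>) \<in> symmetries P"
  shows "(quarter_turn (c + q * v), \<epsilon>) \<in> symmetries P"
proof -
  obtain \<epsilon>' where T: "(translation (q * v), \<epsilon>') \<in> symmetries P"
    using translation_in_group_iff[OF assms(1)] assms(2) planar_groupE by metis
  have "translation (- q * v) \<in> planar_group P"
    using translation_in_group_iff[OF assms(1)] assms(2) by blast
  then have T': "(translation (- q * v), \<epsilon>') \<in> symmetries P"
    using T by (intro symmetries_inverse[OF T]) (auto simp: translation_def)
  have "(translation (q * v) \<circ> (quarter_turn c \<circ> translation (- q * v)),
      kind_comp \<epsilon>' (kind_comp \<epsilon> \<epsilon>')) \<in> symmetries P"
    by (intro symmetries_comp assms T T')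
  moreover have "kind_comp \<epsilon>' (kind_comp \<epsilon> \<epsilon>') = \<epsilon>"
    by (cases \<epsilon>; cases \<epsilon>') (auto simp: kind_comp_def)
  moreover have "translation (q * v) \<circ> (quarter_turn c \<circ> translation (- q * v))
      = quarter_turn (c + q * v)"
    by (auto simp: rotation_def translation_def fun_eq_iff algebra_simps)
  ultimately show ?thesis by simp
qed

section \<open>The side and the level of a lattice unit\<close>

lemma translation_cell:
  "translation (of_int k) ` cell i j = cell (i + k) j"
  "translation (of_int k) ` warp i = warp (i + k)" "translation (of_int k) ` weft j = weft j"
  "translation (\<i> * of_int k) ` cell i j = cell i (j + k)"
  "translation (\<i> * of_int k) ` warp i = warp i" "translation (\<i> * of_int k) ` weft j = weft (j + k)"
proof -
  have *: "translation t ` X = {z. z - t \<in> X}" for t X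
    unfolding translation_def by (auto simp: image_iff) (metis diff_add_cancel)
  show "translation (of_int k) ` cell i j = cell (i + k) j"
    "translation (of_int k) ` warp i = warp (i + k)" "translation (of_int k) ` weft j = weft j"
    "translation (\<i> * of_int k) ` cell i j = cell i (j + k)"
    "translation (\<i> * of_int k) ` warp i = warp i" "translation (\<i> * of_int k) ` weft j = weft (j + k)"
    unfolding * by (auto simp: cell_iff warp_iff weft_iff)
qed

lemma repeats_everyI:
  assumes "(translation (of_int k), Keep) \<in> symmetries P" "(translation (\<i> * of_int k), Keep) \<in> symmetries P"
    "k = int m"
  shows "repeats_every P m"
proof -
  have "P (i + k) j = P i j" for i j
  proof -
    obtain i' j' where "translation (of_int k) ` cell i j = cell i' j'"
      "translation (of_int k) ` uppermost P i j = uppermost P i' j'"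
      using symmetriesD(3)[OF assms(1), of i j] unfolding carries_def by auto
    then show ?thesis
      unfolding uppermost_def by (auto simp: translation_cell split: if_splits)
  qed
  moreover have "P i (j + k) = P i j" for i j
  proof -
    obtain i' j' where "translation (\<i> * of_int k) ` cell i j = cell i' j'"
      "translation (\<i> * of_int k) ` uppermost P i j = uppermost P i' j'"
      using symmetriesD(3)[OF assms(2), of i j] unfolding carries_def by auto
    then show ?thesis
      unfolding uppermost_def by (auto simp: translation_cell split: if_splits)
  qed
  ultimately show ?thesis using assms(3) by (simp add: repeats_every_def)
qed

text \<open>The preserving translations of the commutator argument include those by \<open>2 * k\<close>
  along the warps and the wefts, as \<open>(\<i> - 1) * (- 1 - \<i>) = 2\<close>.\<close>

lemma order_le:
  assumes "lattice_unit P (p, v)" "has_order P n"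
    and "c \<in> units" "k > 0" "v = of_nat k * c \<or> v = of_nat k * c * (1 + \<i>)"
  shows "n \<le> 2 * k"
proof -
  obtain q where q: "q \<in> cell_corners" "(\<i> - 1) * q * v = of_int (int (2 * k))"
  proof (cases "v = of_nat k * c")
    case True
    have "(\<i> - 1) * ((- 1 - \<i>) * cnj c) * v = (\<i> - 1) * (- 1 - \<i>) * (c * cnj c) * of_nat k"
      using True by (simp only: mult_ac)
    also have "\<dots> = of_int (int (2 * k))" using assms(3) by (simp add: algebra_simps)
    finally show thesis using that[of "(- 1 - \<i>) * cnj c"] assms(3) by auto
  next
    case False
    then have "v = of_nat k * c * (1 + \<i>)" using assms(5) by blast
    then have "(\<i> - 1) * (- cnj c) * v = - ((\<i> - 1) * (1 + \<i>) * (c * cnj c) * of_nat k)"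
      by simp
    also have "\<dots> = of_int (int (2 * k))" using assms(3) by (simp add: algebra_simps)
    finally show thesis using that[of "- cnj c"] assms(3) by auto
  qed
  have "(translation (of_int (int (2 * k))), Keep) \<in> symmetries P"
    using even_translation_preserving[OF assms(1) q(1)] q(2) by simp
  moreover have "(\<i> - 1) * (\<i> * q) * v = \<i> * of_int (int (2 * k))"
    unfolding q(2)[symmetric] by (simp only: mult_ac)
  then have "(translation (\<i> * of_int (int (2 * k))), Keep) \<in> symmetries P"
    using even_translation_preserving[OF assms(1), of "\<i> * q"] q(1) by (metis cell_corners_closed(3,9))
  ultimately have "repeats_every P (2 * k)"
    using repeats_everyI by blast
  then show ?thesis
    using assms(2,4) by (simp add: has_order_def)
qed

text \<open>Translations and half-turns are the elements of the group that take warps to warps. With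
  \<open>d\<close> the divisor, the translations take warp 0 to the warps divisible by
  \<open>d\<close>, and the half-turns, which are translations after the half-turn about
  \<open>p\<close>, to those congruent to \<open>2 * Re p - 1\<close>. Two classes modulo
  \<open>d\<close> cover all warps only if \<open>d \<le> 2\<close>.\<close>

lemma isonemal_gcd:
  assumes "lattice_unit P (p, v)" "p \<in> cell_corners" "v = Complex (of_int a) (of_int b)" "isonemal P"
  shows "gcd a b \<in> {1, 2}"
proof -
  define d where "d = gcd a b"
  obtain x where x: "Re p = of_int x" using assms(2) by (auto simp: cell_corners_iff elim!: Ints_cases)
  have "d \<noteq> 0"
    using lattice_unit_nonzero[OF assms(1)] assms(3) by (auto simp: d_def complex_eq_iff)
  have re: "\<exists>m. Re (q * v) = of_int m \<and> d dvd m" if q: "q \<in> cell_corners" for q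
  proof -
    obtain i j where "q = Complex (of_int i) (of_int j)" using q unfolding cell_corners_def by blast
    then have "Re (q * v) = of_int (i * a - j * b)" using assms(3) by simp
    moreover have "d dvd i * a - j * b" by (simp add: d_def)
    ultimately show ?thesis by blast
  qed
  have *: "d dvd i \<or> d dvd i + 1 - 2 * x" for i
  proof -
    obtain g where g: "g \<in> planar_group P" "g ` warp 0 = warp i"
      using assms(4) unfolding isonemal_def strands_def by blast
    obtain u q where u: "u \<in> units" and q: "q \<in> cell_corners"
      and e: "\<And>z. g z = p + u * (z - p) + q * v"
      using planar_groupD[OF assms(1) g(1)] by metis
    obtain m where m: "Re (q * v) = of_int m" "d dvd m" using re[OF q] by blast
    have w: "of_int i \<le> Re (g z) \<and> Re (g z) \<le> of_int i + 1" if "0 \<le> Re z" "Re z \<le> 1" for z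
    proof -
      have "z \<in> warp 0" using that by (simp add: warp_iff)
      then have "g z \<in> warp i" using g(2) by blast
      then show ?thesis by (simp add: warp_iff)
    qed
    consider "u = 1" | "u = -1" | "u = \<i>" | "u = -\<i>" using u by (auto simp: units_def)
    then show ?thesis
    proof cases
      case 1
      have "real_of_int i = of_int m" using w[of 0] w[of 1] m by (simp add: e 1)
      then show ?thesis using m by simp
    next
      case 2
      have "real_of_int i + 1 = of_int m + 2 * of_int x" using w[of 0] w[of 1] m x by (simp add: e 2)
      then have "i + 1 - 2 * x = m" by linarith
      then show ?thesis using m by simp
    next
      case 3
      have False using w[of "of_real (Re (g 0) - of_int i + 2) * \<i>"] by (simp add: e 3 algebra_simps)
      then show ?thesis ..
    next
      case 4
      have False using w[of "of_real (of_int i + 2 - Re (g 0)) * \<i>"] by (simp add: e 4 algebra_simps)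
      then show ?thesis ..
    qed
  qed
  have "d dvd 1 \<or> d dvd 2"
    using *[of 1] *[of 2] dvd_diff[of d "2 + 1 - 2 * x" "1 + 1 - 2 * x"] by auto
  then have "d dvd 2" by (metis dvd_trans one_dvd)
  moreover have "d \<ge> 0" by (simp add: d_def)
  ultimately have "d \<le> 2" "d > 0" using zdvd_imp_le[of d 2] \<open>d \<noteq> 0\<close> by auto
  then have "d = 1 \<or> d = 2" by linarith
  then show ?thesis by (auto simp: d_def)
qed

text \<open>The excluded sides are unit multiples of 1, 2, \<open>1 + \<i>\<close> and
  \<open>2 * (1 + \<i>)\<close>, for which the order is at most 4.\<close>

lemma nondegenerate_side:
  assumes "lattice_unit P (p, v)" "corners (p, v) \<subseteq> cell_corners" "isonemal P" "has_order P n" "n > 4"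
  obtains a b where "v = Complex (of_int a) (of_int b)" "gcd a b \<in> {1, 2}"
    "a \<noteq> 0" "b \<noteq> 0" "\<bar>a\<bar> \<noteq> \<bar>b\<bar>"
proof -
  have p: "p \<in> cell_corners" "p + v \<in> cell_corners" using assms(2) by (auto simp: corners_def)
  then have "p + v - p \<in> cell_corners" by blast
  then obtain a b where v: "v = Complex (of_int a) (of_int b)"
    unfolding cell_corners_def by auto
  have g: "gcd a b \<in> {1, 2}" using isonemal_gcd[OF assms(1) p(1) v assms(3)] .
  have no: False if "c \<in> units" "k \<in> {1, 2}" "v = of_nat k * c \<or> v = of_nat k * c * (1 + \<i>)" for c k
    using order_le[OF assms(1,4) that(1) _ that(3)] that(2) assms(5) by auto
  have "a \<noteq> 0"
  proof
    assume "a = 0"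
    then have "\<bar>b\<bar> \<in> {1, 2}" using g by simp
    then have "v = of_nat (nat \<bar>b\<bar>) * (of_int (sgn b) * \<i>)"
      using v \<open>a = 0\<close> by (auto simp: complex_eq_iff sgn_if)
    then show False using no[of "of_int (sgn b) * \<i>" "nat \<bar>b\<bar>"] \<open>\<bar>b\<bar> \<in> {1, 2}\<close>
      by (auto simp: sgn_if split: if_splits)
  qed
  moreover have "b \<noteq> 0"
  proof
    assume "b = 0"
    then have "\<bar>a\<bar> \<in> {1, 2}" using g by simp
    then have "v = of_nat (nat \<bar>a\<bar>) * of_int (sgn a)"
      using v \<open>b = 0\<close> by (auto simp: complex_eq_iff sgn_if)
    then show False using no[of "of_int (sgn a)" "nat \<bar>a\<bar>"] \<open>\<bar>a\<bar> \<in> {1, 2}\<close>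
      by (auto simp: sgn_if split: if_splits)
  qed
  moreover have "\<bar>a\<bar> \<noteq> \<bar>b\<bar>"
  proof
    assume ab: "\<bar>a\<bar> = \<bar>b\<bar>"
    then have "gcd a b = \<bar>a\<bar>" by (metis gcd_abs1_int gcd_abs2_int gcd_idem_int)
    then have k: "\<bar>a\<bar> \<in> {1, 2}" using g by simp
    define c where "c = (if a > 0 then if b > 0 then 1 else -\<i> else if b > 0 then \<i> else -1)"
    have "v = of_nat (nat \<bar>a\<bar>) * c * (1 + \<i>)"
      using v ab k by (auto simp: complex_eq_iff c_def)
    moreover have "c \<in> units" by (auto simp: c_def)
    ultimately show False using no[of c "nat \<bar>a\<bar>"] k by auto
  qed
  ultimately show thesis by (rule that[OF v g])
qed

definition inscribed :: "square \<Rightarrow> square" where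
  "inscribed = (\<lambda>(p, v). (p + v / 2, (1 + \<i>) / 2 * v))"

lemma level_inscribed: "level k (inscribed S) \<Longrightarrow> level (Suc k) S"
proof (rule level_Suc)
  have "midpoints (p, v) = corners (inscribed (p, v))" for p v :: complex
  proof -
    have "p + v / 2 + (1 + \<i>) / 2 * v = p + v + \<i> * v / 2" 
      "p + v / 2 + (1 + \<i>) / 2 * v + \<i> * ((1 + \<i>) / 2 * v) = p + v / 2 + \<i> * v"
      "p + v / 2 + \<i> * ((1 + \<i>) / 2 * v) = p + \<i> * v / 2"
      by (simp_all add: complex_eq_iff field_simps)
    then show ?thesis by (simp only: corners_def midpoints_def inscribed_def split_conv)
  qed
  then show "midpoints S = corners (inscribed S)" by (cases S) simp
qed

lemma cell_centres_add: "c \<in> cell_centres \<Longrightarrow> q \<in> cell_corners \<Longrightarrow> c + q \<in> cell_centres"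
  unfolding cell_centres_iff cell_corners_iff
  by (metis Ints_add diff_add_eq plus_complex.simps)

lemma corners_subset:
  assumes "v \<in> cell_corners"
  shows "p \<in> cell_corners \<Longrightarrow> corners (p, v) \<subseteq> cell_corners"
    "p \<in> cell_centres \<Longrightarrow> corners (p, v) \<subseteq> cell_centres"
proof -
  show "p \<in> cell_corners \<Longrightarrow> corners (p, v) \<subseteq> cell_corners"
    using assms by (auto simp: corners_def)
  assume p: "p \<in> cell_centres"
  have "p + v + \<i> * v \<in> cell_centres"
    using cell_centres_add[OF p, of "v + \<i> * v"] assms by (simp add: add.assoc)
  then show "corners (p, v) \<subseteq> cell_centres"
    using assms cell_centres_add[OF p] p unfolding corners_def by auto
qed

lemma Complex_in_cell_corners [simp, intro]: "Complex (of_int a) (of_int b) \<in> cell_corners"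
  by (simp add: cell_corners_iff)

lemma level_1_unit:
  assumes "coprime a b" "odd (a + b)" "a \<noteq> 0" "b \<noteq> 0" "p \<in> cell_corners \<union> cell_centres"
  shows "level 1 (p, Complex (of_int a) (of_int b))"
proof (rule level_1[where a = "nat \<bar>a\<bar>" and b = "nat \<bar>b\<bar>"])
  show "coprime (nat \<bar>a\<bar>) (nat \<bar>b\<bar>)" using assms(1)
    by (metis abs_ge_zero coprime_abs_left_iff coprime_abs_right_iff coprime_int_iff nat_0_le)
  show "odd (nat \<bar>a\<bar> + nat \<bar>b\<bar>)" using assms(2) by (simp add: even_nat_iff)
  show "corners (p, Complex (of_int a) (of_int b)) \<subseteq> cell_corners \<or>
      corners (p, Complex (of_int a) (of_int b)) \<subseteq> cell_centres"
    using assms(5) corners_subset[of "Complex (of_int a) (of_int b)" p] by auto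
qed (use assms in auto)

lemma half_odd: "odd k \<Longrightarrow> of_int k / 2 - 1 / 2 \<in> (\<int> :: real set)"
proof -
  assume "odd k"
  then obtain l where "k = 2 * l + 1" by (auto elim: oddE)
  then have "of_int k / 2 - 1 / 2 = (of_int l :: real)" by (simp add: field_simps)
  then show ?thesis by simp
qed

text \<open>The inscribed square has the components \<open>(a - b) / 2\<close> and
  \<open>(a + b) / 2\<close>, coprime and of opposite parity because their sum \<open>a\<close>
  is odd, and its corners are at cell centres because half of an odd number is half-integral.\<close>

lemma level_2_unit:
  assumes "coprime a b" "odd a" "odd b" "\<bar>a\<bar> \<noteq> \<bar>b\<bar>" "p \<in> cell_corners"
  shows "level 2 (p, Complex (of_int a) (of_int b))"
proof -
  have "even (a - b)" using assms by simp
  then obtain k where k: "a - b = 2 * k" by (rule evenE)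
  then have ab: "a = b + 2 * k" by simp
  have cop: "coprime k (b + k)"
  proof (rule coprimeI)
    fix c assume "c dvd k" "c dvd b + k"
    then have "c dvd b" by (simp add: dvd_add_left_iff)
    moreover have "c dvd a" using \<open>c dvd k\<close> calculation ab by simp
    ultimately show "is_unit c" using assms(1) by (meson coprime_common_divisor)
  qed
  have "odd (k + (b + k))" "k \<noteq> 0" "b + k \<noteq> 0"
    using assms(2-4) by (auto simp: ab)
  moreover have "p + Complex (of_int a) (of_int b) / 2 \<in> cell_centres"
  proof -
    have "Re p + (of_int a / 2 - 1 / 2) \<in> \<int>" "Im p + (of_int b / 2 - 1 / 2) \<in> \<int>"
      using assms half_odd[of a] half_odd[of b] by (auto simp: cell_corners_iff intro!: Ints_add)
    then show ?thesis by (simp add: cell_centres_iff algebra_simps)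
  qed
  moreover have "(1 + \<i>) / 2 * Complex (of_int a) (of_int b) = Complex (of_int k) (of_int (b + k))"
    unfolding ab by (simp add: complex_eq_iff field_simps)
  ultimately have "level 1 (inscribed (p, Complex (of_int a) (of_int b)))"
    using level_1_unit[OF cop] by (simp add: inscribed_def)
  then show ?thesis using level_inscribed by (metis Suc_1)
qed

text \<open>Inscribing twice multiplies the side by \<open>((1 + \<i>) / 2)\<^sup>2 = \<i> / 2\<close>.\<close>

lemma level_of_doubled_unit:
  assumes "level k (p + ((3 + \<i>) / 2) * Complex (of_int a) (of_int b), Complex (of_int (- b)) (of_int a))"
  shows "level (k + 2) (p, Complex (of_int (2 * a)) (of_int (2 * b)))"
proof -
  define v where "v = Complex (of_int (2 * a)) (of_int (2 * b))"
  have "inscribed (inscribed (p, v)) =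
    (p + ((3 + \<i>) / 2) * Complex (of_int a) (of_int b), Complex (of_int (- b)) (of_int a))"
    by (simp add: inscribed_def v_def complex_eq_iff field_simps)
  then have "level (Suc (Suc k)) (p, v)"
    using assms level_inscribed by metis
  then show ?thesis by (simp add: v_def)
qed

section \<open>Kinds of quarter-turns and the species\<close>

lemma half_even: "even k \<Longrightarrow> of_int k / 2 \<in> (\<int> :: real set)"
  by (auto elim!: evenE)

text \<open>The multiples of \<open>1 - \<i>\<close> are the Gaussian integers with even coordinate sum.\<close>

lemma gaussian_parity:
  assumes "q \<in> cell_corners"
  shows "\<exists>q'\<in>cell_corners. q = (1 - \<i>) * q' \<or> q = 1 + (1 - \<i>) * q'"
proof -
  obtain x y where q: "q = Complex (of_int x) (of_int y)"
    using assms unfolding cell_corners_def by blast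
  show ?thesis
  proof (cases "even (x + y)")
    case True
    then obtain k where k: "x + y = 2 * k" by (rule evenE)
    then have "y = 2 * k - x" by simp
    then have "q = (1 - \<i>) * Complex (of_int (x - k)) (of_int k)"
      by (simp add: q complex_eq_iff)
    then show ?thesis by blast
  next
    case False
    then obtain k where k: "x + y = 2 * k + 1" by (rule oddE)
    then have "y = 2 * k + 1 - x" by simp
    then have "q = 1 + (1 - \<i>) * Complex (of_int (x - k - 1)) (of_int k)"
      by (simp add: q complex_eq_iff)
    then show ?thesis by blast
  qed
qed

lemma centre_eq: "centre (p, v) = p + 1 * ((1 + \<i>) / 2 * v)"
  by (simp add: centre_def field_simps)

lemma quarter_turn_centres:
  assumes "lattice_unit P (p, v)" "quarter_turn c \<in> planar_group P"
  obtains q where "q \<in> cell_corners" "c = p + q * v" | q where "q \<in> cell_corners" "c = centre (p, v) + q * v"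
proof -
  have *: "(1 - \<i>) * ((1 + \<i>) / 2 * v) = v" by (simp add: complex_eq_iff field_simps)
  obtain q where q: "q \<in> cell_corners" "c = p + q * ((1 + \<i>) / 2 * v)"
    using quarter_turn_in_group_iff[OF assms(1)] assms(2) by blast
  obtain q' where q': "q' \<in> cell_corners" "q = (1 - \<i>) * q' \<or> q = 1 + (1 - \<i>) * q'"
    using gaussian_parity[OF q(1)] by blast
  have **: "(1 - \<i>) * q' * ((1 + \<i>) / 2 * v) = q' * v"
    using * by (metis mult.assoc mult.commute)
  from q'(2) show thesis
  proof
    assume "q = (1 - \<i>) * q'"
    then have "c = p + q' * v" using q(2) ** by simp
    then show thesis by (rule that(1)[OF q'(1)])
  next
    assume "q = 1 + (1 - \<i>) * q'"
    then have "c = p + 1 * ((1 + \<i>) / 2 * v) + (1 - \<i>) * q' * ((1 + \<i>) / 2 * v)"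
      unfolding q by (simp only: distrib_right add.assoc)
    then have "c = centre (p, v) + q' * v" unfolding centre_eq ** .
    then show thesis by (rule that(2)[OF q'(1)])
  qed
qed

lemma centre_in_group:
  assumes "lattice_unit P (p, v)" shows "quarter_turn (centre (p, v)) \<in> planar_group P"
  using quarter_turn_in_group_iff[OF assms, of "centre (p, v)"] unfolding centre_eq
  by (metis cell_corners_closed(2))

text \<open>The cell around \<open>c\<close> is mapped to itself and its two strands are exchanged.\<close>

lemma quarter_turn_cell_centre_reversing:
  assumes "c \<in> cell_centres" "quarter_turn c \<in> planar_group P"
  shows "reversing P c"
proof -
  obtain i j where c: "c = Complex (of_int i + 1/2) (of_int j + 1/2)"
    using assms(1) unfolding cell_centres_def by blast
  obtain \<epsilon> where Q: "(quarter_turn c, \<epsilon>) \<in> symmetries P" using assms(2) planar_groupE by metis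
  have r: "Re (quarter_turn c z) = of_int i + 1/2 - (Im z - (of_int j + 1/2))"
    "Im (quarter_turn c z) = of_int j + 1/2 + (Re z - (of_int i + 1/2))" for z
    by (simp_all add: rotation_def c)
  obtain i' j' where C: "quarter_turn c ` cell i j = cell i' j'"
    "quarter_turn c ` uppermost P i j = (case \<epsilon> of Keep \<Rightarrow> uppermost P i' j' | Tau \<Rightarrow> lowermost P i' j')"
    using symmetriesD(3)[OF Q, of i j] unfolding carries_def by blast
  have "c \<in> cell i j" by (simp add: c cell_iff warp_iff weft_iff)
  moreover have "quarter_turn c c = c" by (simp add: rotation_def)
  ultimately have "c \<in> cell i' j'" using C(1) by (metis imageI)
  then have ij: "i' = i" "j' = j" by (auto simp: c cell_iff warp_iff weft_iff)
  have "quarter_turn c ` uppermost P i j \<noteq> uppermost P i j"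
  proof (cases "P i j")
    case True
    have "Complex (of_int i) (of_int j + 2) \<in> warp i" by (simp add: warp_iff)
    then have "quarter_turn c (Complex (of_int i) (of_int j + 2)) \<in> quarter_turn c ` warp i" by blast
    moreover have "quarter_turn c (Complex (of_int i) (of_int j + 2)) \<notin> warp i"
      by (simp add: warp_iff r)
    ultimately show ?thesis using True by (auto simp: uppermost_def)
  next
    case False
    have "Complex (of_int i + 2) (of_int j) \<in> weft j" by (simp add: weft_iff)
    then have "quarter_turn c (Complex (of_int i + 2) (of_int j)) \<in> quarter_turn c ` weft j" by blast
    moreover have "quarter_turn c (Complex (of_int i + 2) (of_int j)) \<notin> weft j"
      by (simp add: weft_iff r)
    ultimately show ?thesis using False by (auto simp: uppermost_def)
  qed
  then have "\<epsilon> = Tau" using C(2) ij by (cases \<epsilon>) auto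
  then show ?thesis using Q by (simp add: reversing_def)
qed

text \<open>The cell around \<open>c\<close> and both its strands are mapped to themselves.\<close>

lemma half_turn_cell_centre_preserving:
  assumes "c \<in> cell_centres" "(half_turn c, \<epsilon>) \<in> symmetries P"
  shows "\<epsilon> = Keep"
proof -
  obtain i j where c: "c = Complex (of_int i + 1/2) (of_int j + 1/2)"
    using assms(1) unfolding cell_centres_def by blast
  have r: "Re (half_turn c z) = of_int i + 1/2 - (Re z - (of_int i + 1/2))"
    "Im (half_turn c z) = of_int j + 1/2 - (Im z - (of_int j + 1/2))" for z
    by (simp_all add: rotation_def c)
  have "half_turn c (half_turn c z) = z" for z
    by (simp add: rotation_def)
  then have inv: "half_turn c ` X = {z. half_turn c z \<in> X}" for X
    by (auto simp: image_iff) metis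
  have "half_turn c ` warp i = warp i" "half_turn c ` weft j = weft j"
    unfolding inv by (auto simp: warp_iff weft_iff r)
  moreover have "half_turn c ` cell i j = cell i j"
    unfolding inv by (auto simp: cell_iff warp_iff weft_iff r)
  ultimately have "carries P (half_turn c) Keep i j"
    unfolding carries_def uppermost_def by (intro exI[of _ i] exI[of _ j]) auto
  then show ?thesis using carries_unique symmetriesD(3)[OF assms(2)] by metis
qed

lemma corners_preserving:
  assumes "lattice_unit P (p, v)" "(quarter_turn p, \<epsilon>) \<in> symmetries P" "c \<in> corners (p, v)"
  shows "(quarter_turn c, \<epsilon>) \<in> symmetries P"
proof -
  have "\<exists>q\<in>cell_corners. c = p + q * v"
    using assms(3) unfolding corners_def
    by (auto intro: bexI[of _ 0] bexI[of _ 1] bexI[of _ \<i>] bexI[of _ "1 + \<i>"] simp: algebra_simps)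
  then show ?thesis using preserving_translate[OF assms(1) _ assms(2)] by auto
qed

lemma all_preservingI:
  assumes "lattice_unit P (p, v)" "preserving P p" "preserving P (centre (p, v))"
  shows "all_preserving P"
  unfolding all_preserving_def
proof (intro allI impI)
  fix c assume "quarter_turn c \<in> planar_group P"
  then show "preserving P c"
    by (rule quarter_turn_centres[OF assms(1)])
      (use assms preserving_translate[OF assms(1)] in \<open>auto simp: preserving_def\<close>)
qed

text \<open>The greatest common divisor of the components of \<open>v\<close> and their parities give the
  level; the kind \<open>\<epsilon>\<close> of the quarter-turn at the centre gives the species.
  At level 2 the product of the quarter-turns at the corner and at the centre is the half-turn
  about the mid-point of a side, which is a cell centre; so \<open>\<epsilon>\<close> cannot be
  reversing.\<close>

lemma species_of_preserving_corner:
  assumes "lattice_unit P (p, v)" "corners (p, v) \<subseteq> cell_corners" "preserving P p"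
    and "isonemal P" "has_order P n" "n > 4"
  shows "species33 P \<or> species34 P \<or> species37 P \<or> species38 P \<or> species39 P"
proof -
  have p: "p \<in> cell_corners" using assms(2) by (auto simp: corners_def)
  obtain a b where v: "v = Complex (of_int a) (of_int b)" and g: "gcd a b \<in> {1, 2}"
    and nz: "a \<noteq> 0" "b \<noteq> 0" "\<bar>a\<bar> \<noteq> \<bar>b\<bar>"
    using nondegenerate_side[OF assms(1,2,4-6)] .
  obtain \<epsilon> where Q: "(quarter_turn (centre (p, v)), \<epsilon>) \<in> symmetries P"
    using planar_groupE[OF centre_in_group[OF assms(1)]] by metis
  have c: "Re (centre (p, v)) = Re p + of_int (a - b) / 2" "Im (centre (p, v)) = Im p + of_int (a + b) / 2"
    by (simp_all add: centre_def v)
  have at: "at_cell_corners (p, v)" if "even (a + b)"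
  proof -
    have "even (a - b)" using that by simp
    then have "(of_int (a - b) / 2 :: real) \<in> \<int>" "(of_int (a + b) / 2 :: real) \<in> \<int>"
      using that by (blast intro: half_even)+
    then show ?thesis
      using assms(2) p by (auto simp: at_cell_corners_def cell_corners_iff c simp del: of_int_add of_int_diff intro!: Ints_add)
  qed
  have mixed: "mixed_kinds P (p, v)" if "\<epsilon> = Tau"
    using Q that corners_preserving[OF assms(1)] assms(3)
    by (auto simp: mixed_kinds_def reversing_def preserving_def)
  have allp: "all_preserving P" if "\<epsilon> = Keep"
    using Q that all_preservingI[OF assms(1,3)] by (simp add: preserving_def)
  consider (1) "coprime a b" "odd (a + b)" | (2) "coprime a b" "odd a" "odd b" | (3) "gcd a b = 2"
  proof -
    have "odd a \<or> odd b" if "gcd a b = 1"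
      using that by (metis gcd_greatest odd_one)
    then have "gcd a b = 1 \<and> odd (a + b) \<or> gcd a b = 1 \<and> odd a \<and> odd b \<or> gcd a b = 2"
      using g by auto
    then show thesis
      by (elim disjE conjE) (rule that; simp add: coprime_iff_gcd_eq_1)+
  qed
  then show ?thesis
  proof cases
    case 1
    have "level 1 (p, v)" using level_1_unit[OF 1 nz(1,2)] p v by simp
    moreover have "preserving P c" if "c \<in> cell_corners" "quarter_turn c \<in> planar_group P" for c
      using that(2)
    proof (cases rule: quarter_turn_centres[OF assms(1), consumes 1])
      case (1 q)
      then show ?thesis using preserving_translate[OF assms(1) 1(1)] assms(3)
        by (simp add: preserving_def)
    next
      case (2 q)
      have "v \<in> cell_corners" using v by simp
      then have "c - q * v - p \<in> cell_corners" using that(1) 2(1) p by blast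
      then have "Re (centre (p, v)) - Re p \<in> \<int>" using 2(2) by (simp add: cell_corners_iff)
      then have "(of_int (a - b) / 2 :: real) \<in> \<int>" by (simp add: c)
      then obtain k where "(of_int (a - b) / 2 :: real) = of_int k" by (auto elim: Ints_cases)
      then have "real_of_int (a - b) = real_of_int (2 * k)" by (simp add: field_simps)
      then have "a - b = 2 * k" by (simp only: of_int_eq_iff)
      then have "even (a - b)" by simp
      then show ?thesis using \<open>odd (a + b)\<close> by simp
    qed
    ultimately have "species39 P"
      using assms(1) quarter_turn_cell_centre_reversing unfolding species39_def by blast
    then show ?thesis by blast
  next
    case 2
    have lev: "level 2 (p, v)" using level_2_unit[OF 2 nz(3) p] v by simp
    have m: "p + v / 2 \<in> cell_centres"
    proof -
      have "Re p + (of_int a / 2 - 1 / 2) \<in> \<int>" "Im p + (of_int b / 2 - 1 / 2) \<in> \<int>"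
        using p half_odd[OF 2(2)] half_odd[OF 2(3)] by (auto simp: cell_corners_iff intro!: Ints_add)
      then show ?thesis by (simp add: v cell_centres_iff algebra_simps)
    qed
    have "(quarter_turn (centre (p, v)) \<circ> quarter_turn p, kind_comp \<epsilon> Keep) \<in> symmetries P"
      using assms(3) Q symmetries_comp unfolding preserving_def by blast
    moreover have "quarter_turn (centre (p, v)) \<circ> quarter_turn p = half_turn (p + v / 2)"
      by (auto simp: rotation_def centre_def fun_eq_iff field_simps)
    ultimately have "\<epsilon> = Keep" using half_turn_cell_centre_preserving[OF m] by simp
    then have "species34 P" using lev at 2 allp assms(1) unfolding species34_def by auto
    then show ?thesis by blast
  next
    case 3
    have "even a" "even b" using 3 by (metis gcd_dvd1, metis gcd_dvd2)
    then obtain a' b' where ab: "a = 2 * a'" "b = 2 * b'" by (auto elim!: evenE)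
    have cop: "coprime a' b'" using 3 by (simp add: ab gcd_mult_distrib_int[symmetric] coprime_iff_gcd_eq_1)
    have cop': "coprime (- b') a'" using cop by (simp add: coprime_commute)
    have re: "Re (p + ((3 + \<i>) / 2) * Complex (of_int a') (of_int b')) = Re p + of_int (3 * a' - b') / 2"
      "Im (p + ((3 + \<i>) / 2) * Complex (of_int a') (of_int b')) = Im p + of_int (3 * b' + a') / 2"
      by (simp_all add: field_simps)
    have "level 3 (p, v) \<or> level 4 (p, v)"
    proof (cases "odd (a' + b')")
      case True
      have "p + ((3 + \<i>) / 2) * Complex (of_int a') (of_int b') \<in> cell_centres"
      proof -
        have "odd (3 * a' - b')" "odd (3 * b' + a')" using True by auto
        then have "Re p + (of_int (3 * a' - b') / 2 - 1 / 2) \<in> \<int>" "Im p + (of_int (3 * b' + a') / 2 - 1 / 2) \<in> \<int>"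
          using p half_odd by (auto simp: cell_corners_iff simp del: of_int_add of_int_diff intro!: Ints_add)
        then show ?thesis unfolding cell_centres_iff re by (simp add: algebra_simps)
      qed
      then have "level 1 (p + ((3 + \<i>) / 2) * Complex (of_int a') (of_int b'), Complex (of_int (- b')) (of_int a'))"
        using level_1_unit[OF cop'] True nz ab by auto
      then show ?thesis using level_of_doubled_unit[of 1 p a' b'] ab v by (simp add: numeral_eq_Suc)
    next
      case False
      then have odd: "odd a'" "odd b'" using cop by (auto dest: coprime_common_divisor)
      have "p + ((3 + \<i>) / 2) * Complex (of_int a') (of_int b') \<in> cell_corners"
      proof -
        have "even (3 * a' - b')" "even (3 * b' + a')" using False by auto
        then have "Re p + of_int (3 * a' - b') / 2 \<in> \<int>" "Im p + of_int (3 * b' + a') / 2 \<in> \<int>"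
          using p half_even by (auto simp: cell_corners_iff simp del: of_int_add of_int_diff intro!: Ints_add)
        then show ?thesis unfolding cell_corners_iff re by blast
      qed
      then have "level 2 (p + ((3 + \<i>) / 2) * Complex (of_int a') (of_int b'), Complex (of_int (- b')) (of_int a'))"
        using level_2_unit[OF cop'] odd nz ab by auto
      then show ?thesis using level_of_doubled_unit[of 2 p a' b'] ab v by (simp add: numeral_eq_Suc)
    qed
    moreover have "at_cell_corners (p, v)" using at ab by simp
    ultimately show ?thesis
      using allp mixed assms(1) unfolding species33_def species37_def species38_def
      by (cases \<epsilon>) blast+
  qed
qed

text \<open>If the corners of the given unit are reversing or at cell centres, its centre serves as the new
  corner.\<close>

lemma preserving_corner_of_species:
  assumes "species33 P \<or> species34 P \<or> species37 P \<or> species38 P \<or> species39 P"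
  obtains p v where "lattice_unit P (p, v)" "corners (p, v) \<subseteq> cell_corners" "preserving P p"
proof -
  note witness = that
  have shift: thesis if S: "lattice_unit P (p, v)" "v \<in> cell_corners" "centre (p, v) \<in> cell_corners"
      "preserving P (centre (p, v))" for p v
  proof (rule witness)
    show "lattice_unit P (centre (p, v), v)"
      unfolding centre_eq by (rule lattice_unitI[OF S(1)]) simp
  qed (use S corners_subset(1)[OF S(2)] in auto)
  have side: "v \<in> cell_corners" if "corners (p, v) \<subseteq> cell_corners" for p v
  proof -
    have "p + v \<in> cell_corners" "p \<in> cell_corners" using that by (auto simp: corners_def)
    then have "p + v - p \<in> cell_corners" by blast
    then show ?thesis by simp
  qed
  consider (all) S where "lattice_unit P S" "at_cell_corners S" "all_preserving P"
    | (mixed) S where "lattice_unit P S" "at_cell_corners S" "mixed_kinds P S"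
    | (39) "species39 P"
    using assms unfolding species33_def species34_def species37_def species38_def by blast
  then show thesis
  proof cases
    case all
    obtain p v where S: "S = (p, v)" by (cases S)
    have "quarter_turn p \<in> planar_group P" using all S by (simp add: lattice_unit_def corners_def)
    then show thesis using witness[of p v] all S by (auto simp: all_preserving_def at_cell_corners_def)
  next
    case mixed
    obtain p v where S: "S = (p, v)" by (cases S)
    have c: "corners (p, v) \<subseteq> cell_corners" "centre (p, v) \<in> cell_corners"
      using mixed S by (auto simp: at_cell_corners_def)
    show thesis
    proof (cases "preserving P (centre (p, v))")
      case True
      then show thesis using shift side c mixed S by blast
    next
      case False
      then have "preserving P p" using mixed S by (auto simp: mixed_kinds_def corners_def)
      then show thesis using witness[of p v] c mixed S by blast
    qed
  next
    case 39
    then obtain S where S: "lattice_unit P S" "level 1 S" by (auto simp: species39_def)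
    from S(2) show thesis
    proof cases
      case (level_1 v a b p)
      have L: "lattice_unit P (p, v)" using S level_1 by simp
      from level_1(8) show thesis
      proof
        assume c: "corners (p, v) \<subseteq> cell_corners"
        then have "p \<in> cell_corners" by (simp add: corners_def)
        moreover have "quarter_turn p \<in> planar_group P" using L by (simp add: lattice_unit_def corners_def)
        ultimately show thesis using witness[OF L c] 39 by (auto simp: species39_def)
      next
        assume c: "corners (p, v) \<subseteq> cell_centres"
        then have "p \<in> cell_centres" "p + v \<in> cell_centres" by (auto simp: corners_def)
        then have r: "Re p - 1/2 \<in> \<int>" "Im p - 1/2 \<in> \<int>" "Re p + Re v - 1/2 \<in> \<int>" "Im p + Im v - 1/2 \<in> \<int>"
          by (auto simp: cell_centres_iff)
        have "Re p + Re v - 1/2 - (Re p - 1/2) \<in> \<int>" "Im p + Im v - 1/2 - (Im p - 1/2) \<in> \<int>"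
          using r by (blast intro: Ints_diff)+
        then obtain x y where xy: "Re v = of_int x" "Im v = of_int y"
          by (auto elim!: Ints_cases)
        have "\<bar>x\<bar> = int a" "\<bar>y\<bar> = int b" using level_1(2,3) xy by linarith+
        then have "odd (x + y)" using level_1(7) by (metis dvd_abs_iff even_add even_of_nat)
        then have "odd (x - y)" by simp
        have "Re p - 1/2 + (of_int (x - y) / 2 - 1/2) + 1 \<in> \<int>" "Im p - 1/2 + (of_int (x + y) / 2 - 1/2) + 1 \<in> \<int>"
          using r half_odd[OF \<open>odd (x - y)\<close>] half_odd[OF \<open>odd (x + y)\<close>] by (intro Ints_add; simp)+
        then have cc: "centre (p, v) \<in> cell_corners"
          using xy by (simp add: cell_corners_iff centre_def algebra_simps diff_divide_distrib add_divide_distrib)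
        moreover have "v \<in> cell_corners" using xy by (simp add: cell_corners_iff)
        ultimately show thesis using shift[OF L] 39 centre_in_group[OF L] by (auto simp: species39_def)
      qed
    next
      case (level_Suc n T)
      have "\<not> level 0 T" for T by (auto elim: level.cases)
      then show thesis using level_Suc by auto
    qed
  qed
qed

unbundle cross3_syntax

section \<open>Rotations of the cube\<close>

text \<open>The unit vectors along the 4-fold axes of the cube: the normals of its faces.\<close>

definition axes :: "(real ^ 3) set" where
  "axes = {vector [1,0,0], vector [-1,0,0], vector [0,1,0], vector [0,-1,0], vector [0,0,1], vector [0,0,-1]}"

lemma inner_3: "x \<bullet> y = x $ 1 * y $ 1 + x $ 2 * y $ 2 + x $ 3 * y $ 3" for x y :: "real ^ 3"
  by (simp add: inner_vec_def sum_3)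

lemma eq_3: "x = y \<longleftrightarrow> x $ 1 = y $ 1 \<and> x $ 2 = y $ 2 \<and> x $ 3 = y $ 3" for x y :: "real ^ 3"
  by (simp add: vec_eq_iff forall_3)

lemma cube_iff: "x \<in> cube r \<longleftrightarrow> \<bar>x $ 1\<bar> \<le> r \<and> \<bar>x $ 2\<bar> \<le> r \<and> \<bar>x $ 3\<bar> \<le> r"
  by (simp add: cube_def forall_3)

lemma cube_iff_axes: "x \<in> cube r \<longleftrightarrow> (\<forall>a\<in>axes. x \<bullet> a \<le> r)"
  by (auto simp: cube_iff axes_def inner_3 abs_le_iff)

definition face :: "real \<Rightarrow> real ^ 3 \<Rightarrow> (real ^ 3) set" where
  "face r a = {x \<in> cube r. x \<bullet> a = r}"

lemma cube_faces_eq: "cube_faces r = face r ` axes"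
proof -
  have "cube_faces r = (\<Union>k\<in>UNIV. {{x \<in> cube r. x $ k = r}, {x \<in> cube r. x $ k = - r}})"
    unfolding cube_faces_def by auto
  also have "\<dots> = {{x \<in> cube r. x $ 1 = r}, {x \<in> cube r. x $ 1 = - r}, {x \<in> cube r. x $ 2 = r},
      {x \<in> cube r. x $ 2 = - r}, {x \<in> cube r. x $ 3 = r}, {x \<in> cube r. x $ 3 = - r}}"
    unfolding UNIV_3 by auto
  also have "\<dots> = face r ` axes"
  proof -
    have "face r (vector [1,0,0]) = {x \<in> cube r. x $ 1 = r}" "face r (vector [-1,0,0]) = {x \<in> cube r. x $ 1 = - r}"
      "face r (vector [0,1,0]) = {x \<in> cube r. x $ 2 = r}" "face r (vector [0,-1,0]) = {x \<in> cube r. x $ 2 = - r}"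
      "face r (vector [0,0,1]) = {x \<in> cube r. x $ 3 = r}" "face r (vector [0,0,-1]) = {x \<in> cube r. x $ 3 = - r}"
      by (auto simp: face_def inner_3)
    then show ?thesis unfolding axes_def by (simp only: image_insert image_empty)
  qed
  finally show ?thesis .
qed

definition frame :: "real ^ 3 \<Rightarrow> real ^ 3 \<Rightarrow> bool" where
  "frame e n \<longleftrightarrow> e \<in> axes \<and> n \<in> axes \<and> e \<bullet> n = 0"

lemma axes_inner:
  "a \<in> axes \<Longrightarrow> b \<in> axes \<Longrightarrow> a \<bullet> b \<in> {-1, 0, 1}"
  "a \<in> axes \<Longrightarrow> a \<bullet> a = 1"
  "a \<in> axes \<Longrightarrow> b \<in> axes \<Longrightarrow> a \<bullet> b = 1 \<Longrightarrow> b = a"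
  "a \<in> axes \<Longrightarrow> b \<in> axes \<Longrightarrow> a \<bullet> b = -1 \<Longrightarrow> b = - a"
  "a \<in> axes \<Longrightarrow> - a \<in> axes"
  by (auto simp: axes_def inner_3 eq_3)

lemma frame_cross: "frame e n \<Longrightarrow> n \<times> e \<in> axes"
  unfolding frame_def axes_def
  by (elim conjE insertE emptyE; hypsubst; simp add: inner_3 eq_3 cross_components)

lemma frame_inner:
  assumes "frame e n"
  shows "e \<bullet> e = 1" "n \<bullet> n = 1" "e \<bullet> n = 0" "n \<bullet> e = 0" "(n \<times> e) \<bullet> (n \<times> e) = 1"
    "(n \<times> e) \<bullet> n = 0" "(n \<times> e) \<bullet> e = 0" "n \<bullet> (n \<times> e) = 0" "e \<bullet> (n \<times> e) = 0"
  using assms axes_inner(2) frame_cross[OF assms]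
  by (auto simp: frame_def inner_commute dot_cross_self)

lemma frame_expand:
  assumes "frame e n"
  shows "x = (x \<bullet> e) *\<^sub>R e + (x \<bullet> (n \<times> e)) *\<^sub>R (n \<times> e) + (x \<bullet> n) *\<^sub>R n"
  using assms unfolding frame_def axes_def
  by (elim conjE insertE emptyE; hypsubst; simp add: inner_3 eq_3 cross_components)

lemma frame_cube:
  assumes "frame e n"
  shows "x \<in> cube r \<longleftrightarrow> \<bar>x \<bullet> e\<bar> \<le> r \<and> \<bar>x \<bullet> (n \<times> e)\<bar> \<le> r \<and> \<bar>x \<bullet> n\<bar> \<le> r"
  using assms unfolding frame_def axes_def cube_iff
  by (elim conjE insertE emptyE; hypsubst; simp add: inner_3 cross_components; blast)

text \<open>Coordinates on the face with outward normal \<open>n\<close>, seen from outside: multiplying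
  \<open>u\<close> by \<open>\<i>\<close> is a quarter-turn of the face.\<close>

definition along :: "real ^ 3 \<Rightarrow> real ^ 3 \<Rightarrow> complex \<Rightarrow> real ^ 3" where
  "along e n u = Re u *\<^sub>R e + Im u *\<^sub>R (n \<times> e)"

lemma along_diff: "along e n (u - w) = along e n u - along e n w"
  by (simp add: along_def algebra_simps)

lemma along_1 [simp]: "along e n 1 = e"
  by (simp add: along_def)

lemma along_inner:
  assumes "frame e n"
  shows "along e n u \<bullet> along e n w = Re (u * cnj w)" "along e n u \<bullet> n = 0"
    "along e n u \<bullet> e = Re u" "along e n u \<bullet> (n \<times> e) = Im u"
  using frame_inner[OF assms] by (simp_all add: along_def inner_add_left inner_add_right)

lemma along_norm: "frame e n \<Longrightarrow> norm (along e n u) = norm u"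
  using along_inner(1)[of e n u u] by (simp add: norm_eq_sqrt_inner[of "along e n u"] cmod_def power2_eq_square)

lemma along_mult:
  assumes "frame e n" shows "along (along e n c) n u = along e n (c * u)"
proof -
  have "n \<times> (n \<times> e) = - e"
    using frame_inner[OF assms] by (simp add: Lagrange)
  then show ?thesis
    by (simp add: along_def cross_add_right cross_mult_right algebra_simps)
qed

lemma along_frame:
  assumes "frame e n" "c \<in> units"
  shows "frame (along e n c) n"
proof -
  have "e \<in> axes" using assms(1) by (simp add: frame_def)
  then have "e \<in> axes" "n \<times> e \<in> axes" "- e \<in> axes" "- (n \<times> e) \<in> axes"
    using frame_cross[OF assms(1)] by (blast intro: axes_inner(5))+
  moreover have "along e n c \<in> {e, n \<times> e, - e, - (n \<times> e)}"
    using assms(2) by (auto simp: units_def along_def)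
  ultimately have "along e n c \<in> axes" by (metis empty_iff insert_iff)
  then show ?thesis using along_inner(2)[OF assms(1)] assms(1) by (simp add: frame_def)
qed

lemma along_exists:
  assumes "frame e n" "a \<bullet> n = 0"
  shows "a = along e n (Complex (a \<bullet> e) (a \<bullet> (n \<times> e)))"
  using frame_expand[OF assms(1), of a] assms(2) by (simp add: along_def)

lemma along_unit_exists:
  assumes "frame e n" "frame a n"
  obtains c where "c \<in> units" "a = along e n c"
proof -
  have a: "a \<in> axes" "a \<bullet> n = 0" using assms(2) by (auto simp: frame_def)
  have e: "e \<in> axes" using assms(1) by (auto simp: frame_def)
  define c where "c = Complex (a \<bullet> e) (a \<bullet> (n \<times> e))"
  have al: "a = along e n c" using along_exists[OF assms(1) a(2)] by (simp add: c_def)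
  have "(a \<bullet> e)\<^sup>2 + (a \<bullet> (n \<times> e))\<^sup>2 = 1"
    using along_inner(1)[OF assms(1), of c c] axes_inner(2)[OF a(1)]
    unfolding al[symmetric] by (simp add: c_def power2_eq_square)
  moreover have "a \<bullet> e \<in> {-1, 0, 1}" "a \<bullet> (n \<times> e) \<in> {-1, 0, 1}"
    using axes_inner(1) a e frame_cross[OF assms(1)] by blast+
  ultimately have "c \<in> units" by (auto simp: units_def c_def complex_eq_iff)
  then show thesis using that al by blast
qed

lemma face_param:
  assumes "frame e n" "r > 0"
  shows "face r n = (\<lambda>u. r *\<^sub>R (n + along e n u)) ` {u. \<bar>Re u\<bar> \<le> 1 \<and> \<bar>Im u\<bar> \<le> 1}"
proof (intro subset_antisym subsetI)
  fix x assume "x \<in> face r n"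
  then have x: "x \<bullet> n = r" "\<bar>x \<bullet> e\<bar> \<le> r" "\<bar>x \<bullet> (n \<times> e)\<bar> \<le> r"
    using frame_cube[OF assms(1)] by (auto simp: face_def)
  have "x = r *\<^sub>R (n + along e n (Complex ((x \<bullet> e) / r) ((x \<bullet> (n \<times> e)) / r)))"
    using frame_expand[OF assms(1), of x] x(1) assms(2) by (simp add: along_def algebra_simps)
  moreover have "\<bar>(x \<bullet> e) / r\<bar> \<le> 1" "\<bar>(x \<bullet> (n \<times> e)) / r\<bar> \<le> 1"
    using x assms(2) by simp_all
  ultimately show "x \<in> (\<lambda>u. r *\<^sub>R (n + along e n u)) ` {u. \<bar>Re u\<bar> \<le> 1 \<and> \<bar>Im u\<bar> \<le> 1}"
    by (metis (mono_tags, lifting) complex.sel image_eqI mem_Collect_eq)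
next
  fix x assume "x \<in> (\<lambda>u. r *\<^sub>R (n + along e n u)) ` {u. \<bar>Re u\<bar> \<le> 1 \<and> \<bar>Im u\<bar> \<le> 1}"
  then obtain u where u: "x = r *\<^sub>R (n + along e n u)" "\<bar>Re u\<bar> \<le> 1" "\<bar>Im u\<bar> \<le> 1" by blast
  have "x \<bullet> n = r" "x \<bullet> e = r * Re u" "x \<bullet> (n \<times> e) = r * Im u"
    using along_inner(2-4)[OF assms(1)] frame_inner[OF assms(1)] by (simp_all add: u(1) inner_add_left)
  then show "x \<in> face r n"
    using frame_cube[OF assms(1)] u assms(2) by (simp add: face_def abs_mult mult_left_le)
qed

lemma cube_rotationD:
  assumes "\<rho> \<in> cube_rotations r"
  shows "(\<rho> *v x) \<bullet> (\<rho> *v y) = x \<bullet> y" "(\<rho> *v x) \<times> (\<rho> *v y) = \<rho> *v (x \<times> y)"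
    "\<rho> *v (x + y) = \<rho> *v x + \<rho> *v y" "\<rho> *v (c *\<^sub>R x) = c *\<^sub>R (\<rho> *v x)"
    "(\<lambda>x. \<rho> *v x) ` cube r = cube r"
proof -
  have R: "rotation_matrix \<rho>" using assms by (simp add: cube_rotations_def)
  then have "orthogonal_transformation (\<lambda>x. \<rho> *v x)"
    by (simp add: rotation_matrix_def orthogonal_transformation_matrix)
  then show "(\<rho> *v x) \<bullet> (\<rho> *v y) = x \<bullet> y" by (simp add: orthogonal_transformation_def)
  show "(\<rho> *v x) \<times> (\<rho> *v y) = \<rho> *v (x \<times> y)" using R by (rule cross_rotation_matrix)
qed (use assms in \<open>auto simp: cube_rotations_def matrix_vector_right_distrib matrix_vector_mult_scaleR\<close>)

lemma cube_rotation_along: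
  assumes "\<rho> \<in> cube_rotations r"
  shows "\<rho> *v along e n u = along (\<rho> *v e) (\<rho> *v n) u"
  using cube_rotationD[OF assms] by (simp add: along_def)

text \<open>The image \<open>b\<close> of an axis vector has Euclidean norm 1. The sum of the absolute
  values of its components is at most 1 as well, because \<open>b \<bullet> y \<le> r\<close>
  for the vertex \<open>y\<close> with the signs of \<open>b\<close>. Both can only hold if a
  single component is non-zero.\<close>

lemma cube_rotation_axes:
  assumes "\<rho> \<in> cube_rotations r" "r > 0" "a \<in> axes"
  shows "\<rho> *v a \<in> axes"
proof -
  define b where "b = \<rho> *v a"
  define s where "s = (\<lambda>t::real. if t < 0 then - 1 else 1 :: real)"
  have st: "s t * t = \<bar>t\<bar>" "\<bar>s t\<bar> = 1" for t by (auto simp: s_def)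
  define y :: "real ^ 3" where "y = r *\<^sub>R vector [s (b $ 1), s (b $ 2), s (b $ 3)]"
  have "y \<in> cube r" using assms(2) by (simp add: y_def cube_iff abs_mult st)
  then obtain x where x: "x \<in> cube r" "y = \<rho> *v x"
    using cube_rotationD(5)[OF assms(1)] by (metis imageE)
  have "y \<bullet> b = x \<bullet> a" using cube_rotationD(1)[OF assms(1)] by (simp add: b_def x)
  also have "\<dots> \<le> r" using x(1) assms(3) by (simp add: cube_iff_axes)
  also have "y \<bullet> b = r * (\<bar>b $ 1\<bar> + \<bar>b $ 2\<bar> + \<bar>b $ 3\<bar>)"
    by (simp add: y_def inner_3 distrib_left flip: st(1))
  finally have l1: "\<bar>b $ 1\<bar> + \<bar>b $ 2\<bar> + \<bar>b $ 3\<bar> \<le> 1"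
    using assms(2) by (metis mult_le_cancel_left_pos mult.right_neutral)
  have "b \<bullet> b = 1" using cube_rotationD(1)[OF assms(1)] axes_inner(2)[OF assms(3)] by (simp add: b_def)
  then have l2: "\<bar>b $ 1\<bar> * \<bar>b $ 1\<bar> + \<bar>b $ 2\<bar> * \<bar>b $ 2\<bar> + \<bar>b $ 3\<bar> * \<bar>b $ 3\<bar> = 1"
    by (simp add: inner_3)
  define A B C where "A = \<bar>b $ 1\<bar>" "B = \<bar>b $ 2\<bar>" "C = \<bar>b $ 3\<bar>"
  have nn: "A \<ge> 0" "B \<ge> 0" "C \<ge> 0" and l1': "A + B + C \<le> 1" and l2': "A * A + B * B + C * C = 1"
    using l1 l2 by (simp_all add: A_B_C_def)
  have p: "A * B \<ge> 0" "A * C \<ge> 0" "B * C \<ge> 0" using nn by simp_all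
  have "(A + B + C) * (A + B + C) \<le> 1"
    using l1' nn by (simp add: mult_le_one)
  then have "2 * (A * B + A * C + B * C) \<le> 0"
    using l2' by (simp add: algebra_simps)
  then have "A * B = 0" "A * C = 0" "B * C = 0" using p by (smt (verit))+
  then have "A = 0 \<and> B = 0 \<and> C * C = 1 \<or> A = 0 \<and> C = 0 \<and> B * B = 1 \<or> B = 0 \<and> C = 0 \<and> A * A = 1"
    using l2' by auto
  then have "b $ 1 = 0 \<and> b $ 2 = 0 \<and> \<bar>b $ 3\<bar> = 1 \<or> b $ 1 = 0 \<and> b $ 3 = 0 \<and> \<bar>b $ 2\<bar> = 1 \<or>
      b $ 2 = 0 \<and> b $ 3 = 0 \<and> \<bar>b $ 1\<bar> = 1"
    using nn by (auto simp: A_B_C_def square_eq_1_iff)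
  then show ?thesis
    unfolding b_def[symmetric] by (auto simp: axes_def eq_3 abs_if split: if_splits)
qed

lemma cube_rotation_frame:
  assumes "\<rho> \<in> cube_rotations r" "r > 0" "frame e n"
  shows "frame (\<rho> *v e) (\<rho> *v n)"
  using assms cube_rotation_axes cube_rotationD(1) by (auto simp: frame_def)

text \<open>The orthogonal map that matches the two frames respects the cross product of the frame vectors,
  so it is a rotation.\<close>

lemma cube_rotation_exists:
  assumes f: "frame e n" and f': "frame e' n'"
  obtains \<rho> where "\<rho> \<in> cube_rotations r" "\<rho> *v e = e'" "\<rho> *v n = n'"
proof -
  define R where "R e n e' n' x = (x \<bullet> e) *\<^sub>R e' + (x \<bullet> (n \<times> e)) *\<^sub>R (n' \<times> e') + (x \<bullet> n) *\<^sub>R n'"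
    for e n e' n' x :: "real ^ 3"
  have lin: "linear (R e n e' n')" for e n e' n'
    unfolding R_def by (intro linearI) (simp_all add: inner_add_left algebra_simps)
  have comp: "R e n e' n' x \<bullet> e' = x \<bullet> e" "R e n e' n' x \<bullet> (n' \<times> e') = x \<bullet> (n \<times> e)"
      "R e n e' n' x \<bullet> n' = x \<bullet> n" if "frame e' n'" for e n e' n' x
    using frame_inner[OF that] by (simp_all add: R_def inner_add_left)
  have inv: "R e' n' e n (R e n e' n' x) = x" if "frame e n" "frame e' n'" for e n e' n' x
    unfolding R_def[of e' n' e n] comp[OF that(2)] using frame_expand[OF that(1), of x] by simp
  have cub: "R e n e' n' x \<in> cube r \<longleftrightarrow> x \<in> cube r" if "frame e n" "frame e' n'" for e n e' n' x
    unfolding frame_cube[OF that(1), of x] frame_cube[OF that(2), of "R e n e' n' x"] comp[OF that(2)] by simp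
  define \<rho> where "\<rho> = matrix (R e n e' n')"
  have \<rho>: "\<rho> *v x = R e n e' n' x" for x
    unfolding \<rho>_def using lin by (simp add: matrix_works)
  have e: "\<rho> *v e = e'" "\<rho> *v n = n'" "\<rho> *v (n \<times> e) = n' \<times> e'"
    using frame_inner[OF f] by (simp_all add: \<rho> R_def)
  have "R e n e' n' x \<bullet> R e n e' n' y = x \<bullet> y" for x y
  proof -
    have "R e n e' n' x \<bullet> R e n e' n' y =
        R e n e' n' x \<bullet> ((y \<bullet> e) *\<^sub>R e' + (y \<bullet> (n \<times> e)) *\<^sub>R (n' \<times> e') + (y \<bullet> n) *\<^sub>R n')"
      by (simp only: R_def[of e n e' n' y])
    also have "\<dots> = (y \<bullet> e) * (x \<bullet> e) + (y \<bullet> (n \<times> e)) * (x \<bullet> (n \<times> e)) + (y \<bullet> n) * (x \<bullet> n)"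
      by (simp only: inner_add_right inner_scaleR_right comp[OF f'])
    also have "\<dots> = x \<bullet> ((y \<bullet> e) *\<^sub>R e + (y \<bullet> (n \<times> e)) *\<^sub>R (n \<times> e) + (y \<bullet> n) *\<^sub>R n)"
      by (simp only: inner_add_right inner_scaleR_right)
    finally show ?thesis using frame_expand[OF f, of y] by simp
  qed
  then have "orthogonal_transformation (R e n e' n')"
    using lin by (simp add: orthogonal_transformation_def)
  then have orth: "orthogonal_matrix \<rho>"
    by (simp add: \<rho>_def orthogonal_transformation_matrix)
  have "\<not> rotoinversion_matrix \<rho>"
  proof
    assume "rotoinversion_matrix \<rho>"
    then have "(\<rho> *v n) \<times> (\<rho> *v e) = - \<rho> *v (n \<times> e)" by (rule cross_rotoinversion_matrix)
    moreover have "- \<rho> *v (n \<times> e) = - (\<rho> *v (n \<times> e))" 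
      by (simp add: vec_eq_iff matrix_vector_mult_def sum_negf)
    ultimately have "n' \<times> e' = - (n' \<times> e')" using e by simp
    then have "n' \<times> e' = 0" by (simp add: eq_neg_iff_add_eq_0 flip: scaleR_2)
    then show False using frame_inner(5)[OF f'] by simp
  qed
  then have "rotation_matrix \<rho>" using orth orthogonal_rotation_or_rotoinversion by blast
  moreover have "(\<lambda>x. \<rho> *v x) ` cube r = cube r"
  proof (intro subset_antisym subsetI)
    fix y assume "y \<in> cube r"
    then have "R e' n' e n y \<in> cube r" "y = \<rho> *v (R e' n' e n y)"
      using cub[OF f' f] inv[OF f' f] by (simp_all add: \<rho>)
    then show "y \<in> (\<lambda>x. \<rho> *v x) ` cube r" by blast
  qed (auto simp: \<rho> cub[OF f f'])
  ultimately have "\<rho> \<in> cube_rotations r" by (simp add: cube_rotations_def)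
  then show thesis using that e by blast
qed

text \<open>At a vertex of the cube the sign of this product tells which of the two inscribed tetrahedra the
  vertex belongs to.\<close>

definition vertex_colour :: "real ^ 3 \<Rightarrow> real" where
  "vertex_colour x = x $ 1 * x $ 2 * x $ 3"

text \<open>A matrix with columns among the axis vectors permutes the coordinates and changes signs; so it
  changes the product of the coordinates by a sign only.\<close>

lemma vertex_colour_frame:
  assumes "a \<in> axes" "b \<in> axes" "a \<bullet> b = 0"
  shows "vertex_colour (x *\<^sub>R a + y *\<^sub>R b + z *\<^sub>R (a \<times> b)) = vertex_colour (a + b + a \<times> b) * (x * y * z)"
    "vertex_colour (a + b + a \<times> b) = 1 \<or> vertex_colour (a + b + a \<times> b) = -1"
  using assms unfolding axes_def
  by (elim conjE insertE emptyE; hypsubst; simp add: inner_3 vertex_colour_def cross_components)+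

lemma cube_rotation_colour:
  assumes "\<rho> \<in> cube_rotations r" "r > 0"
  obtains \<kappa> where "\<kappa> = 1 \<or> \<kappa> = -1" "\<And>x. vertex_colour (\<rho> *v x) = \<kappa> * vertex_colour x"
proof -
  define a b :: "real ^ 3" where "a = \<rho> *v vector [1,0,0]" and "b = \<rho> *v vector [0,1,0]"
  have ab: "a \<in> axes" "b \<in> axes" "a \<bullet> b = 0"
    using cube_rotation_axes[OF assms] cube_rotationD(1)[OF assms(1)]
    by (auto simp: a_def b_def axes_def inner_3)
  have "\<rho> *v x = x $ 1 *\<^sub>R a + x $ 2 *\<^sub>R b + x $ 3 *\<^sub>R (a \<times> b)" for x
  proof -
    have "x = x $ 1 *\<^sub>R vector [1,0,0] + x $ 2 *\<^sub>R vector [0,1,0] + x $ 3 *\<^sub>R (vector [1,0,0] \<times> vector [0,1,0])"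
      by (simp add: eq_3 cross_components)
    then show ?thesis
      using cube_rotationD[OF assms(1)] unfolding a_def b_def by metis
  qed
  then have "vertex_colour (\<rho> *v x) = vertex_colour (a + b + a \<times> b) * vertex_colour x" for x
    using vertex_colour_frame(1)[OF ab, of "x $ 1" "x $ 2" "x $ 3"] by (simp add: vertex_colour_def[of x])
  then show thesis using that vertex_colour_frame(2)[OF ab] by blast
qed

section \<open>Square regions\<close>

lemma region_eq: "region (p, v) = (\<lambda>w. p + w * v) ` {w. 0 \<le> Re w \<and> Re w \<le> 1 \<and> 0 \<le> Im w \<and> Im w \<le> 1}"
proof (intro subset_antisym subsetI)
  fix z assume "z \<in> region (p, v)"
  then obtain s t where "z = p + of_real s * v + of_real t * (\<i> * v)" "0 \<le> s" "s \<le> 1" "0 \<le> t" "t \<le> 1"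
    unfolding region_def by auto
  then have "z = p + Complex s t * v" "Complex s t \<in> {w. 0 \<le> Re w \<and> Re w \<le> 1 \<and> 0 \<le> Im w \<and> Im w \<le> 1}"
    by (simp_all add: Complex_eq algebra_simps)
  then show "z \<in> (\<lambda>w. p + w * v) ` {w. 0 \<le> Re w \<and> Re w \<le> 1 \<and> 0 \<le> Im w \<and> Im w \<le> 1}" by blast
next
  fix z assume "z \<in> (\<lambda>w. p + w * v) ` {w. 0 \<le> Re w \<and> Re w \<le> 1 \<and> 0 \<le> Im w \<and> Im w \<le> 1}"
  then obtain w where w: "z = p + w * v" "0 \<le> Re w" "Re w \<le> 1" "0 \<le> Im w" "Im w \<le> 1" by auto
  have "z = p + of_real (Re w) * v + of_real (Im w) * (\<i> * v)"
    by (subst w(1), subst complex_eq[of w]) (simp add: algebra_simps)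
  then show "z \<in> region (p, v)" using w unfolding region_def by blast
qed

lemma region_box: "region (p, v) = (+) p ` (\<lambda>w. w * v) ` cbox 0 (Complex 1 1)"
  unfolding region_eq image_image by (intro image_cong) (auto simp: in_cbox_complex_iff)

lemma corners_eq: "corners (p, v) = (\<lambda>w. p + w * v) ` {0, 1, 1 + \<i>, \<i>}"
  by (simp add: corners_def algebra_simps)

lemma region_convex: "convex (region (p, v))"
  unfolding region_box
  by (intro convex_translation convex_linear_image convex_box) (auto intro: linearI simp: algebra_simps)

lemma region_interior:
  assumes "v \<noteq> 0"
  shows "interior (region (p, v)) = (+) p ` (\<lambda>w. w * v) ` box 0 (Complex 1 1)"
proof -
  have "linear (\<lambda>w. w * v)" by (intro linearI) (auto simp: algebra_simps)
  moreover have "inj (\<lambda>w. w * v)" using assms by (simp add: inj_def)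
  ultimately show ?thesis
    unfolding region_box by (simp add: interior_translation interior_injective_linear_image interior_cbox del: cbox_complex_eq)
qed

text \<open>A convex set with interior points is contained in the closure of its interior.\<close>

lemma open_meets_region:
  assumes "v \<noteq> 0" "x \<in> region (p, v)" "open U" "x \<in> U"
  shows "U \<inter> interior (region (p, v)) \<noteq> {}"
proof -
  have "Complex (1/2) (1/2) \<in> box 0 (Complex 1 1)" by (simp add: in_box_complex_iff)
  then have "interior (region (p, v)) \<noteq> {}" unfolding region_interior[OF assms(1)] by blast
  then have "closure (interior (region (p, v))) = closure (region (p, v))"
    by (rule convex_closure_interior[OF region_convex])
  then have "x \<in> closure (interior (region (p, v)))"
    using assms(2) closure_subset by blast
  then show ?thesis using assms(3,4) by (metis closure_iff_nhds_not_empty order_refl inf_commute)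
qed

lemma corners_in_region: "corners (p, v) \<subseteq> region (p, v)"
  unfolding corners_eq region_eq by (intro image_mono) auto

text \<open>Three corners of the square are not collinear.\<close>

lemma isometry_eq_of_eq_on_region:
  assumes "plane_isometry g" "plane_isometry h" "v \<noteq> 0" "\<And>x. x \<in> region (p, v) \<Longrightarrow> g x = h x"
  shows "g = h"
proof -
  have e: "g p = h p" "g (p + v) = h (p + v)" "g (p + \<i> * v) = h (p + \<i> * v)"
    using corners_in_region by (auto simp: corners_def intro!: assms(4))
  obtain u b where g: "norm u = 1" "g = (\<lambda>z. u * z + b) \<or> g = (\<lambda>z. u * cnj z + b)"
    using plane_isometry_form[OF assms(1)] .
  obtain u' b' where h: "norm u' = 1" "h = (\<lambda>z. u' * z + b') \<or> h = (\<lambda>z. u' * cnj z + b')"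
    using plane_isometry_form[OF assms(2)] .
  have nz: "u \<noteq> 0" "u' \<noteq> 0" using g h by auto
  from g(2) h(2) show ?thesis
  proof (elim disjE)
    assume "g = (\<lambda>z. u * z + b)" "h = (\<lambda>z. u' * z + b')"
    then have *: "u * p + b = u' * p + b'" "u * (p + v) + b = u' * (p + v) + b'" using e(1,2) by auto
    then have "u * (p + v) + b - (u * p + b) = u' * (p + v) + b' - (u' * p + b')" by simp
    then have "u * v = u' * v" by (simp add: algebra_simps)
    then show ?thesis using * assms(3) \<open>g = _\<close> \<open>h = _\<close> by simp
  next
    assume "g = (\<lambda>z. u * cnj z + b)" "h = (\<lambda>z. u' * cnj z + b')"
    then have *: "u * cnj p + b = u' * cnj p + b'" "u * cnj (p + v) + b = u' * cnj (p + v) + b'" using e(1,2) by auto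
    then have "u * cnj (p + v) + b - (u * cnj p + b) = u' * cnj (p + v) + b' - (u' * cnj p + b')" by simp
    then have "u * cnj v = u' * cnj v" by (simp add: algebra_simps)
    then show ?thesis using * assms(3) \<open>g = _\<close> \<open>h = _\<close> by simp
  next
    assume gh: "g = (\<lambda>z. u * z + b)" "h = (\<lambda>z. u' * cnj z + b')"
    have "g (p + v) - g p = h (p + v) - h p" "g (p + \<i> * v) - g p = h (p + \<i> * v) - h p"
      using e by simp_all
    then have "u * v = u' * cnj v" "u * (\<i> * v) = - (\<i> * (u' * cnj v))"
      unfolding gh by (simp_all add: algebra_simps)
    then have "2 * \<i> * (u * v) = 0" by (simp add: algebra_simps)
    then show ?thesis using nz assms(3) by simp
  next
    assume gh: "g = (\<lambda>z. u * cnj z + b)" "h = (\<lambda>z. u' * z + b')"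
    have "g (p + v) - g p = h (p + v) - h p" "g (p + \<i> * v) - g p = h (p + \<i> * v) - h p"
      using e by simp_all
    then have "u * cnj v = u' * v" "- (\<i> * (u * cnj v)) = u' * (\<i> * v)"
      unfolding gh by (simp_all add: algebra_simps)
    then have "2 * \<i> * (u' * v) = 0" by (simp add: algebra_simps)
    then show ?thesis using nz assms(3) by simp
  qed
qed

lemma in_interior_cell:
  assumes "Re z \<notin> \<int>" "Im z \<notin> \<int>"
  shows "z \<in> interior (cell \<lfloor>Re z\<rfloor> \<lfloor>Im z\<rfloor>)"
proof (rule interiorI)
  define b where "b = box (Complex (of_int \<lfloor>Re z\<rfloor>) (of_int \<lfloor>Im z\<rfloor>)) (Complex (of_int \<lfloor>Re z\<rfloor> + 1) (of_int \<lfloor>Im z\<rfloor> + 1))"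
  show "open b" by (simp add: b_def open_box)
  have "of_int \<lfloor>x\<rfloor> < x" if "x \<notin> \<int>" for x :: real
    using that by (metis Ints_of_int of_int_floor_le order_le_less)
  then show "z \<in> b" using assms by (simp add: b_def in_box_complex_iff)
  show "b \<subseteq> cell \<lfloor>Re z\<rfloor> \<lfloor>Im z\<rfloor>"
    by (auto simp: b_def in_box_complex_iff cell_iff warp_iff weft_iff)
qed

section \<open>Corners of the regions of a woven cube\<close>

lemma cube_rotation_face:
  assumes "\<rho> \<in> cube_rotations r"
  shows "(\<lambda>x. \<rho> *v x) ` face r a = face r (\<rho> *v a)"
proof (intro subset_antisym subsetI)
  fix y assume "y \<in> face r (\<rho> *v a)"
  then have y: "y \<in> cube r" "y \<bullet> (\<rho> *v a) = r" by (auto simp: face_def)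
  then obtain x where "x \<in> cube r" "y = \<rho> *v x"
    using cube_rotationD(5)[OF assms] by (metis imageE)
  then show "y \<in> (\<lambda>x. \<rho> *v x) ` face r a"
    using y cube_rotationD(1)[OF assms] by (auto simp: face_def)
next
  fix y assume "y \<in> (\<lambda>x. \<rho> *v x) ` face r a"
  then show "y \<in> face r (\<rho> *v a)"
    using cube_rotationD(1)[OF assms] cube_rotationD(5)[OF assms] by (auto simp: face_def)
qed

lemma induces_face:
  assumes "induces f \<rho> A B g"
  shows "f ` region B = (\<lambda>x. \<rho> *v x) ` f ` region A"
proof -
  have "f ` region B = f ` g ` region A" "\<forall>x\<in>region A. f (g x) = \<rho> *v f x"
    using assms by (auto simp: induces_def)
  then show ?thesis by (simp add: image_image cong: image_cong)
qed

text \<open>The diameter of the square is \<open>sqrt 2 * norm v\<close> and that of the face is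
  \<open>2 * sqrt 2 * r\<close>. As the folding is an isometry, they agree, and a distance equal
  to the diameter is only attained between opposite corners.\<close>

lemma diagonal_corners:
  assumes iso: "\<And>x y. x \<in> region (p, v) \<Longrightarrow> y \<in> region (p, v) \<Longrightarrow> dist (f x) (f y) = dist x y"
    and img: "f ` region (p, v) = face r (vector [0,0,1])" and "r > 0" and "v \<noteq> 0"
    and x: "x \<in> region (p, v)" and y: "y \<in> region (p, v)" and d: "(dist (f x) (f y))\<^sup>2 = 8 * r\<^sup>2"
  shows "x \<in> corners (p, v)" "norm v = 2 * r"
proof -
  have "p \<in> region (p, v)" "p + (1 + \<i>) * v \<in> region (p, v)"
    using corners_in_region unfolding corners_eq by force+
  then have "dist (f p) (f (p + (1 + \<i>) * v)) = dist p (p + (1 + \<i>) * v)" 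
    and F: "f p \<in> face r (vector [0,0,1])" "f (p + (1 + \<i>) * v) \<in> face r (vector [0,0,1])"
    using iso img by auto
  moreover have "(norm ((1 + \<i>) * v))\<^sup>2 = 2 * (norm v)\<^sup>2"
    by (simp add: norm_mult power_mult_distrib cmod_power2)
  ultimately have 1: "(dist (f p) (f (p + (1 + \<i>) * v)))\<^sup>2 = 2 * (norm v)\<^sup>2"
    by (simp add: dist_norm)
  have sq: "(dist a b)\<^sup>2 = (a $ 1 - b $ 1)\<^sup>2 + (a $ 2 - b $ 2)\<^sup>2 + (a $ 3 - b $ 3)\<^sup>2" for a b :: "real ^ 3"
    unfolding dist_norm power2_norm_eq_inner by (simp add: inner_3 power2_eq_square)
  have "(dist (f p) (f (p + (1 + \<i>) * v)))\<^sup>2 \<le> (2 * r)\<^sup>2 + (2 * r)\<^sup>2 + 0"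
  proof -
    have "(a - b)\<^sup>2 \<le> (2 * r)\<^sup>2" if "\<bar>a\<bar> \<le> r" "\<bar>b\<bar> \<le> r" for a b
      using that by (intro abs_le_square_iff[THEN iffD1]) auto
    then show ?thesis
      unfolding sq using F by (intro add_mono) (auto simp: face_def cube_iff inner_3 simp del: power_mult_distrib)
  qed
  then have 2: "(norm v)\<^sup>2 \<le> 4 * r\<^sup>2" using 1 by (simp add: power_mult_distrib)
  obtain w where w: "x = p + w * v" "0 \<le> Re w" "Re w \<le> 1" "0 \<le> Im w" "Im w \<le> 1"
    using x unfolding region_eq by blast
  obtain w' where w': "y = p + w' * v" "0 \<le> Re w'" "Re w' \<le> 1" "0 \<le> Im w'" "Im w' \<le> 1"
    using y unfolding region_eq by blast
  have "x - y = (w - w') * v" by (simp add: w w' algebra_simps)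
  then have "(dist x y)\<^sup>2 = ((Re w - Re w')\<^sup>2 + (Im w - Im w')\<^sup>2) * (norm v)\<^sup>2"
    by (simp add: dist_norm norm_mult power_mult_distrib cmod_power2)
  then have 3: "((Re w - Re w')\<^sup>2 + (Im w - Im w')\<^sup>2) * (norm v)\<^sup>2 = 8 * r\<^sup>2"
    using d iso[OF x y] by simp
  have re: "(Re w - Re w')\<^sup>2 \<le> 1" and im: "(Im w - Im w')\<^sup>2 \<le> 1"
    using w w' by (auto simp: abs_square_le_1)
  have "8 * r\<^sup>2 \<le> 2 * (norm v)\<^sup>2"
    unfolding 3[symmetric] using re im by (intro mult_right_mono) auto
  then have nv: "(norm v)\<^sup>2 = 4 * r\<^sup>2" using 2 by linarith
  then have "(norm v)\<^sup>2 = (2 * r)\<^sup>2" by (simp add: power_mult_distrib)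
  then show "norm v = 2 * r" using \<open>r > 0\<close> power2_eq_iff_nonneg[of "norm v" "2 * r"] by auto
  have "(Re w - Re w')\<^sup>2 + (Im w - Im w')\<^sup>2 = 2" using 3 nv \<open>r > 0\<close> by simp
  then have "(Re w - Re w')\<^sup>2 = 1" "(Im w - Im w')\<^sup>2 = 1" using re im by linarith+
  then have "Re w \<in> {0, 1}" "Im w \<in> {0, 1}" using w w' by (auto simp: power2_eq_1_iff)
  then have "w \<in> {0, 1, 1 + \<i>, \<i>}" by (auto simp: complex_eq_iff)
  then show "x \<in> corners (p, v)" unfolding corners_eq w(1) by blast
qed

text \<open>The rotation \<open>\<rho>\<close> permutes the axes cyclically; it takes the face of
  \<open>A\<close> to that of \<open>B\<close>, then to that of \<open>C\<close>, and back.
  Going round once gives the identity of the plane, so \<open>\<rho>\<close> is preserving. The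
  motion \<open>k\<close> that carries \<open>A\<close> to \<open>B\<close> and then lays
  \<open>B\<close> beside \<open>A\<close> fixes the corner \<open>c\<close> at the vertex and
  takes one side of \<open>A\<close> at \<open>c\<close> to the other; it is a quarter-turn
  about \<open>c\<close>, in one of the two directions. A cell that is cut by the edge shows
  that it is preserving.\<close>

lemma preserving_corner_of_woven_cube:
  assumes W: "isonemal_woven_cube P N r f" and "isonemal P" "has_order P n" "n > 4"
  obtains p v where "lattice_unit P (p, v)" "corners (p, v) \<subseteq> cell_corners" "preserving P p"
proof -
  have nf: "net_folding N r f" and match: "matches_across_edges P N f"
    and inv: "\<And>\<rho>. \<rho> \<in> cube_rotations r \<Longrightarrow> \<exists>\<epsilon>. weaving_invariant P N f \<rho> \<epsilon>"
    and cc: "\<And>A. A \<in> N \<Longrightarrow> corners A \<subseteq> cell_corners" and lu: "\<And>A. A \<in> N \<Longrightarrow> lattice_unit P A"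
    using W unfolding isonemal_woven_cube_def by auto
  have r: "r > 0" and iso: "\<And>A x y. A \<in> N \<Longrightarrow> x \<in> region A \<Longrightarrow> y \<in> region A \<Longrightarrow> dist (f x) (f y) = dist x y"
    and bij: "bij_betw (\<lambda>A. f ` region A) N (cube_faces r)" and nz: "\<And>A. A \<in> N \<Longrightarrow> snd A \<noteq> 0"
    using nf unfolding net_folding_def by auto
  have ex: "\<exists>A\<in>N. f ` region A = face r a" if "a \<in> axes" for a
    using bij that unfolding bij_betw_def cube_faces_eq by (metis (no_types, lifting) imageE imageI)
  have uniq: "A = B" if "A \<in> N" "B \<in> N" "f ` region A = f ` region B" for A B
    using bij that unfolding bij_betw_def inj_on_def by blast
  define e1 e2 e3 :: "real ^ 3" where "e1 = vector [1,0,0]" and "e2 = vector [0,1,0]" and "e3 = vector [0,0,1]"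
  have ax: "e1 \<in> axes" "e2 \<in> axes" "e3 \<in> axes" by (auto simp: e1_def e2_def e3_def axes_def)
  have fr: "frame e1 e3" "frame e2 e1" using ax by (auto simp: frame_def e1_def e2_def e3_def inner_3)
  obtain \<rho> where \<rho>: "\<rho> \<in> cube_rotations r" "\<rho> *v e1 = e2" "\<rho> *v e3 = e1"
    using cube_rotation_exists[OF fr] by blast
  have cr: "e3 \<times> e1 = e2" "e1 \<times> e2 = e3" by (simp_all add: e1_def e2_def e3_def eq_3 cross_components)
  have \<rho>2: "\<rho> *v e2 = e3" using cube_rotationD(2)[OF \<rho>(1), of e3 e1] \<rho>(2,3) cr by simp
  have \<rho>x: "\<rho> *v vector [x, y, z] = vector [z, x, y]" for x y z
  proof -
    have "vector [x, y, z] = x *\<^sub>R e1 + y *\<^sub>R e2 + z *\<^sub>R e3"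
      by (simp add: e1_def e2_def e3_def eq_3)
    then have "\<rho> *v vector [x, y, z] = x *\<^sub>R e2 + y *\<^sub>R e3 + z *\<^sub>R e1"
      using cube_rotationD(3,4)[OF \<rho>(1)] \<rho>(2,3) \<rho>2 by simp
    then show ?thesis by (simp add: e1_def e2_def e3_def eq_3)
  qed
  obtain A B C where A: "A \<in> N" "f ` region A = face r e3" and B: "B \<in> N" "f ` region B = face r e1"
    and C: "C \<in> N" "f ` region C = face r e2"
    using ex ax by metis
  obtain \<epsilon> where wi: "weaving_invariant P N f \<rho> \<epsilon>" using inv \<rho>(1) by blast
  have step: "\<exists>g. induces f \<rho> X Y g \<and> (\<forall>i j. interior (cell i j) \<inter> interior (region X) \<noteq> {} \<longrightarrow> carries P g \<epsilon> i j)"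
    if XY: "X \<in> N" "Y \<in> N" "f ` region X = face r a" "f ` region Y = face r (\<rho> *v a)" for X Y a
  proof -
    obtain Y' g where g: "Y' \<in> N" "induces f \<rho> X Y' g"
      "\<forall>i j. interior (cell i j) \<inter> interior (region X) \<noteq> {} \<longrightarrow> carries P g \<epsilon> i j"
      using wi XY(1) unfolding weaving_invariant_def by blast
    have "f ` region Y' = f ` region Y"
      using induces_face[OF g(2)] cube_rotation_face[OF \<rho>(1)] XY(3,4) by simp
    then have "Y' = Y" using uniq g(1) XY(2) by blast
    then show ?thesis using g by blast
  qed
  obtain g1 where g1: "induces f \<rho> A B g1"
    "\<And>i j. interior (cell i j) \<inter> interior (region A) \<noteq> {} \<Longrightarrow> carries P g1 \<epsilon> i j"
    using step[OF A(1) B(1) A(2)] B(2) \<rho> by auto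
  obtain g2 where g2: "induces f \<rho> B C g2"
    "\<And>i j. interior (cell i j) \<inter> interior (region B) \<noteq> {} \<Longrightarrow> carries P g2 \<epsilon> i j"
    using step[OF B(1) C(1) B(2)] C(2) \<rho> by auto
  obtain g3 where g3: "induces f \<rho> C A g3"
    "\<And>i j. interior (cell i j) \<inter> interior (region C) \<noteq> {} \<Longrightarrow> carries P g3 \<epsilon> i j"
    using step[OF C(1) A(1) C(2)] A(2) \<rho>2 by auto
  have g1r: "plane_isometry g1" "g1 ` region A = region B" "\<And>x. x \<in> region A \<Longrightarrow> f (g1 x) = \<rho> *v f x"
    and g2r: "plane_isometry g2" "g2 ` region B = region C" "\<And>x. x \<in> region B \<Longrightarrow> f (g2 x) = \<rho> *v f x"
    and g3r: "plane_isometry g3" "g3 ` region C = region A" "\<And>x. x \<in> region C \<Longrightarrow> f (g3 x) = \<rho> *v f x"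
    using g1(1) g2(1) g3(1) by (auto simp: induces_def)
  obtain p v where Apv: "A = (p, v)" by (cases A)
  have v0: "v \<noteq> 0" using nz[OF A(1)] Apv by simp
  have inj: "x = y" if "x \<in> region A" "y \<in> region A" "f x = f y" for x y
    using iso[OF A(1) that(1,2)] that(3) by simp
  have pre: "\<exists>x\<in>region A. f x = y" if "y \<in> face r e3" for y
    using A(2) that by (metis imageE)
  have vf: "vector [x, y, r] \<in> face r e3" if "\<bar>x\<bar> \<le> r" "\<bar>y\<bar> \<le> r" for x y
    using that r by (simp add: face_def cube_iff inner_3 e3_def)
  obtain c where c: "c \<in> region A" "f c = vector [r, r, r]" using pre vf[of r r] r by auto
  obtain x1 where x1: "x1 \<in> region A" "f x1 = vector [-r, r, r]" using pre vf[of "-r" r] r by auto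
  obtain x2 where x2: "x2 \<in> region A" "f x2 = vector [r, -r, r]" using pre vf[of r "-r"] r by auto
  obtain x3 where x3: "x3 \<in> region A" "f x3 = vector [-r, -r, r]" using pre vf[of "-r" "-r"] r by auto
  have sq: "(dist a b)\<^sup>2 = (a $ 1 - b $ 1)\<^sup>2 + (a $ 2 - b $ 2)\<^sup>2 + (a $ 3 - b $ 3)\<^sup>2" for a b :: "real ^ 3"
    unfolding dist_norm power2_norm_eq_inner by (simp add: inner_3 power2_eq_square)
  have isoA: "dist (f x) (f y) = dist x y" if "x \<in> region (p, v)" "y \<in> region (p, v)" for x y
    using iso[OF A(1)] that Apv by simp
  have "(dist (f c) (f x3))\<^sup>2 = 8 * r\<^sup>2" "(dist (f x1) (f x2))\<^sup>2 = 8 * r\<^sup>2"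
    unfolding sq c x1 x2 x3 by (simp_all add: power2_eq_square)
  then have cor: "c \<in> corners (p, v)" "x1 \<in> corners (p, v)" and nv: "norm v = 2 * r"
    using diagonal_corners[where f = f and r = r and p = p and v = v, OF isoA _ r v0]
      A(2) c(1) x1(1) x2(1) x3(1) unfolding Apv e3_def by blast+
  obtain d where d: "d \<in> units" "x1 = c + d * v"
  proof -
    have "(dist c x1)\<^sup>2 = 4 * r\<^sup>2"
      unfolding iso[OF A(1) c(1) x1(1), symmetric] unfolding sq c x1 by (simp add: power2_eq_square)
    obtain w w' where ww: "w \<in> {0, 1, 1 + \<i>, \<i>}" "w' \<in> {0, 1, 1 + \<i>, \<i>}" "c = p + w * v" "x1 = p + w' * v"
      using cor unfolding corners_eq by blast
    have "c - x1 = (w - w') * v" by (simp add: ww algebra_simps)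
    then have "(norm (w - w'))\<^sup>2 * (4 * r\<^sup>2) = 4 * r\<^sup>2"
      using \<open>(dist c x1)\<^sup>2 = 4 * r\<^sup>2\<close> nv by (simp add: dist_norm norm_mult power_mult_distrib)
    then have "(norm (w - w'))\<^sup>2 = 1" using r by simp
    then have "w' - w \<in> units" using ww(1,2) unfolding cmod_power2 units_def by (auto simp: power2_eq_square)
    then show thesis using that[of "w' - w"] ww(3,4) by (simp add: algebra_simps)
  qed
  have Lp: "lattice_unit P (p, v)" "corners (p, v) \<subseteq> cell_corners"
    using lu[OF A(1)] cc[OF A(1)] Apv by simp_all
  obtain a b where ab: "v = Complex (of_int a) (of_int b)" "a \<noteq> 0" "b \<noteq> 0"
    using nondegenerate_side[OF Lp assms(2-4)] by metis
  \<comment> \<open>A point \<open>x0\<close> of the edge whose coordinates differ from those of the corner \<open>c\<close> by less than 1,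
    and not by 0; so it lies in the interior of a cell.\<close>
  define s where "s = 1 / (\<bar>of_int a\<bar> + \<bar>of_int b\<bar> :: real)"
  have ab1: "\<bar>real_of_int a\<bar> \<ge> 1" "\<bar>real_of_int b\<bar> \<ge> 1" using ab by linarith+
  then have s: "0 < s" "s < 1" "\<bar>s * of_int a\<bar> < 1" "\<bar>s * of_int b\<bar> < 1" "s * of_int a \<noteq> 0" "s * of_int b \<noteq> 0"
    by (auto simp: s_def abs_mult divide_less_eq)
  define x0 where "x0 = c + of_real s * (d * v)"
  have x0s: "x0 \<in> closed_segment c x1"
    using s unfolding closed_segment_def x0_def d(2) by (auto simp: algebra_simps scaleR_conv_of_real intro!: exI[of _ s])
  then have x0: "x0 \<in> region A"
    using region_convex[of p v] c(1) x1(1) unfolding Apv convex_contains_segment by blast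
  have "dist c x1 = dist c x0 + dist x0 x1"
    using x0s unfolding between_mem_segment[symmetric] between by blast
  then have "dist (f c) (f x1) = dist (f c) (f x0) + dist (f x0) (f x1)"
    by (simp only: iso[OF A(1)] c(1) x1(1) x0)
  then have "f x0 \<in> closed_segment (f c) (f x1)"
    unfolding between_mem_segment[symmetric] between .
  then obtain w where "f x0 = (1 - w) *\<^sub>R f c + w *\<^sub>R f x1"
    unfolding closed_segment_def by blast
  then have "f x0 $ 2 = (1 - w) * r + w * r"
    by (simp add: c(2) x1(2))
  then have "f x0 $ 2 = r" by (simp add: algebra_simps)
  moreover have "f x0 \<in> face r e3" using A(2) x0 by blast
  ultimately have fx0: "f x0 \<in> face r e2" by (simp add: face_def inner_3 e2_def)
  have nonint: "t \<notin> \<int>" if "\<bar>t - of_int m\<bar> < 1" "t \<noteq> of_int m" for t :: real and m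
  proof
    assume "t \<in> \<int>"
    then obtain k where "t = of_int k" by (auto elim: Ints_cases)
    then have "\<bar>real_of_int (k - m)\<bar> < 1" using that by simp
    then have "k = m" by linarith
    then show False using that \<open>t = of_int k\<close> by simp
  qed
  have "c \<in> cell_corners" using cor Lp by blast
  then obtain ci cj where cij: "Re c = of_int ci" "Im c = of_int cj"
    by (auto simp: cell_corners_iff elim!: Ints_cases)
  have "s * of_int a \<notin> \<int>" "s * of_int b \<notin> \<int>"
    using nonint[of _ 0] s by auto
  then have "Re x0 \<notin> \<int>" "Im x0 \<notin> \<int>"
    using d(1) cij by (auto simp: x0_def units_def ab)
  then obtain i0 j0 where cell0: "x0 \<in> interior (cell i0 j0)" using in_interior_cell by blast
  have meets: "interior (cell i j) \<inter> interior (region X) \<noteq> {}"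
    if "x \<in> interior (cell i j)" "x \<in> region X" "X \<in> N" for x i j X
    using open_meets_region[of "snd X" x "fst X" "interior (cell i j)"] that nz[OF that(3)] by simp
  have k1: "carries P g1 \<epsilon> i0 j0" using g1(2) meets cell0 x0 A(1) by blast
  then obtain i1 j1 where ij1: "g1 ` cell i0 j0 = cell i1 j1" using carriesE g1r(1) by metis
  have g1x: "g1 x0 \<in> interior (cell i1 j1)" "g1 x0 \<in> region B"
    unfolding ij1[symmetric] plane_isometry_interior[OF g1r(1)] using cell0 x0 g1r(2) by blast+
  have k2: "carries P g2 \<epsilon> i1 j1" using g2(2) meets g1x B(1) by blast
  then obtain i2 j2 where ij2: "g2 ` cell i1 j1 = cell i2 j2" using carriesE g2r(1) by metis
  have g2x: "g2 (g1 x0) \<in> interior (cell i2 j2)" "g2 (g1 x0) \<in> region C"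
    unfolding ij2[symmetric] plane_isometry_interior[OF g2r(1)] using g1x g2r(2) by blast+
  have k3: "carries P g3 \<epsilon> i2 j2" using g3(2) meets g2x C(1) by blast
  have iso21: "plane_isometry (g2 \<circ> g1)" using plane_isometry_comp g1r g2r by blast
  have ij21: "(g2 \<circ> g1) ` cell i0 j0 = cell i2 j2" using ij1 ij2 by (metis image_comp)
  have "carries P (g3 \<circ> (g2 \<circ> g1)) (kind_comp \<epsilon> (kind_comp \<epsilon> \<epsilon>)) i0 j0"
    using carries_comp[OF iso21 g3r(1) carries_comp[OF g1r(1) g2r(1) k1 ij1 k2] ij21 k3] .
  moreover have "g3 \<circ> (g2 \<circ> g1) = id"
  proof (rule isometry_eq_of_eq_on_region[OF _ _ v0])
    show "plane_isometry (g3 \<circ> (g2 \<circ> g1))" using plane_isometry_comp iso21 g3r by blast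
    show "plane_isometry id" by (simp add: plane_isometry_def)
    fix x assume "x \<in> region (p, v)"
    then have x: "x \<in> region A" "g1 x \<in> region B" "g2 (g1 x) \<in> region C" "g3 (g2 (g1 x)) \<in> region A"
      using Apv g1r(2) g2r(2) g3r(2) by blast+
    obtain a b c where abc: "f x = vector [a, b, c]"
      by (metis eq_3 vector_3)
    have "f (g3 (g2 (g1 x))) = f x"
      using g1r(3)[OF x(1)] g2r(3)[OF x(2)] g3r(3)[OF x(3)] abc \<rho>x by simp
    then show "(g3 \<circ> (g2 \<circ> g1)) x = id x" using inj x by simp
  qed
  ultimately have "\<epsilon> = Keep"
    using carries_unique[OF _ carries_id] by auto
  have "A \<noteq> B"
  proof
    assume "A = B"
    then have "f c \<in> face r e3" "f x1 \<in> face r e1" using A B x1 c by blast+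
    then show False using x1 r by (simp add: face_def e1_def inner_3)
  qed
  moreover have "f c \<in> f ` region B" using B c r by (simp add: face_def e1_def inner_3 cube_iff)
  then have "f ` region A \<inter> f ` region B \<noteq> {}" using c(1) by blast
  ultimately have "\<exists>h. unfolding_isometry f A B h \<and>
      (\<forall>i j. interior (cell i j) \<inter> {y \<in> region B. f y \<in> f ` region A} \<noteq> {} \<longrightarrow> carries P h Keep i j)"
    using match A(1) B(1) unfolding matches_across_edges_def by fast
  then obtain h where h: "unfolding_isometry f A B h"
    "\<And>i j. interior (cell i j) \<inter> {y \<in> region B. f y \<in> f ` region A} \<noteq> {} \<Longrightarrow> carries P h Keep i j"
    by blast
  have hr: "plane_isometry h" "\<And>y. y \<in> region B \<Longrightarrow> f y \<in> f ` region A \<Longrightarrow> h y \<in> region A \<and> f (h y) = f y"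
    "region A \<inter> h ` region B = {x \<in> region A. f x \<in> f ` region B}"
    using h(1) unfolding unfolding_isometry_def by auto
  define k where "k = h \<circ> g1"
  have k: "plane_isometry k" using plane_isometry_comp hr(1) g1r(1) by (simp add: k_def)
  have kx: "k x = y" if "x \<in> region A" "y \<in> region A" "\<rho> *v f x = f y" for x y
  proof -
    have "f (g1 x) \<in> f ` region A" "g1 x \<in> region B" using that g1r(2,3) by auto
    then have "h (g1 x) \<in> region A" "f (h (g1 x)) = f y" using hr(2)[of "g1 x"] that g1r(3) by auto
    then show ?thesis using inj that by (simp add: k_def)
  qed
  have kc: "k c = c" and k1x: "k x1 = x2" using kx c x1 x2 \<rho>x by auto
  have "carries P h Keep i1 j1"
  proof (rule h(2))
    have "\<rho> *v f x0 \<in> face r (\<rho> *v e2)" using fx0 cube_rotation_face[OF \<rho>(1)] by blast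
    then have "f (g1 x0) \<in> f ` region A" using g1r(3)[OF x0] \<rho>2 A(2) by simp
    then show "interior (cell i1 j1) \<inter> {y \<in> region B. f y \<in> f ` region A} \<noteq> {}" using g1x by blast
  qed
  then have kK: "carries P k Keep i0 j0"
    using carries_comp[OF g1r(1) hr(1) k1 ij1] \<open>\<epsilon> = Keep\<close> by (simp add: k_def)
  have nD: "norm (d * v) = 2 * r" using d(1) nv by (simp add: norm_mult)
  then have D0: "d * v \<noteq> 0" using r by auto
  define t where "t = (x2 - c) / (d * v)"
  have t: "x2 = c + t * (d * v)" using D0 by (simp add: t_def)
  have "(dist x1 x2)\<^sup>2 = 8 * r\<^sup>2" "(dist c x2)\<^sup>2 = 4 * r\<^sup>2"
    unfolding iso[OF A(1) x1(1) x2(1), symmetric] iso[OF A(1) c(1) x2(1), symmetric]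
    unfolding sq x1 x2 c by (simp_all add: power2_eq_square)
  moreover have "x1 - x2 = (1 - t) * (d * v)" "c - x2 = - t * (d * v)"
    unfolding t d(2) by (simp_all add: algebra_simps)
  ultimately have "(norm (1 - t))\<^sup>2 * (2 * r)\<^sup>2 = 8 * r\<^sup>2" "(norm t)\<^sup>2 * (2 * r)\<^sup>2 = 4 * r\<^sup>2"
    unfolding dist_norm nD[symmetric] power_mult_distrib[symmetric] norm_mult[symmetric]
    by (simp_all only: norm_mult norm_minus_cancel)
  then have "(norm (1 - t))\<^sup>2 = 2" "(norm t)\<^sup>2 = 1" using r by (simp_all add: power_mult_distrib)
  then have "Re t = 0" "\<bar>Im t\<bar> = 1"
    unfolding cmod_power2 by (auto simp: power2_eq_square algebra_simps square_eq_1_iff)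
  then have ti: "t = \<i> \<or> t = - \<i>" by (auto simp: complex_eq_iff abs_if split: if_splits)
  have "k = rotation c t"
  proof -
    obtain u b where u: "k = (\<lambda>z. u * z + b) \<or> k = (\<lambda>z. u * cnj z + b)"
      using plane_isometry_form[OF k] by metis
    from u show ?thesis
    proof
      assume kk: "k = (\<lambda>z. u * z + b)"
      have "k x1 - k c = x2 - c" using kc k1x by simp
      then have "u * (d * v) = t * (d * v)" unfolding kk by (simp add: d(2) t algebra_simps)
      then have "u = t" using D0 by simp
      moreover have b: "b = c - u * c" using kc kk by (simp add: algebra_simps)
      ultimately show ?thesis unfolding kk b rotation_def by (simp add: algebra_simps)
    next
      \<comment> \<open>The reflection in the diagonal of \<open>A\<close> through \<open>c\<close> would lay \<open>B\<close> upon \<open>A\<close> instead of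
        beside it.\<close>
      assume kk: "k = (\<lambda>z. u * cnj z + b)"
      have "k x1 - k c = x2 - c" using kc k1x by simp
      then have ut: "u * cnj (d * v) = t * (d * v)" unfolding kk by (simp add: d(2) t algebra_simps)
      have "k x2 - k c = cnj t * (u * cnj (d * v))" unfolding kk t by (simp add: algebra_simps)
      also have "\<dots> = (cnj t * t) * (d * v)" unfolding ut by simp
      also have "cnj t * t = 1" using ti by auto
      finally have "k x2 = x1" using kc by (simp add: d(2) diff_eq_eq add.commute)
      moreover have "k x2 \<in> h ` region B" using x2(1) g1r(2) by (auto simp: k_def)
      ultimately have "x1 \<in> region A \<inter> h ` region B" using x1(1) by simp
      then have "f x1 \<in> face r e1" using hr(3) B(2) by auto
      then show ?thesis using x1 r by (simp add: face_def e1_def inner_3)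
    qed
  qed
  obtain \<epsilon>' where Q: "(quarter_turn c, \<epsilon>') \<in> symmetries P"
    using Lp(1) cor(1) planar_groupE unfolding lattice_unit_def by metis
  have "(rotation c t, \<epsilon>') \<in> symmetries P"
    using ti
  proof
    assume "t = - \<i>"
    have "(quarter_turn c \<circ> (quarter_turn c \<circ> quarter_turn c), kind_comp \<epsilon>' (kind_comp \<epsilon>' \<epsilon>')) \<in> symmetries P"
      by (intro symmetries_comp Q)
    moreover have "quarter_turn c \<circ> (quarter_turn c \<circ> quarter_turn c) = rotation c t"
      by (auto simp: rotation_def fun_eq_iff algebra_simps \<open>t = - \<i>\<close>)
    ultimately show ?thesis by simp
  qed (use Q in simp)
  then have "\<epsilon>' = Keep"
    using kK carries_unique symmetriesD(3) unfolding \<open>k = rotation c t\<close> by metis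
  obtain w where w: "w \<in> {0, 1, 1 + \<i>, \<i>}" "c = p + w * v" using cor(1) unfolding corners_eq by blast
  then have "- w \<in> cell_corners" by auto
  then have "preserving P p"
    using preserving_translate[OF Lp(1) _ Q, of "- w"] \<open>\<epsilon>' = Keep\<close> w(2) by (simp add: preserving_def)
  then show thesis using that Lp by blast
qed

section \<open>A cross-shaped net\<close>

text \<open>An entry \<open>(q, e, n)\<close> says that the square in position \<open>q\<close> of the grid,
  counted in sides, becomes the face with normal \<open>n\<close>, with its first side vector
  along \<open>e\<close>. The frames arise by rolling the cube from the square in position 0,
  without turning it in the plane.\<close>

definition net_faces :: "(complex \<times> (real ^ 3) \<times> (real ^ 3)) set" where
  "net_faces = {(0, vector [1,0,0], vector [0,0,1]), (1, vector [0,0,-1], vector [1,0,0]),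
     (-1, vector [0,0,1], vector [-1,0,0]), (\<i>, vector [1,0,0], vector [0,1,0]),
     (-\<i>, vector [1,0,0], vector [0,-1,0]), (2, vector [-1,0,0], vector [0,0,-1])}"

text \<open>The plane is measured in half sides from the centre of the square in position 0, and the cube
  has the vertices \<open>(\<plusminus>1, \<plusminus>1, \<plusminus>1)\<close>. Cutting off the
  coordinates at \<open>\<plusminus>1\<close> bends the four arms down; the far square of the
  long arm, where \<open>Re u > 3\<close>, becomes the bottom.\<close>

definition fold_cross :: "complex \<Rightarrow> real ^ 3" where
  "fold_cross u = vector
     [if Re u \<le> 3 then max (- 1) (min 1 (Re u)) else 4 - Re u,
      max (- 1) (min 1 (Im u)),
      if Re u \<le> 3 then 1 - max 0 (\<bar>Re u\<bar> - 1) - max 0 (\<bar>Im u\<bar> - 1) else - 1]"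

text \<open>A square in half sides from its centre.\<close>

definition face_box :: "complex set" where
  "face_box = {u. \<bar>Re u\<bar> \<le> 1 \<and> \<bar>Im u\<bar> \<le> 1}"

lemma fold_cross_face:
  assumes "(q, e, n) \<in> net_faces" "u \<in> face_box"
  shows "fold_cross (2 * q + u) = n + along e n u"
proof -
  have u: "- 1 \<le> Re u" "Re u \<le> 1" "- 1 \<le> Im u" "Im u \<le> 1" using assms(2) by (auto simp: face_box_def abs_le_iff)
  show ?thesis
    using assms(1) unfolding net_faces_def
    by (elim insertE emptyE; simp; elim conjE; hypsubst)
      (use u in \<open>auto simp: eq_3 fold_cross_def along_def cross_components max_def min_def abs_if\<close>)
qed

lemma net_faces_frame:
  assumes "(q, e, n) \<in> net_faces" shows "frame e n" "q \<in> cell_corners"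
  using assms unfolding net_faces_def
  by (elim insertE emptyE; simp add: frame_def axes_def inner_3 cell_corners_iff)+

lemma net_faces_unique:
  assumes "(q, e, n) \<in> net_faces" "(q', e', n') \<in> net_faces"
  shows "q = q' \<longleftrightarrow> n = n'" "q = q' \<Longrightarrow> e = e'"
  using assms unfolding net_faces_def
  by (elim insertE emptyE; simp add: eq_3 complex_eq_iff)+

lemma net_faces_cover: "a \<in> axes \<Longrightarrow> \<exists>q e. (q, e, a) \<in> net_faces"
  unfolding net_faces_def axes_def by (elim insertE emptyE; hypsubst) blast+

text \<open>The chessboard colouring of the corners of the grid.\<close>

definition checker :: "complex \<Rightarrow> real" where
  "checker q = (if even (\<lfloor>Re q\<rfloor> + \<lfloor>Im q\<rfloor>) then 1 else - 1)"

lemma checker_simps [simp]: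
  "checker 0 = 1" "checker 1 = -1" "checker \<i> = -1" "checker (-1) = -1" "checker (-\<i>) = -1" "checker 2 = 1"
  "checker (1 + \<i>) = 1"
  "checker q * checker q = 1" "checker q * (checker q * x) = x"
  by (simp_all add: checker_def floor_minus)

lemma checker_add:
  assumes "a \<in> cell_corners" "b \<in> cell_corners" shows "checker (a + b) = checker a * checker b"
  using assms by (auto simp: checker_def cell_corners_iff elim!: Ints_cases)

lemma checker_uminus:
  assumes "a \<in> cell_corners" shows "checker (- a) = checker a"
  using assms by (auto simp: checker_def cell_corners_iff elim!: Ints_cases)

lemma checker_unit_mult:
  assumes "a \<in> cell_corners" "c \<in> units" shows "checker (c * a) = checker a"
  using assms by (auto simp: checker_def cell_corners_iff units_def elim!: Ints_cases)

lemma checker_unit [simp]: "c \<in> units \<Longrightarrow> checker c = -1"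
  by (auto simp: units_def)

lemma checker_even:
  assumes "q \<in> cell_corners" "checker q = 1"
  obtains q' where "q' \<in> cell_corners" "q = (\<i> - 1) * q'"
proof -
  obtain q' where q': "q' \<in> cell_corners" "q = (1 - \<i>) * q' \<or> q = 1 + (1 - \<i>) * q'"
    using gaussian_parity[OF assms(1)] by blast
  have "checker ((1 - \<i>) * q') = checker (q' + - (\<i> * q'))" by (simp add: algebra_simps)
  also have "\<dots> = 1"
    using q'(1) by (subst checker_add) (auto simp: checker_uminus checker_unit_mult)
  finally have *: "checker ((1 - \<i>) * q') = 1" .
  have "(1 - \<i>) * q' \<in> cell_corners" using q' by blast
  then have "checker (1 + (1 - \<i>) * q') = -1" by (subst checker_add) (auto simp: *)
  then have "q = (1 - \<i>) * q'" using q'(2) assms(2) by auto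
  then show thesis using that[of "- q'"] q'(1) by (simp add: algebra_simps)
qed

text \<open>At the corners \<open>u = \<plusminus>1 \<plusminus> \<i>\<close> of the square this says that
  the folding respects the colours: the corner has the colour \<open>checker q\<close> if
  \<open>Re u\<close> and \<open>Im u\<close> agree, and the other one otherwise.\<close>

lemma net_vertex_colour:
  assumes "(q, e, n) \<in> net_faces"
  shows "vertex_colour (n + along e n u) = checker q * (Re u * Im u)"
  using assms unfolding net_faces_def
  by (elim insertE emptyE; simp; elim conjE; hypsubst)
    (simp_all add: vertex_colour_def along_def cross_components)

text \<open>The grid of squares with side vector \<open>v\<close> and corners \<open>p + q * v\<close> for
  Gaussian integers \<open>q\<close>. Each square \<open>sq q\<close> has a chart, in half sides
  from its centre; the motion \<open>move q q' c\<close> takes \<open>sq q\<close> to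
  \<open>sq q'\<close> and is multiplication by \<open>c\<close> in the charts.\<close>

locale square_grid =
  fixes p v :: complex
  assumes side_nonzero: "v \<noteq> 0"
begin

definition sq :: "complex \<Rightarrow> square" where
  "sq q = (p + q * v, v)"

definition half :: complex where "half = v / 2"

definition chart :: "complex \<Rightarrow> complex \<Rightarrow> complex" where
  "chart q u = p + (1 + \<i> + 2 * q + u) * half"

definition coord :: "complex \<Rightarrow> complex" where
  "coord z = (z - p) / half - (1 + \<i>)"

definition move :: "complex \<Rightarrow> complex \<Rightarrow> complex \<Rightarrow> complex \<Rightarrow> complex" where
  "move q q' c z = chart q' (c * (coord z - 2 * q))"

definition radius :: real where "radius = norm half"

definition fold_net :: "complex \<Rightarrow> real ^ 3" where
  "fold_net z = radius *\<^sub>R fold_cross (coord z)"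

definition net :: "square set" where
  "net = sq ` {0, 1, -1, \<i>, -\<i>, 2}"

lemma half_nonzero: "half \<noteq> 0"
  using side_nonzero by (simp add: half_def)

lemma mult_side: "x * v = 2 * x * half"
  by (simp add: half_def)

lemma radius_pos: "radius > 0"
  using half_nonzero by (simp add: radius_def)

lemma sq_inject [simp]: "sq q = sq q' \<longleftrightarrow> q = q'"
  using side_nonzero by (simp add: sq_def)

lemma net_iff: "A \<in> net \<longleftrightarrow> (\<exists>q e n. (q, e, n) \<in> net_faces \<and> A = sq q)"
  unfolding net_def net_faces_def by auto

lemma region_sq: "region (sq q) = chart q ` face_box"
proof (intro subset_antisym subsetI)
  fix z assume "z \<in> region (sq q)"
  then obtain w where w: "z = p + q * v + w * v" "0 \<le> Re w" "Re w \<le> 1" "0 \<le> Im w" "Im w \<le> 1"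
    unfolding sq_def region_eq by blast
  have "z = chart q (2 * w - 1 - \<i>)" unfolding chart_def w(1) mult_side by (simp add: algebra_simps)
  moreover have "2 * w - 1 - \<i> \<in> face_box" using w by (auto simp: face_box_def abs_le_iff)
  ultimately show "z \<in> chart q ` face_box" by blast
next
  fix z assume "z \<in> chart q ` face_box"
  then obtain u where u: "z = chart q u" "u \<in> face_box" by blast
  have "z = p + q * v + ((1 + \<i> + u) / 2) * v" by (simp add: chart_def u(1) mult_side algebra_simps)
  moreover have "0 \<le> Re ((1 + \<i> + u) / 2)" "Re ((1 + \<i> + u) / 2) \<le> 1" "0 \<le> Im ((1 + \<i> + u) / 2)" "Im ((1 + \<i> + u) / 2) \<le> 1"
    using u(2) by (auto simp: face_box_def abs_le_iff)
  ultimately show "z \<in> region (sq q)" unfolding sq_def region_eq by blast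
qed

lemma chart_eq_iff: "chart q u = chart q' u' \<longleftrightarrow> 2 * q + u = 2 * q' + u'"
  using half_nonzero by (simp add: chart_def add.assoc)

lemma coord_chart [simp]: "coord (chart q u) = 2 * q + u"
  using half_nonzero by (simp add: chart_def coord_def)

lemma chart_coord: "chart q (coord z - 2 * q) = z"
  using half_nonzero by (simp add: chart_def coord_def)

lemma chart_surj: "\<exists>u. z = chart q u"
  using chart_coord by metis

lemma chart_shift: "chart (q + d) u = chart q (2 * d + u)"
  by (simp add: chart_eq_iff)

lemma chart_dist: "dist (chart q u) (chart q u') = radius * norm (u - u')"
proof -
  have "chart q u - chart q u' = (u - u') * half" by (simp add: chart_def algebra_simps)
  then show ?thesis by (simp add: dist_norm norm_mult radius_def)
qed

lemma move_chart [simp]: "move q q' c (chart q u) = chart q' (c * u)"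
  by (simp add: move_def)

lemma move_eqI: "(\<And>u. g (chart q u) = chart q' (c * u)) \<Longrightarrow> g = move q q' c"
  by (metis ext chart_surj move_chart)

lemma move_id: "move q q 1 = id"
  by (rule move_eqI[symmetric]) simp

lemma move_comp: "move q' q'' c' \<circ> move q q' c = move q q'' (c' * c)"
  by (rule move_eqI) (simp add: mult.assoc)

lemma face_box_unit: "c \<in> units \<Longrightarrow> c * u \<in> face_box \<longleftrightarrow> u \<in> face_box"
  by (auto simp: units_def face_box_def)

lemma move_region: "c \<in> units \<Longrightarrow> move q q' c ` region (sq q) = region (sq q')"
proof -
  assume c: "c \<in> units"
  have "(\<lambda>u. c * u) ` face_box = face_box"
  proof (intro subset_antisym subsetI)
    fix u assume "u \<in> face_box"
    then have "cnj c * u \<in> face_box" "u = c * (cnj c * u)"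
      using c by (simp_all add: face_box_unit mult.assoc[symmetric])
    then show "u \<in> (\<lambda>u. c * u) ` face_box" by blast
  qed (auto simp: face_box_unit c)
  then have "chart q' ` face_box = (\<lambda>u. chart q' (c * u)) ` face_box" by (metis image_image)
  then show ?thesis unfolding region_sq by (simp add: image_image)
qed

lemma move_affine: "move q q' c z = p + c * (z - p) + (q' - c * q + (1 - c) * ((1 + \<i>) / 2)) * v"
proof -
  have a: "coord z * half = z - p - (1 + \<i>) * half"
    using half_nonzero by (simp add: coord_def left_diff_distrib[of "(z - p) / half"])
  have b: "move q q' c z = p + (1 + \<i> + 2 * q') * half + c * (coord z * half) - 2 * c * q * half"
    by (simp add: move_def chart_def algebra_simps)
  have c: "(q' - c * q + (1 - c) * ((1 + \<i>) / 2)) * v = (2 * q' - 2 * c * q + (1 - c) * (1 + \<i>)) * half"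
  proof -
    define k where "k = (1 - c) * ((1 + \<i>) / 2)"
    have e: "(1 - c) * (1 + \<i>) = 2 * k" by (simp add: k_def)
    show ?thesis unfolding mult_side e k_def[symmetric] by (simp add: algebra_simps)
  qed
  show ?thesis unfolding a b c by (simp add: algebra_simps)
qed

lemma move_isometry:
  assumes "norm c = 1" shows "plane_isometry (move q q' c)"
proof -
  have "move q q' c = (\<lambda>z. c * z + (p - c * p + (q' - c * q + (1 - c) * ((1 + \<i>) / 2)) * v))"
    by (simp add: fun_eq_iff move_affine right_diff_distrib)
  then show ?thesis using plane_isometry_affine[OF assms] by metis
qed

lemma fold_chart:
  assumes "(q, e, n) \<in> net_faces" "u \<in> face_box"
  shows "fold_net (chart q u) = radius *\<^sub>R (n + along e n u)"
  using fold_cross_face[OF assms] by (simp add: fold_net_def)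

lemma fold_face:
  assumes "(q, e, n) \<in> net_faces"
  shows "fold_net ` region (sq q) = face radius n"
  unfolding face_param[OF net_faces_frame(1)[OF assms] radius_pos] region_sq image_image
  using fold_chart[OF assms] by (auto simp: face_box_def intro!: image_cong)

lemma region_sq_shift_inter:
  "region (sq q) \<inter> region (sq (q + d)) = (\<lambda>w. p + q * v + w * v) `
     {w. 0 \<le> Re w \<and> Re w \<le> 1 \<and> 0 \<le> Im w \<and> Im w \<le> 1 \<and>
       Re d \<le> Re w \<and> Re w \<le> Re d + 1 \<and> Im d \<le> Im w \<and> Im w \<le> Im d + 1}"
proof -
  have "z \<in> region (sq (q + d)) \<longleftrightarrow> (\<exists>w. z = p + q * v + w * v \<and>
      Re d \<le> Re w \<and> Re w \<le> Re d + 1 \<and> Im d \<le> Im w \<and> Im w \<le> Im d + 1)" for z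
  proof -
    have "(\<exists>w. z = p + (q + d) * v + w * v \<and> 0 \<le> Re w \<and> Re w \<le> 1 \<and> 0 \<le> Im w \<and> Im w \<le> 1) \<longleftrightarrow>
      (\<exists>w. z = p + q * v + w * v \<and> Re d \<le> Re w \<and> Re w \<le> Re d + 1 \<and> Im d \<le> Im w \<and> Im w \<le> Im d + 1)" (is "?L \<longleftrightarrow> ?R")
    proof
      assume ?L then obtain w where "z = p + (q + d) * v + w * v \<and> 0 \<le> Re w \<and> Re w \<le> 1 \<and> 0 \<le> Im w \<and> Im w \<le> 1" by blast
      then show ?R by (intro exI[of _ "w + d"]) (auto simp: algebra_simps)
    next
      assume ?R then obtain w where "z = p + q * v + w * v \<and> Re d \<le> Re w \<and> Re w \<le> Re d + 1 \<and> Im d \<le> Im w \<and> Im w \<le> Im d + 1" by blast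
      then show ?L by (intro exI[of _ "w - d"]) (auto simp: algebra_simps)
    qed
    then show ?thesis unfolding sq_def region_eq by blast
  qed
  then show ?thesis
    using side_nonzero unfolding sq_def[of q] region_eq by auto
qed

end

lemma closed_segment_affine:
  "(\<lambda>w. a + w * v) ` closed_segment x y = closed_segment (a + x * v) (a + y * v)" for a v x y :: complex
proof -
  have "linear (\<lambda>w. w * v)" by (intro linearI) (auto simp: algebra_simps)
  then have "(\<lambda>w. w * v) ` closed_segment x y = closed_segment (x * v) (y * v)"
    by (rule closed_segment_linear_image[symmetric])
  then have "(+) a ` (\<lambda>w. w * v) ` closed_segment x y = closed_segment (a + x * v) (a + y * v)"
    by (simp add: closed_segment_translation)
  then show ?thesis by (simp add: image_image)
qed

lemma sides_eq:
  "sides (a, v) = {closed_segment (a + 0 * v) (a + 1 * v), closed_segment (a + 1 * v) (a + (1 + \<i>) * v),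
    closed_segment (a + (1 + \<i>) * v) (a + \<i> * v), closed_segment (a + \<i> * v) (a + 0 * v)}"
  by (simp add: sides_def algebra_simps)

lemma edge_to_edge_sym: "edge_to_edge A B \<Longrightarrow> edge_to_edge B A"
  unfolding edge_to_edge_def by (simp add: Int_commute)

context square_grid
begin

lemma common_side:
  assumes "d = 1 \<or> d = \<i>"
  shows "region (sq q) \<inter> region (sq (q + d)) \<in> sides (sq q) \<inter> sides (sq (q + d))"
proof -
  define a where "a = p + q * v"
  have b: "p + (q + d) * v + w * v = a + (d + w) * v" for w by (simp add: a_def algebra_simps)
  have sd: "sides (sq (q + d)) = {closed_segment (a + (d + 0) * v) (a + (d + 1) * v),
    closed_segment (a + (d + 1) * v) (a + (d + (1 + \<i>)) * v),
    closed_segment (a + (d + (1 + \<i>)) * v) (a + (d + \<i>) * v), closed_segment (a + (d + \<i>) * v) (a + (d + 0) * v)}"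
    unfolding sq_def sides_eq b ..
  from assms show ?thesis
  proof
    assume d: "d = 1"
    have "{w. 0 \<le> Re w \<and> Re w \<le> 1 \<and> 0 \<le> Im w \<and> Im w \<le> 1 \<and>
       Re d \<le> Re w \<and> Re w \<le> Re d + 1 \<and> Im d \<le> Im w \<and> Im w \<le> Im d + 1} = closed_segment 1 (1 + \<i>)"
      by (subst closed_segment_same_Re) (auto simp: d closed_segment_eq_real_ivl)
    then have e: "region (sq q) \<inter> region (sq (q + d)) = closed_segment (a + 1 * v) (a + (1 + \<i>) * v)"
      unfolding region_sq_shift_inter a_def[symmetric] by (simp only: closed_segment_affine)
    show ?thesis
      unfolding e unfolding sd sq_def[of q] a_def[symmetric] sides_eq
      by (simp add: d closed_segment_commute)
  next
    assume d: "d = \<i>"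
    have "{w. 0 \<le> Re w \<and> Re w \<le> 1 \<and> 0 \<le> Im w \<and> Im w \<le> 1 \<and>
       Re d \<le> Re w \<and> Re w \<le> Re d + 1 \<and> Im d \<le> Im w \<and> Im w \<le> Im d + 1} = closed_segment (1 + \<i>) \<i>"
      by (subst closed_segment_same_Im) (auto simp: d closed_segment_eq_real_ivl)
    then have e: "region (sq q) \<inter> region (sq (q + d)) = closed_segment (a + (1 + \<i>) * v) (a + \<i> * v)"
      unfolding region_sq_shift_inter a_def[symmetric] by (simp only: closed_segment_affine)
    show ?thesis
      unfolding e unfolding sd sq_def[of q] a_def[symmetric] sides_eq
      by (simp add: d closed_segment_commute add.commute[of \<i> 1])
  qed
qed

lemma common_corner:
  assumes "d = 1 + \<i> \<or> d = 1 - \<i>"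
  shows "\<exists>x\<in>corners (sq q) \<inter> corners (sq (q + d)). region (sq q) \<inter> region (sq (q + d)) = {x}"
proof -
  define a where "a = p + q * v"
  have b: "p + (q + d) * v + w * v = a + (d + w) * v" for w by (simp add: a_def algebra_simps)
  have sd: "corners (sq (q + d)) = (\<lambda>w. a + (d + w) * v) ` {0, 1, 1 + \<i>, \<i>}"
    unfolding sq_def corners_eq b ..
  from assms show ?thesis
  proof
    assume d: "d = 1 + \<i>"
    have "{w. 0 \<le> Re w \<and> Re w \<le> 1 \<and> 0 \<le> Im w \<and> Im w \<le> 1 \<and>
       Re d \<le> Re w \<and> Re w \<le> Re d + 1 \<and> Im d \<le> Im w \<and> Im w \<le> Im d + 1} = {1 + \<i>}"
      by (auto simp: d complex_eq_iff)
    then have e: "region (sq q) \<inter> region (sq (q + d)) = {a + (1 + \<i>) * v}"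
      unfolding region_sq_shift_inter a_def[symmetric] by (simp only: image_insert image_empty)
    show ?thesis
      unfolding e unfolding sd sq_def[of q] a_def[symmetric] corners_eq
      by (intro bexI[of _ "a + (1 + \<i>) * v"]) (simp_all add: d)
  next
    assume d: "d = 1 - \<i>"
    have "{w. 0 \<le> Re w \<and> Re w \<le> 1 \<and> 0 \<le> Im w \<and> Im w \<le> 1 \<and>
       Re d \<le> Re w \<and> Re w \<le> Re d + 1 \<and> Im d \<le> Im w \<and> Im w \<le> Im d + 1} = {1}"
      by (auto simp: d complex_eq_iff)
    then have e: "region (sq q) \<inter> region (sq (q + d)) = {a + 1 * v}"
      unfolding region_sq_shift_inter a_def[symmetric] by (simp only: image_insert image_empty)
    show ?thesis
      unfolding e unfolding sd sq_def[of q] a_def[symmetric] corners_eq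
      by (intro bexI[of _ "a + 1 * v"]) (simp_all add: d)
  qed
qed

text \<open>Only the eight neighbours meet, and by symmetry four of them suffice.\<close>

lemma squares_edge_to_edge:
  assumes "q \<in> cell_corners" "q' \<in> cell_corners" "q \<noteq> q'"
  shows "edge_to_edge (sq q) (sq q')"
proof -
  have step: "edge_to_edge (sq q) (sq q')" if d: "q' = q + d" "d \<in> {1, \<i>, 1 + \<i>, 1 - \<i>}" for q q' d
    using d common_side[of d q] common_corner[of d q] unfolding edge_to_edge_def by auto
  have far: "edge_to_edge (sq q) (sq (q + d))" if d: "Re d > 1 \<or> Re d < -1 \<or> Im d > 1 \<or> Im d < -1" for d
  proof -
    have "{w. 0 \<le> Re w \<and> Re w \<le> 1 \<and> 0 \<le> Im w \<and> Im w \<le> 1 \<and>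
       Re d \<le> Re w \<and> Re w \<le> Re d + 1 \<and> Im d \<le> Im w \<and> Im w \<le> Im d + 1} = {}"
      using d by auto
    then have "region (sq q) \<inter> region (sq (q + d)) = {}" unfolding region_sq_shift_inter by simp
    then show ?thesis unfolding edge_to_edge_def by blast
  qed
  obtain x y where xy: "q' - q = Complex (of_int x) (of_int y)"
    using cell_corners_closed(8)[OF assms(2,1)] unfolding cell_corners_def by blast
  then have q': "q' = q + Complex (of_int x) (of_int y)" "q = q' + - Complex (of_int x) (of_int y)"
    by (auto simp: algebra_simps)
  have ne: "x \<noteq> 0 \<or> y \<noteq> 0"
    using q' assms(3) by (auto simp: Complex_eq)
  show ?thesis
  proof (cases "\<bar>x\<bar> \<le> 1 \<and> \<bar>y\<bar> \<le> 1")
    case False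
    then have "Re (Complex (of_int x) (of_int y)) > 1 \<or> Re (Complex (of_int x) (of_int y)) < -1 \<or>
      Im (Complex (of_int x) (of_int y)) > 1 \<or> Im (Complex (of_int x) (of_int y)) < -1" by auto
    then show ?thesis using far q'(1) by metis
  next
    case True
    then have "x = -1 \<or> x = 0 \<or> x = 1" "y = -1 \<or> y = 0 \<or> y = 1" by auto
    then have "Complex (of_int x) (of_int y) \<in> {1, \<i>, 1 + \<i>, 1 - \<i>} \<or>
        - Complex (of_int x) (of_int y) \<in> {1, \<i>, 1 + \<i>, 1 - \<i>}"
      using ne by (elim disjE) (simp_all add: complex_eq_iff)
    then show ?thesis using step[OF q'(1)] edge_to_edge_sym[OF step[OF q'(2)]] by blast
  qed
qed

lemma net_positions: "A \<in> net \<Longrightarrow> \<exists>q\<in>cell_corners. A = sq q"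
  using net_iff net_faces_frame(2) by blast

lemma net_connected:
  assumes "A \<in> net" "B \<in> net" shows "(A, B) \<in> (side_adjacency net)\<^sup>*"
proof -
  have adj: "(sq q, sq (q + d)) \<in> side_adjacency net \<and> (sq (q + d), sq q) \<in> side_adjacency net"
    if "d = 1 \<or> d = \<i>" "sq q \<in> net" "sq (q + d) \<in> net" for q d
    using common_side[OF that(1), of q] that(2,3) by (auto simp: side_adjacency_def Int_commute)
  have "(sq 0, sq 1) \<in> side_adjacency net" "(sq 1, sq 0) \<in> side_adjacency net"
    "(sq (-1), sq 0) \<in> side_adjacency net" "(sq 0, sq (-1)) \<in> side_adjacency net"
    "(sq 0, sq \<i>) \<in> side_adjacency net" "(sq \<i>, sq 0) \<in> side_adjacency net"
    "(sq (-\<i>), sq 0) \<in> side_adjacency net" "(sq 0, sq (-\<i>)) \<in> side_adjacency net"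
    "(sq 1, sq 2) \<in> side_adjacency net" "(sq 2, sq 1) \<in> side_adjacency net"
    using adj[of 1 0] adj[of 1 "-1"] adj[of \<i> 0] adj[of \<i> "-\<i>"] adj[of 1 1] by (simp_all add: net_def)
  then have "(A, sq 0) \<in> (side_adjacency net)\<^sup>* \<and> (sq 0, A) \<in> (side_adjacency net)\<^sup>*" if "A \<in> net" for A
    using that unfolding net_def
    by (auto intro: converse_rtrancl_into_rtrancl rtrancl_into_rtrancl)
  from this[OF assms(1)] this[OF assms(2)] show ?thesis
    by (elim conjE) (rule rtrancl_trans)
qed

lemma face_inject:
  assumes "a \<in> axes" "b \<in> axes" "face radius a = face radius b" shows "a = b"
proof -
  have "radius *\<^sub>R a \<in> face radius a"
    using radius_pos assms(1) axes_inner(2) axes_inner(1)[OF assms(1)]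
    by (force simp: face_def cube_iff_axes)
  then have "radius *\<^sub>R a \<in> face radius b" using assms(3) by blast
  then have "(radius *\<^sub>R a) \<bullet> b = radius" by (simp add: face_def)
  then have "a \<bullet> b = 1" using radius_pos by simp
  then show ?thesis using axes_inner(3) assms by metis
qed

lemma net_bij: "bij_betw (\<lambda>A. fold_net ` region A) net (cube_faces radius)"
  unfolding bij_betw_def
proof
  show "inj_on (\<lambda>A. fold_net ` region A) net"
  proof (rule inj_onI)
    fix A B assume AB: "A \<in> net" "B \<in> net" "fold_net ` region A = fold_net ` region B"
    obtain q e n q' e' n' where F: "(q, e, n) \<in> net_faces" "A = sq q" "(q', e', n') \<in> net_faces" "B = sq q'"
      using AB net_iff by metis
    then have "face radius n = face radius n'" using AB(3) fold_face by simp
    then have "n = n'" using face_inject F net_faces_frame(1) by (auto simp: frame_def)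
    then show "A = B" using net_faces_unique(1)[OF F(1,3)] F by simp
  qed
  have "(\<lambda>A. fold_net ` region A) ` net = face radius ` axes"
  proof (intro subset_antisym subsetI)
    fix X assume "X \<in> (\<lambda>A. fold_net ` region A) ` net"
    then obtain A where "A \<in> net" "X = fold_net ` region A" by blast
    then obtain q e n where "(q, e, n) \<in> net_faces" "X = fold_net ` region (sq q)" using net_iff by auto
    then show "X \<in> face radius ` axes" using fold_face net_faces_frame(1) unfolding frame_def by blast
  next
    fix X assume "X \<in> face radius ` axes"
    then obtain a q e where "(q, e, a) \<in> net_faces" "X = face radius a" using net_faces_cover by blast
    then show "X \<in> (\<lambda>A. fold_net ` region A) ` net" using fold_face net_iff by blast
  qed
  then show "(\<lambda>A. fold_net ` region A) ` net = cube_faces radius" by (simp add: cube_faces_eq)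
qed

lemma net_folds_to_cube: "net_folding net radius fold_net"
proof -
  have "inj sq" by (simp add: inj_def)
  then have "card net = card {0, 1, -1, \<i>, -\<i>, 2 :: complex}"
    unfolding net_def by (intro card_image) (auto intro: inj_on_subset)
  also have "\<dots> = 6" by (simp add: complex_eq_iff)
  finally have "card net = 6" .
  moreover have "edge_to_edge A B" if "A \<in> net" "B \<in> net" "A \<noteq> B" for A B
    using net_positions[OF that(1)] net_positions[OF that(2)] that(3) squares_edge_to_edge by auto
  moreover have "dist (fold_net x) (fold_net y) = dist x y" if xy: "A \<in> net" "x \<in> region A" "y \<in> region A" for A x y
  proof -
    obtain q e n where F: "(q, e, n) \<in> net_faces" "A = sq q" using xy(1) net_iff by blast
    obtain u w where u: "u \<in> face_box" "w \<in> face_box" "x = chart q u" "y = chart q w"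
      using xy(2,3) unfolding F region_sq by blast
    have "fold_net x - fold_net y = radius *\<^sub>R along e n (u - w)"
      using fold_chart[OF F(1)] u by (simp add: along_diff algebra_simps)
    then have "dist (fold_net x) (fold_net y) = radius * norm (u - w)"
      using along_norm[OF net_faces_frame(1)[OF F(1)]] radius_pos by (simp add: dist_norm)
    then show ?thesis using chart_dist u by simp
  qed
  moreover have "\<forall>A\<in>net. snd A \<noteq> 0" using side_nonzero by (auto simp: net_def sq_def)
  ultimately show ?thesis
    using radius_pos net_connected net_bij unfolding net_folding_def by blast
qed

lemma move_induces:
  assumes "(q, e, n) \<in> net_faces" "(q', e', n') \<in> net_faces" "\<rho> \<in> cube_rotations radius"
    and "\<rho> *v n = n'" "\<rho> *v e = along e' n' c" "c \<in> units"
  shows "induces fold_net \<rho> (sq q) (sq q') (move q q' c)"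
  unfolding induces_def
proof (intro conjI ballI)
  show "plane_isometry (move q q' c)" using assms(6) by (intro move_isometry) simp
  show "move q q' c ` region (sq q) = region (sq q')" using assms(6) by (rule move_region)
  fix x assume "x \<in> region (sq q)"
  then obtain u where u: "u \<in> face_box" "x = chart q u" unfolding region_sq by blast
  have "\<rho> *v fold_net x = radius *\<^sub>R (n' + along (along e' n' c) n' u)"
    using fold_chart[OF assms(1) u(1)] u(2) cube_rotationD(3,4)[OF assms(3)]
      cube_rotation_along[OF assms(3)] assms(4,5) by simp
  also have "\<dots> = radius *\<^sub>R (n' + along e' n' (c * u))"
    using along_mult[OF net_faces_frame(1)[OF assms(2)]] by simp
  also have "\<dots> = fold_net (move q q' c x)"
    using fold_chart[OF assms(2), of "c * u"] u face_box_unit[OF assms(6)] by simp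
  finally show "fold_net (move q q' c x) = \<rho> *v fold_net x" by simp
qed

text \<open>The rotation takes the frame of one face to an axis frame of another face, so it is a
  multiplication by a unit \<open>c\<close> between the charts. The last conclusion compares
  colours at the corner \<open>u = 1 + \<i>\<close>: the left side is 1 iff the motion of the
  grid keeps the colours, the right side is 1 iff the rotation does; hence the former does not
  depend on the face.\<close>

lemma move_exists:
  assumes "(q, e, n) \<in> net_faces" "\<rho> \<in> cube_rotations radius"
  obtains q' e' n' c where "(q', e', n') \<in> net_faces" "c \<in> units" "\<rho> *v n = n'" "\<rho> *v e = along e' n' c"
    "induces fold_net \<rho> (sq q) (sq q') (move q q' c)"
    "checker q * checker q' * Re (c\<^sup>2) = vertex_colour (\<rho> *v vector [1, 1, 1])"
proof -
  have fr: "frame (\<rho> *v e) (\<rho> *v n)"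
    using cube_rotation_frame[OF assms(2) radius_pos net_faces_frame(1)[OF assms(1)]] .
  then obtain q' e' where F: "(q', e', \<rho> *v n) \<in> net_faces"
    using net_faces_cover unfolding frame_def by blast
  obtain c where c: "c \<in> units" "\<rho> *v e = along e' (\<rho> *v n) c"
    using along_unit_exists[OF net_faces_frame(1)[OF F] fr] .
  obtain \<kappa> where \<kappa>: "\<kappa> = 1 \<or> \<kappa> = -1" "\<And>x. vertex_colour (\<rho> *v x) = \<kappa> * vertex_colour x"
    by (rule cube_rotation_colour[OF assms(2) radius_pos]) blast
  have "\<rho> *v (n + along e n (1 + \<i>)) = \<rho> *v n + along e' (\<rho> *v n) (c * (1 + \<i>))"
    using cube_rotationD(3)[OF assms(2)] cube_rotation_along[OF assms(2)] c(2)
      along_mult[OF net_faces_frame(1)[OF F]] by simp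
  then have "\<kappa> * vertex_colour (n + along e n (1 + \<i>)) = vertex_colour (\<rho> *v n + along e' (\<rho> *v n) (c * (1 + \<i>)))"
    using \<kappa>(2) by metis
  then have "\<kappa> * checker q = checker q' * (Re (c * (1 + \<i>)) * Im (c * (1 + \<i>)))"
    unfolding net_vertex_colour[OF assms(1)] net_vertex_colour[OF F] by simp
  also have "Re (c * (1 + \<i>)) * Im (c * (1 + \<i>)) = Re (c\<^sup>2)"
    using c(1) by (auto simp: units_def power2_eq_square)
  finally have "checker q * (\<kappa> * checker q) = checker q * checker q' * Re (c\<^sup>2)" by simp
  then have "checker q * checker q' * Re (c\<^sup>2) = \<kappa>" by (simp add: mult.commute[of \<kappa>])
  moreover have "vertex_colour (\<rho> *v vector [1, 1, 1]) = \<kappa>"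
    unfolding \<kappa>(2) by (simp add: vertex_colour_def)
  ultimately show thesis
    using that[OF F c(1) refl c(2) move_induces[OF assms(1) F assms(2) refl c(2,1)]] by simp
qed

text \<open>In the chart of \<open>sq q\<close> the common edge is \<open>d * (1 + \<i> * s)\<close> for
  \<open>\<bar>s\<bar> \<le> 1\<close>, and in the chart of \<open>sq q'\<close> it is
  \<open>d' * (- 1 + \<i> * s)\<close>, where \<open>d'\<close> is the direction pointing away
  from the first face. Thus \<open>sq q'\<close> is laid upon \<open>sq (q + d)\<close> with
  \<open>c = d / d'\<close>. The motion keeps the colours because it keeps the colour of a
  vertex on the edge, here \<open>s = 1\<close>.\<close>

lemma unfolding_exists:
  assumes F: "(q, e, n) \<in> net_faces" and F': "(q', e', n') \<in> net_faces"
    and d: "d \<in> units" "n' = along e n d"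
  obtains c where "c \<in> units" "unfolding_isometry fold_net (sq q) (sq q') (move q' (q + d) c)"
    "checker q' * checker (q + d) * Re (c\<^sup>2) = 1"
proof -
  note fr = net_faces_frame(1)[OF F] and fr' = net_faces_frame(1)[OF F']
  have nn': "n' \<bullet> n = 0" "n \<bullet> n' = 0" using along_inner(2)[OF fr, of d] d(2) by (simp_all add: inner_commute)
  have ax: "n \<in> axes" "n' \<in> axes" using fr fr' by (auto simp: frame_def)
  have "frame (- n) n'" using ax nn' axes_inner(5) by (simp add: frame_def)
  then obtain d' where d': "d' \<in> units" "- n = along e' n' d'"
    using along_unit_exists[OF fr'] by metis
  define c where "c = d * cnj d'"
  have c: "c \<in> units" using d d' by (simp add: c_def)
  have cd: "c * d' = d" using d' by (simp add: c_def mult.assoc)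
  have e1: "n + along e n (d * (1 + \<i> * of_real s)) = n' + along e' n' (d' * (- 1 + \<i> * of_real s))" for s
  proof -
    have "along e n (d * (1 + \<i> * of_real s)) = along (along e n d) n (1 + \<i> * of_real s)"
      using along_mult[OF fr] by simp
    also have "\<dots> = n' + s *\<^sub>R (n \<times> n')" unfolding d(2)[symmetric] by (simp add: along_def)
    finally have 1: "along e n (d * (1 + \<i> * of_real s)) = n' + s *\<^sub>R (n \<times> n')" .
    have "along e' n' (d' * (- 1 + \<i> * of_real s)) = along (along e' n' d') n' (- 1 + \<i> * of_real s)"
      using along_mult[OF fr'] by simp
    also have "\<dots> = n + s *\<^sub>R (n \<times> n')" unfolding d'(2)[symmetric] using cross_skew[of n n'] by (simp add: along_def)
    finally show ?thesis using 1 by simp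
  qed
  have b: "d * (1 + \<i> * of_real s) \<in> face_box \<longleftrightarrow> \<bar>s\<bar> \<le> 1" "d' * (- 1 + \<i> * of_real s) \<in> face_box \<longleftrightarrow> \<bar>s\<bar> \<le> 1" for s
    using d d' by (simp_all add: face_box_unit) (simp_all add: face_box_def)
  \<comment> \<open>The common edge, seen from either face.\<close>
  have edge: "\<exists>s. \<bar>s\<bar> \<le> 1 \<and> u = d * (1 + \<i> * of_real s)" if "u \<in> face_box" "along e n u \<bullet> n' = 1" for u
  proof -
    have "Re (u * cnj d) = 1" using that(2) along_inner(1)[OF fr] d(2) by simp
    then have "u * cnj d = 1 + \<i> * of_real (Im (u * cnj d))" by (simp add: complex_eq_iff)
    then have "d * (u * cnj d) = d * (1 + \<i> * of_real (Im (u * cnj d)))" by simp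
    moreover have "d * (u * cnj d) = u" using d(1) by (simp add: mult.left_commute)
    ultimately show ?thesis using b(1) that(1) by metis
  qed
  have edge': "\<exists>s. \<bar>s\<bar> \<le> 1 \<and> u = d' * (- 1 + \<i> * of_real s)" if "u \<in> face_box" "along e' n' u \<bullet> n = 1" for u
  proof -
    have "along e' n' u \<bullet> along e' n' d' = -1" using that(2) d'(2) by (metis inner_minus_right)
    then have "Re (u * cnj d') = - 1" using along_inner(1)[OF fr'] by simp
    then have "u * cnj d' = - 1 + \<i> * of_real (Im (u * cnj d'))" by (simp add: complex_eq_iff)
    then have "d' * (u * cnj d') = d' * (- 1 + \<i> * of_real (Im (u * cnj d')))" by simp
    moreover have "d' * (u * cnj d') = u" using d'(1) by (simp add: mult.left_commute)
    ultimately show ?thesis using b(2) that(1) by metis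
  qed
  have folds: "fold_net (chart q (d * (1 + \<i> * of_real s))) = fold_net (chart q' (d' * (- 1 + \<i> * of_real s)))" if "\<bar>s\<bar> \<le> 1" for s
    using fold_chart[OF F, of "d * (1 + \<i> * of_real s)"] fold_chart[OF F', of "d' * (- 1 + \<i> * of_real s)"] b that e1 by simp
  have h: "move q' (q + d) c (chart q' (d' * (- 1 + \<i> * of_real s))) = chart q (d * (1 + \<i> * of_real s))" for s
  proof -
    have "move q' (q + d) c (chart q' (d' * (- 1 + \<i> * of_real s))) = chart q (2 * d + (c * d') * (- 1 + \<i> * of_real s))"
      by (simp add: chart_shift mult.assoc)
    then show ?thesis unfolding cd by (simp add: chart_eq_iff algebra_simps)
  qed
  have on_n': "u \<in> face_box \<and> along e n u \<bullet> n' = 1" if "chart q u \<in> region (sq q)" "fold_net (chart q u) \<in> fold_net ` region (sq q')" for u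
  proof -
    have u: "u \<in> face_box" using that(1) unfolding region_sq by (auto simp: chart_eq_iff)
    have "(radius *\<^sub>R (n + along e n u)) \<bullet> n' = radius"
      using that(2) fold_chart[OF F u] unfolding fold_face[OF F'] face_def by simp
    then show ?thesis using u radius_pos nn' by (simp add: inner_add_left)
  qed
  have on_n: "u \<in> face_box \<and> along e' n' u \<bullet> n = 1" if "chart q' u \<in> region (sq q')" "fold_net (chart q' u) \<in> fold_net ` region (sq q)" for u
  proof -
    have u: "u \<in> face_box" using that(1) unfolding region_sq by (auto simp: chart_eq_iff)
    have "(radius *\<^sub>R (n' + along e' n' u)) \<bullet> n = radius"
      using that(2) fold_chart[OF F' u] unfolding fold_face[OF F] face_def by simp
    then show ?thesis using u radius_pos nn' by (simp add: inner_add_left)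
  qed
  have pts: "chart q (d * (1 + \<i> * of_real s)) \<in> region (sq q)" "chart q' (d' * (- 1 + \<i> * of_real s)) \<in> region (sq q')"
    if "\<bar>s\<bar> \<le> 1" for s
    using b that unfolding region_sq by blast+
  have "unfolding_isometry fold_net (sq q) (sq q') (move q' (q + d) c)"
    unfolding unfolding_isometry_def
  proof (intro conjI ballI impI)
    show "sq q \<noteq> sq q'"
    proof
      assume "sq q = sq q'"
      then have "n = n'" using net_faces_unique(1)[OF F F'] by simp
      then show False using nn' axes_inner(2)[OF ax(1)] by simp
    qed
    show "fold_net ` region (sq q) \<inter> fold_net ` region (sq q') \<noteq> {}"
      using folds[of 0] pts[of 0] by force
    show "plane_isometry (move q' (q + d) c)" using c by (intro move_isometry) simp
    show "move q' (q + d) c y \<in> region (sq q)" "fold_net (move q' (q + d) c y) = fold_net y"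
      if y: "y \<in> region (sq q')" "fold_net y \<in> fold_net ` region (sq q)" for y
    proof -
      obtain u where u: "y = chart q' u" using chart_surj by blast
      obtain s where "\<bar>s\<bar> \<le> 1" "u = d' * (- 1 + \<i> * of_real s)" using on_n y edge' unfolding u by metis
      then show "move q' (q + d) c y \<in> region (sq q)" "fold_net (move q' (q + d) c y) = fold_net y"
        using h folds pts u by simp_all
    qed
    show "region (sq q) \<inter> move q' (q + d) c ` region (sq q') = {x \<in> region (sq q). fold_net x \<in> fold_net ` region (sq q')}"
    proof (intro subset_antisym subsetI)
      fix x assume "x \<in> {x \<in> region (sq q). fold_net x \<in> fold_net ` region (sq q')}"
      then have x: "x \<in> region (sq q)" "fold_net x \<in> fold_net ` region (sq q')" by auto
      obtain u where u: "x = chart q u" using chart_surj by blast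
      obtain s where s: "\<bar>s\<bar> \<le> 1" "u = d * (1 + \<i> * of_real s)" using on_n' x edge unfolding u by metis
      then have "x = move q' (q + d) c (chart q' (d' * (- 1 + \<i> * of_real s)))" using h u by simp
      then show "x \<in> region (sq q) \<inter> move q' (q + d) c ` region (sq q')" using x pts(2)[OF s(1)] by blast
    next
      fix x assume "x \<in> region (sq q) \<inter> move q' (q + d) c ` region (sq q')"
      then have x: "x \<in> region (sq q)" "x \<in> region (sq (q + d))" using move_region[OF c] by auto
      then obtain u w where u: "u \<in> face_box" "w \<in> face_box" "x = chart q u" "x = chart (q + d) w"
        unfolding region_sq by blast
      then have "u = 2 * d + w" by (simp add: chart_shift chart_eq_iff)
      then have uw: "cnj d * u = 2 + cnj d * w" using d(1) by (simp add: distrib_left mult.left_commute)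
      have "cnj d * u \<in> face_box" "cnj d * w \<in> face_box" using u d(1) by (simp_all add: face_box_unit)
      then have "Re (cnj d * u) = 1" unfolding uw face_box_def by auto
      then have "along e n u \<bullet> n' = 1" using along_inner(1)[OF fr] d(2) by (simp add: mult.commute)
      then obtain s where s: "\<bar>s\<bar> \<le> 1" "u = d * (1 + \<i> * of_real s)" using edge u(1) by blast
      then show "x \<in> {x \<in> region (sq q). fold_net x \<in> fold_net ` region (sq q')}"
        using x(1) folds[OF s(1)] pts(2)[OF s(1)] u(3) by auto
    qed
  qed
  moreover have "checker q' * checker (q + d) * Re (c\<^sup>2) = 1"
  proof -
    have sqr: "Re (d * (1 + \<i>)) * Im (d * (1 + \<i>)) = Re (d\<^sup>2)" "Re (d' * (- 1 + \<i>)) * Im (d' * (- 1 + \<i>)) = - Re (d'\<^sup>2)"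
      "Re (c\<^sup>2) = Re (d\<^sup>2) * Re (d'\<^sup>2)" "Re (d\<^sup>2) * Re (d\<^sup>2) = 1" "Re (d'\<^sup>2) * Re (d'\<^sup>2) = 1"
      using d(1) d'(1) by (auto simp: c_def units_def power2_eq_square)
    have "vertex_colour (n + along e n (d * (1 + \<i>))) = vertex_colour (n' + along e' n' (d' * (- 1 + \<i>)))"
      using e1[of 1] by simp
    then have "checker q * Re (d\<^sup>2) = - (checker q' * Re (d'\<^sup>2))"
      unfolding net_vertex_colour[OF F] net_vertex_colour[OF F'] sqr by simp
    then have "checker q = - (checker q' * Re (d'\<^sup>2)) * Re (d\<^sup>2)" using sqr(4) by (metis mult.assoc mult.right_neutral)
    moreover have "checker (q + d) = - checker q"
      using checker_add[OF net_faces_frame(2)[OF F], of d] d(1) by simp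
    ultimately show ?thesis unfolding sqr(3) using sqr(4,5) by (simp add: mult_ac)
  qed
  ultimately show thesis using that c by blast
qed

end

section \<open>Walking along a strand\<close>

lemma interval_exit_right:
  fixes a a' :: int and x y :: real
  assumes "a < a'" "of_int a \<le> x" "x \<le> of_int a + 1" "of_int a' \<le> y" "y \<le> of_int a' + 1"
  obtains s where "0 \<le> s" "s \<le> 1" "x + s * (y - x) = of_int a + 1"
    "\<And>t. 0 \<le> t \<Longrightarrow> t \<le> s \<Longrightarrow> of_int a \<le> x + t * (y - x) \<and> x + t * (y - x) \<le> of_int a + 1"
proof -
  have ya: "y \<ge> of_int a + 1" using assms by linarith
  define s where "s = (if y = x then 0 else (of_int a + 1 - x) / (y - x))"
  have s: "0 \<le> s" "s \<le> 1" "x + s * (y - x) = of_int a + 1"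
    using ya assms by (auto simp: s_def divide_le_eq zero_le_divide_iff)
  have "of_int a \<le> x + t * (y - x) \<and> x + t * (y - x) \<le> of_int a + 1" if "0 \<le> t" "t \<le> s" for t
  proof -
    have "y - x \<ge> 0" using ya assms by linarith
    then have "0 \<le> t * (y - x)" "t * (y - x) \<le> s * (y - x)" using that by (auto intro: mult_right_mono)
    then show ?thesis using s(3) assms(2) by linarith
  qed
  then show thesis using that s by blast
qed

lemma interval_exit:
  fixes a a' :: int and x y :: real
  assumes "a \<noteq> a'" "of_int a \<le> x" "x \<le> of_int a + 1" "of_int a' \<le> y" "y \<le> of_int a' + 1"
  obtains k :: int and s where "k = 1 \<or> k = -1" "\<bar>a + k - a'\<bar> < \<bar>a - a'\<bar>" "0 \<le> s" "s \<le> 1"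
    "of_int (a + k) \<le> x + s * (y - x)" "x + s * (y - x) \<le> of_int (a + k) + 1"
    "\<And>t. 0 \<le> t \<Longrightarrow> t \<le> s \<Longrightarrow> of_int a \<le> x + t * (y - x) \<and> x + t * (y - x) \<le> of_int a + 1"
proof (cases "a < a'")
  case True
  obtain s where s: "0 \<le> s" "s \<le> 1" "x + s * (y - x) = of_int a + 1"
    "\<And>t. 0 \<le> t \<Longrightarrow> t \<le> s \<Longrightarrow> of_int a \<le> x + t * (y - x) \<and> x + t * (y - x) \<le> of_int a + 1"
    by (rule interval_exit_right[OF True assms(2-5)]) blast
  show thesis by (rule that[of 1 s]) (use True s in auto)
next
  case False
  then have "- a - 1 < - a' - 1" using assms(1) by simp
  then obtain s where s: "0 \<le> s" "s \<le> 1" "- x + s * (- y - - x) = of_int (- a - 1) + 1"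
    "\<And>t. 0 \<le> t \<Longrightarrow> t \<le> s \<Longrightarrow> of_int (- a - 1) \<le> - x + t * (- y - - x) \<and> - x + t * (- y - - x) \<le> of_int (- a - 1) + 1"
    by (rule interval_exit_right[of "- a - 1" "- a' - 1" "- x" "- y"]) (use assms in auto)
  have e: "- x + t * (- y - - x) = - (x + t * (y - x))" for t by (simp add: algebra_simps)
  have t: "of_int a \<le> x + t * (y - x) \<and> x + t * (y - x) \<le> of_int a + 1" if "0 \<le> t" "t \<le> s" for t
    using s(4)[OF that] unfolding e by auto
  have "x + s * (y - x) = of_int a" using s(3) unfolding e by auto
  then show thesis using that[of "- 1" s] s(1,2) t False assms(1) by auto
qed

context square_grid
begin

definition strand_steps :: "complex set \<Rightarrow> (complex \<times> complex) set" where
  "strand_steps X = {(q, q'). q \<in> cell_corners \<and> q' - q \<in> units \<and> X \<inter> region (sq q) \<inter> region (sq q') \<noteq> {}}"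

lemma region_sq_iff:
  "p + w * v \<in> region (sq q) \<longleftrightarrow> Re q \<le> Re w \<and> Re w \<le> Re q + 1 \<and> Im q \<le> Im w \<and> Im w \<le> Im q + 1"
proof -
  have "p + w * v = p + q * v + w' * v \<longleftrightarrow> w' = w - q" for w'
  proof -
    have "p + w * v = p + q * v + w' * v \<longleftrightarrow> w * v = (q + w') * v" by (simp add: algebra_simps)
    then show ?thesis using side_nonzero by auto
  qed
  then show ?thesis unfolding sq_def region_eq image_iff by auto
qed

lemma grid_coordinate: "\<exists>w. z = p + w * v"
  using side_nonzero by (intro exI[of _ "(z - p) / v"]) simp

text \<open>The segment from a point of the first square to a point of the last one stays in
  \<open>X\<close>. Leaving the current square through the first side met that leads closer to
  the target decreases the distance between the positions by 1.\<close>

lemma lattice_walk: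
  assumes "convex X"
  shows "p + x * v \<in> X \<Longrightarrow> p + x * v \<in> region (sq (Complex (of_int a) (of_int b))) \<Longrightarrow>
    p + y * v \<in> X \<Longrightarrow> p + y * v \<in> region (sq (Complex (of_int a') (of_int b'))) \<Longrightarrow>
    (Complex (of_int a) (of_int b), Complex (of_int a') (of_int b')) \<in> (strand_steps X)\<^sup>*"
proof (induction "nat (\<bar>a - a'\<bar> + \<bar>b - b'\<bar>)" arbitrary: a b x rule: less_induct)
  case less
  define z where "z s = x + of_real s * (y - x)" for s
  have zX: "p + z s * v \<in> X" if "0 \<le> s" "s \<le> 1" for s
  proof -
    have "p + z s * v = (1 - s) *\<^sub>R (p + x * v) + s *\<^sub>R (p + y * v)"
      by (simp add: z_def scaleR_conv_of_real algebra_simps)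
    then show ?thesis using assms less.prems(1,3) that by (simp add: convexD)
  qed
  have x: "of_int a \<le> Re x" "Re x \<le> of_int a + 1" "of_int b \<le> Im x" "Im x \<le> of_int b + 1"
    and y: "of_int a' \<le> Re y" "Re y \<le> of_int a' + 1" "of_int b' \<le> Im y" "Im y \<le> of_int b' + 1"
    using less.prems(2,4) unfolding region_sq_iff by auto
  have rz: "Re (z s) = Re x + s * (Re y - Re x)" "Im (z s) = Im x + s * (Im y - Im x)" for s
    by (simp_all add: z_def)
  \<comment> \<open>Leave the square towards the target through the side that is met first.\<close>
  have re_step: ?case if k: "k = 1 \<or> k = -1" "\<bar>a + k - a'\<bar> < \<bar>a - a'\<bar>" "0 \<le> s" "s \<le> 1"
    "of_int (a + k) \<le> Re (z s)" "Re (z s) \<le> of_int (a + k) + 1" "of_int a \<le> Re (z s)" "Re (z s) \<le> of_int a + 1"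
    "of_int b \<le> Im (z s)" "Im (z s) \<le> of_int b + 1" for k s
  proof -
    have i: "p + z s * v \<in> region (sq (Complex (of_int a) (of_int b)))"
      "p + z s * v \<in> region (sq (Complex (of_int (a + k)) (of_int b)))"
      unfolding region_sq_iff using k by auto
    have "Complex (of_int (a + k)) (of_int b) - Complex (of_int a) (of_int b) \<in> units"
      using k(1) by (auto simp: units_def complex_eq_iff)
    then have "(Complex (of_int a) (of_int b), Complex (of_int (a + k)) (of_int b)) \<in> strand_steps X"
      unfolding strand_steps_def using i zX[OF k(3,4)] by blast
    moreover have "(Complex (of_int (a + k)) (of_int b), Complex (of_int a') (of_int b')) \<in> (strand_steps X)\<^sup>*"
      using k(2) by (intro less.hyps[OF _ zX[OF k(3,4)] i(2) less.prems(3,4)]) auto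
    ultimately show ?thesis by (rule converse_rtrancl_into_rtrancl)
  qed
  have im_step: ?case if k: "k = 1 \<or> k = -1" "\<bar>b + k - b'\<bar> < \<bar>b - b'\<bar>" "0 \<le> s" "s \<le> 1"
    "of_int (b + k) \<le> Im (z s)" "Im (z s) \<le> of_int (b + k) + 1" "of_int b \<le> Im (z s)" "Im (z s) \<le> of_int b + 1"
    "of_int a \<le> Re (z s)" "Re (z s) \<le> of_int a + 1" for k s
  proof -
    have i: "p + z s * v \<in> region (sq (Complex (of_int a) (of_int b)))"
      "p + z s * v \<in> region (sq (Complex (of_int a) (of_int (b + k))))"
      unfolding region_sq_iff using k by auto
    have "Complex (of_int a) (of_int (b + k)) - Complex (of_int a) (of_int b) \<in> units"
      using k(1) by (auto simp: units_def complex_eq_iff)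
    then have "(Complex (of_int a) (of_int b), Complex (of_int a) (of_int (b + k))) \<in> strand_steps X"
      unfolding strand_steps_def using i zX[OF k(3,4)] by blast
    moreover have "(Complex (of_int a) (of_int (b + k)), Complex (of_int a') (of_int b')) \<in> (strand_steps X)\<^sup>*"
      using k(2) by (intro less.hyps[OF _ zX[OF k(3,4)] i(2) less.prems(3,4)]) auto
    ultimately show ?thesis by (rule converse_rtrancl_into_rtrancl)
  qed
  have stay: "of_int c \<le> r + t * (r' - r) \<and> r + t * (r' - r) \<le> of_int c + 1"
    if "of_int c \<le> r" "r \<le> of_int c + 1" "of_int c \<le> r'" "r' \<le> of_int c + 1" "0 \<le> t" "t \<le> 1" for c :: int and r r' t :: real
  proof -
    have "r + t * (r' - r) = (1 - t) * r + t * r'" by (simp add: algebra_simps)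
    moreover have "(1 - t) * of_int c + t * of_int c \<le> (1 - t) * r + t * r'"
      "(1 - t) * r + t * r' \<le> (1 - t) * (of_int c + 1) + t * (of_int c + 1)"
      using that by (intro add_mono mult_left_mono; simp)+
    ultimately show ?thesis by (simp add: algebra_simps)
  qed
  show ?case
  proof (cases "a = a'")
    case True
    show ?thesis
    proof (cases "b = b'")
      case True
      then show ?thesis using \<open>a = a'\<close> by simp
    next
      case False
      obtain k s where k: "k = 1 \<or> k = -1" "\<bar>b + k - b'\<bar> < \<bar>b - b'\<bar>" "0 \<le> s" "s \<le> 1"
        "of_int (b + k) \<le> Im x + s * (Im y - Im x)" "Im x + s * (Im y - Im x) \<le> of_int (b + k) + 1"
        "\<And>t. 0 \<le> t \<Longrightarrow> t \<le> s \<Longrightarrow> of_int b \<le> Im x + t * (Im y - Im x) \<and> Im x + t * (Im y - Im x) \<le> of_int b + 1"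
        by (rule interval_exit[OF False x(3,4) y(3,4)]) blast
      have "of_int a \<le> Re x + s * (Re y - Re x) \<and> Re x + s * (Re y - Re x) \<le> of_int a + 1"
        using stay[OF x(1,2)] y(1,2) True k(3,4) by blast
      then show ?thesis using im_step[OF k(1-4)] k(5,6) k(7)[of s] k(3) unfolding rz by simp
    qed
  next
    case ane: False
    obtain k s where k: "k = 1 \<or> k = -1" "\<bar>a + k - a'\<bar> < \<bar>a - a'\<bar>" "0 \<le> s" "s \<le> 1"
      "of_int (a + k) \<le> Re x + s * (Re y - Re x)" "Re x + s * (Re y - Re x) \<le> of_int (a + k) + 1"
      "\<And>t. 0 \<le> t \<Longrightarrow> t \<le> s \<Longrightarrow> of_int a \<le> Re x + t * (Re y - Re x) \<and> Re x + t * (Re y - Re x) \<le> of_int a + 1"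
      by (rule interval_exit[OF ane x(1,2) y(1,2)]) blast
    show ?thesis
    proof (cases "b = b'")
      case True
      have "of_int b \<le> Im x + s * (Im y - Im x) \<and> Im x + s * (Im y - Im x) \<le> of_int b + 1"
        using stay[OF x(3,4)] y(3,4) True k(3,4) by blast
      then show ?thesis using re_step[OF k(1-4)] k(5,6) k(7)[of s] k(3) unfolding rz by simp
    next
      case False
      obtain l t where l: "l = 1 \<or> l = -1" "\<bar>b + l - b'\<bar> < \<bar>b - b'\<bar>" "0 \<le> t" "t \<le> 1"
        "of_int (b + l) \<le> Im x + t * (Im y - Im x)" "Im x + t * (Im y - Im x) \<le> of_int (b + l) + 1"
        "\<And>u. 0 \<le> u \<Longrightarrow> u \<le> t \<Longrightarrow> of_int b \<le> Im x + u * (Im y - Im x) \<and> Im x + u * (Im y - Im x) \<le> of_int b + 1"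
        by (rule interval_exit[OF False x(3,4) y(3,4)]) blast
      show ?thesis
      proof (cases "s \<le> t")
        case True
        then show ?thesis using re_step[OF k(1-4)] k(5,6) k(7)[of s] l(7)[of s] k(3) unfolding rz by simp
      next
        case False
        then show ?thesis using im_step[OF l(1-4)] l(5,6) l(7)[of t] k(7)[of t] l(3) unfolding rz by simp
      qed
    qed
  qed
qed

lemma strand_walk:
  assumes "convex X" "q \<in> cell_corners" "q' \<in> cell_corners"
    and "X \<inter> region (sq q) \<noteq> {}" "X \<inter> region (sq q') \<noteq> {}"
  shows "(q, q') \<in> (strand_steps X)\<^sup>*"
proof -
  obtain x y where "x \<in> X" "x \<in> region (sq q)" "y \<in> X" "y \<in> region (sq q')" using assms(4,5) by blast
  moreover obtain w w' where "x = p + w * v" "y = p + w' * v" using grid_coordinate by metis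
  moreover obtain a b a' b' where "q = Complex (of_int a) (of_int b)" "q' = Complex (of_int a') (of_int b')"
    using assms(2,3) unfolding cell_corners_def by blast
  ultimately show ?thesis using lattice_walk[OF assms(1)] by blast
qed

end

lemma convex_strand: "t \<in> strands \<Longrightarrow> convex (interior t)"
proof -
  have "convex (warp i)" for i
  proof -
    have "warp i = {z. Re z \<ge> of_int i} \<inter> {z. Re z \<le> of_int i + 1}" by (auto simp: warp_iff)
    then show ?thesis by (simp add: convex_Int convex_halfspace_Re_ge convex_halfspace_Re_le)
  qed
  moreover have "convex (weft j)" for j
  proof -
    have "weft j = {z. Im z \<ge> of_int j} \<inter> {z. Im z \<le> of_int j + 1}" by (auto simp: weft_iff)
    then show ?thesis by (simp add: convex_Int convex_halfspace_Im_ge convex_halfspace_Im_le)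
  qed
  ultimately show "t \<in> strands \<Longrightarrow> convex (interior t)" by (auto simp: strands_def convex_interior)
qed

section \<open>Kinds of the motions of a unit with preserving corners\<close>

text \<open>The common content of the five species.\<close>

locale preserving_unit =
  fixes P :: prefabric and p v :: complex
  assumes unit: "lattice_unit P (p, v)"
    and unit_corners: "corners (p, v) \<subseteq> cell_corners"
    and corner_preserving: "preserving P p"
begin

sublocale square_grid p v
  using lattice_unit_nonzero[OF unit] by unfold_locales

lemma p_v_corners: "p \<in> cell_corners" "v \<in> cell_corners"
proof -
  have "p \<in> cell_corners" "p + v \<in> cell_corners" using unit_corners by (auto simp: corners_def)
  moreover from this have "p + v - p \<in> cell_corners" by blast
  ultimately show "p \<in> cell_corners" "v \<in> cell_corners" by auto
qed

text \<open>The displacement, in sides, of the first corner of a square under the rotation by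
  \<open>c\<close> about its centre.\<close>

lemma quarter_shift: "c \<in> units \<Longrightarrow> (1 - c) * ((1 + \<i>) / 2) \<in> cell_corners"
  "c \<in> units \<Longrightarrow> checker ((1 - c) * ((1 + \<i>) / 2)) = Re (c\<^sup>2)"
proof -
  have e: "(1 - 1) * ((1 + \<i>) / 2) = 0" "(1 - \<i>) * ((1 + \<i>) / 2) = 1"
    "(1 - - 1) * ((1 + \<i>) / 2) = 1 + \<i>" "(1 - - \<i>) * ((1 + \<i>) / 2) = \<i>"
    by (simp_all add: complex_eq_iff field_simps)
  show "c \<in> units \<Longrightarrow> (1 - c) * ((1 + \<i>) / 2) \<in> cell_corners"
    unfolding units_def by (elim insertE emptyE; hypsubst; unfold e; blast)
  show "c \<in> units \<Longrightarrow> checker ((1 - c) * ((1 + \<i>) / 2)) = Re (c\<^sup>2)"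
    unfolding units_def by (elim insertE emptyE; hypsubst; unfold e; simp)
qed

lemma move_in_group:
  assumes "q \<in> cell_corners" "q' \<in> cell_corners" "c \<in> units"
  shows "move q q' c \<in> planar_group P"
proof (rule planar_groupI[OF unit assms(3)])
  show "q' - c * q + (1 - c) * ((1 + \<i>) / 2) \<in> cell_corners"
    using assms quarter_shift(1)[OF assms(3)] by blast
qed (rule move_affine)

lemma group_is_move:
  assumes "g \<in> planar_group P" "q \<in> cell_corners"
  obtains q' c where "q' \<in> cell_corners" "c \<in> units" "g = move q q' c"
proof -
  obtain c m where c: "c \<in> units" "m \<in> cell_corners" "\<And>z. g z = p + c * (z - p) + m * v"
    by (rule planar_groupD[OF unit assms(1)]) blast
  define q' where "q' = m + c * q - (1 - c) * ((1 + \<i>) / 2)"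
  have "g = move q q' c" unfolding fun_eq_iff move_affine c(3) q'_def by simp
  moreover have "q' \<in> cell_corners" unfolding q'_def using c assms(2) quarter_shift(1) by blast
  ultimately show thesis using that c(1) by blast
qed

text \<open>The common kind of the motions that exchange the two colours of the corners.\<close>

definition swap_kind :: side_action where
  "swap_kind = (SOME \<epsilon>. (translation v, \<epsilon>) \<in> symmetries P)"

lemma swap_kind: "(translation v, swap_kind) \<in> symmetries P"
proof -
  have "translation v \<in> planar_group P"
    using translation_in_group_iff[OF unit, of v] by (metis cell_corners_closed(2) mult_1)
  then show ?thesis unfolding swap_kind_def by (metis planar_groupE someI_ex)
qed

lemma rotation_corner_preserving: "c \<in> units \<Longrightarrow> (rotation p c, Keep) \<in> symmetries P"
proof -
  assume "c \<in> units"
  then obtain k where k: "c = \<i> ^ k" using units_power_ii by blast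
  have "(rotation p (\<i> ^ k), Keep) \<in> symmetries P"
  proof (induction k)
    case 0
    have "rotation p (\<i> ^ 0) = id" by (auto simp: rotation_def)
    then show ?case using symmetries_id by metis
  next
    case (Suc k)
    have "rotation p (\<i> ^ Suc k) = quarter_turn p \<circ> rotation p (\<i> ^ k)"
      by (auto simp: rotation_def)
    moreover have "(quarter_turn p, Keep) \<in> symmetries P"
      using corner_preserving by (simp add: preserving_def)
    ultimately show ?case using symmetries_comp[OF Suc.IH] by (metis kind_comp_simps(1))
  qed
  then show ?thesis using k by simp
qed

lemma translation_kind:
  assumes "m \<in> cell_corners"
  shows "(translation (m * v), if checker m = 1 then Keep else swap_kind) \<in> symmetries P"
proof (cases "checker m = 1")
  case True
  obtain m' where "m' \<in> cell_corners" "m = (\<i> - 1) * m'" by (rule checker_even[OF assms True])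
  then show ?thesis using even_translation_preserving[OF unit] True by simp
next
  case False
  then have "checker m = -1" by (auto simp: checker_def split: if_splits)
  then have "checker (m - 1) = 1" using checker_add[OF assms, of "-1"] by simp
  moreover have m1: "m - 1 \<in> cell_corners" using assms by blast
  ultimately obtain m' where m': "m' \<in> cell_corners" "m - 1 = (\<i> - 1) * m'" using checker_even by blast
  have "(translation v \<circ> translation ((\<i> - 1) * m' * v), kind_comp swap_kind Keep) \<in> symmetries P"
    using symmetries_comp[OF even_translation_preserving[OF unit m'(1)] swap_kind] .
  moreover have "translation v \<circ> translation ((\<i> - 1) * m' * v) = translation (m * v)"
    unfolding m'(2)[symmetric] by (auto simp: translation_def algebra_simps)
  ultimately show ?thesis using False by simp
qed

text \<open>The motion is a power of the preserving quarter-turn about \<open>p\<close> followed by the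
  translation by \<open>m * v\<close>. It keeps the colours iff \<open>m\<close> is even, and
  then the translation is a commutator; for odd \<open>m\<close> one more translation by
  \<open>v\<close> is needed.\<close>

lemma move_kind:
  assumes "q \<in> cell_corners" "q' \<in> cell_corners" "c \<in> units"
  shows "(move q q' c, if checker q * checker q' * Re (c\<^sup>2) = 1 then Keep else swap_kind) \<in> symmetries P"
proof -
  define m where "m = q' - c * q + (1 - c) * ((1 + \<i>) / 2)"
  have m: "m \<in> cell_corners" unfolding m_def using assms quarter_shift(1)[OF assms(3)] by blast
  have cq: "c * q \<in> cell_corners" using assms by blast
  have "m = (q' + - (c * q)) + (1 - c) * ((1 + \<i>) / 2)" by (simp add: m_def)
  then have "checker m = checker q' * checker q * Re (c\<^sup>2)"
    using checker_add[OF _ quarter_shift(1)[OF assms(3)], of "q' + - (c * q)"] checker_add[OF assms(2), of "- (c * q)"]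
      checker_uminus[OF cq] checker_unit_mult[OF assms(1,3)] quarter_shift(2)[OF assms(3)] cq assms by auto
  moreover have "(translation (m * v) \<circ> rotation p c, kind_comp (if checker m = 1 then Keep else swap_kind) Keep) \<in> symmetries P"
    using symmetries_comp[OF rotation_corner_preserving[OF assms(3)] translation_kind[OF m]] .
  moreover have "translation (m * v) \<circ> rotation p c = move q q' c"
    by (auto simp: move_affine translation_def rotation_def m_def)
  ultimately show ?thesis by (simp add: mult.commute[of "checker q"])
qed

end

section \<open>Strands of the cube\<close>

lemma plane_isometry_inv:
  assumes "plane_isometry g" shows "plane_isometry (inv g)" "inv g (g x) = x" "g (inv g x) = x"
proof -
  show 1: "inv g (g x) = x" for x using plane_isometry_bij[OF assms] by (simp add: bij_def)
  show 2: "g (inv g x) = x" for x using plane_isometry_bij[OF assms] by (simp add: bij_def surj_f_inv_f)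
  show "plane_isometry (inv g)" using assms 2 unfolding plane_isometry_def by metis
qed

lemma cube_rotation_inverse:
  assumes "\<rho> \<in> cube_rotations r"
  obtains \<rho>' where "\<rho>' \<in> cube_rotations r" "\<And>x. \<rho>' *v (\<rho> *v x) = x" "\<And>x. \<rho> *v (\<rho>' *v x) = x"
proof -
  have R: "rotation_matrix \<rho>" "(\<lambda>x. \<rho> *v x) ` cube r = cube r" using assms by (auto simp: cube_rotations_def)
  then have o: "transpose \<rho> ** \<rho> = mat 1" "\<rho> ** transpose \<rho> = mat 1"
    by (auto simp: rotation_matrix_def orthogonal_matrix_def)
  have i: "transpose \<rho> *v (\<rho> *v x) = x" "\<rho> *v (transpose \<rho> *v x) = x" for x
    by (simp_all only: matrix_vector_mul_assoc o matrix_vector_mul_lid)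
  have "(\<lambda>x. transpose \<rho> *v x) ` cube r = (\<lambda>x. transpose \<rho> *v x) ` (\<lambda>x. \<rho> *v x) ` cube r" using R(2) by simp
  also have "\<dots> = cube r" unfolding image_image i by simp
  finally have "transpose \<rho> \<in> cube_rotations r"
    using R(1) by (simp add: cube_rotations_def rotation_matrix_def orthogonal_matrix_transpose det_transpose)
  then show thesis using that i by blast
qed

context square_grid
begin

lemma net_square: "A \<in> net \<Longrightarrow> A = (fst A, v)"
  by (auto simp: net_def sq_def)

lemma fold_net_inj:
  assumes "A \<in> net" "x \<in> region A" "y \<in> region A" "fold_net x = fold_net y" shows "x = y"
  using net_folds_to_cube assms unfolding net_folding_def by (metis dist_eq_0_iff)

lemma net_face_inj:
  assumes "A \<in> net" "B \<in> net" "fold_net ` region A = fold_net ` region B" shows "A = B"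
  using net_bij assms unfolding bij_betw_def inj_on_def by blast

text \<open>A region is determined by its face, and an isometry of the plane by its values on a region.\<close>

lemma induces_unique:
  assumes "A \<in> net" "B \<in> net" "B' \<in> net" "induces fold_net \<rho> A B g" "induces fold_net \<rho> A B' g'"
  shows "B' = B" "g' = g"
proof -
  show B: "B' = B"
    using net_face_inj[OF assms(3,2)] induces_face[OF assms(4)] induces_face[OF assms(5)] by simp
  have "g' = g"
  proof (rule isometry_eq_of_eq_on_region[OF _ _ side_nonzero])
    show "plane_isometry g'" "plane_isometry g" using assms(4,5) by (simp_all add: induces_def)
    fix x assume "x \<in> region (fst A, v)"
    then have x: "x \<in> region A" using net_square[OF assms(1)] by simp
    then have "g' x \<in> region B" "g x \<in> region B" "fold_net (g' x) = fold_net (g x)"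
      using assms(4,5) B by (auto simp: induces_def)
    then show "g' x = g x" by (rule fold_net_inj[OF assms(2)])
  qed
  then show "g' = g" .
qed

lemma net_move_exists:
  assumes "A \<in> net" "\<rho> \<in> cube_rotations radius"
  obtains B g where "B \<in> net" "induces fold_net \<rho> A B g"
    "\<exists>q\<in>cell_corners. \<exists>q'\<in>cell_corners. \<exists>c\<in>units. g = move q q' c"
proof -
  obtain q e n where F: "(q, e, n) \<in> net_faces" "A = sq q" using assms(1) net_iff by blast
  obtain q' e' n' c where "(q', e', n') \<in> net_faces" "c \<in> units" "induces fold_net \<rho> (sq q) (sq q') (move q q' c)"
    by (rule move_exists[OF F(1) assms(2)]) blast
  then show thesis using that[of "sq q'" "move q q' c"] F net_iff net_faces_frame(2) by blast
qed

end

context preserving_unit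
begin

abbreviation adjoins :: "square \<times> complex set \<Rightarrow> square \<times> complex set \<Rightarrow> bool" where
  "adjoins \<equiv> continues net fold_net"

abbreviation joined :: "square \<times> complex set \<Rightarrow> square \<times> complex set \<Rightarrow> bool" where
  "joined \<equiv> (continues net fold_net)\<^sup>*\<^sup>*"

text \<open>The action of a rotation on the pieces of strands, as a relation; on pieces it is a function by
  \<open>carried_exists\<close> and \<open>carried_unique\<close>.\<close>

definition carried :: "real ^ 3 ^ 3 \<Rightarrow> square \<times> complex set \<Rightarrow> square \<times> complex set \<Rightarrow> bool" where
  "carried \<rho> x y \<longleftrightarrow> fst y \<in> net \<and> (\<exists>g. induces fold_net \<rho> (fst x) (fst y) g \<and> snd y = g ` snd x)"

lemma rotate_strand_eq: "rotate_strand net fold_net \<rho> S = {y. \<exists>x\<in>S. carried \<rho> x y}"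
  unfolding rotate_strand_def carried_def by force

lemma pieces_iff: "x \<in> pieces net \<longleftrightarrow> fst x \<in> net \<and> snd x \<in> strands \<and> interior (snd x) \<inter> interior (region (fst x)) \<noteq> {}"
  by (cases x) (simp add: pieces_def)

lemma carried_exists:
  assumes "x \<in> pieces net" "\<rho> \<in> cube_rotations radius" obtains y where "carried \<rho> x y"
proof -
  obtain B g where "B \<in> net" "induces fold_net \<rho> (fst x) B g"
    using net_move_exists[of "fst x" \<rho>] assms pieces_iff by metis
  then have "carried \<rho> x (B, g ` snd x)" by (auto simp: carried_def)
  then show thesis using that by blast
qed

lemma carried_unique:
  assumes "x \<in> pieces net" "carried \<rho> x y" "carried \<rho> x y'" shows "y' = y"
proof -
  obtain g g' where g: "induces fold_net \<rho> (fst x) (fst y) g" "snd y = g ` snd x" "fst y \<in> net"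
    "induces fold_net \<rho> (fst x) (fst y') g'" "snd y' = g' ` snd x" "fst y' \<in> net"
    using assms(2,3) unfolding carried_def by blast
  have "fst x \<in> net" using assms(1) pieces_iff by blast
  from induces_unique[OF this g(3,6,1,4)] show ?thesis using g(2,5) by (simp add: prod_eq_iff)
qed

lemma carried_group:
  assumes "x \<in> pieces net" "\<rho> \<in> cube_rotations radius" "carried \<rho> x y"
  obtains g where "g \<in> planar_group P" "induces fold_net \<rho> (fst x) (fst y) g" "snd y = g ` snd x"
proof -
  obtain g where g: "induces fold_net \<rho> (fst x) (fst y) g" "snd y = g ` snd x" "fst y \<in> net"
    using assms(3) unfolding carried_def by blast
  have A: "fst x \<in> net" using assms(1) pieces_iff by blast
  obtain B g' where g': "B \<in> net" "induces fold_net \<rho> (fst x) B g'"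
    "\<exists>q\<in>cell_corners. \<exists>q'\<in>cell_corners. \<exists>c\<in>units. g' = move q q' c"
    by (rule net_move_exists[OF A assms(2)]) blast
  have "g' = g" using induces_unique(2)[OF A g(3) g'(1) g(1) g'(2)] .
  then have "g \<in> planar_group P" using g'(3) move_in_group by blast
  then show thesis using that g by blast
qed

lemma carried_pieces:
  assumes "x \<in> pieces net" "\<rho> \<in> cube_rotations radius" "carried \<rho> x y"
  shows "y \<in> pieces net"
proof -
  obtain g where g: "g \<in> planar_group P" "induces fold_net \<rho> (fst x) (fst y) g" "snd y = g ` snd x"
    by (rule carried_group[OF assms]) blast
  have iso: "plane_isometry g" and r: "g ` region (fst x) = region (fst y)" using g(2) by (auto simp: induces_def)
  have "interior (snd x) \<inter> interior (region (fst x)) \<noteq> {}" "snd x \<in> strands" using assms(1) pieces_iff by auto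
  moreover have "interior (snd y) \<inter> interior (region (fst y)) = g ` interior (snd x) \<inter> g ` interior (region (fst x))"
    unfolding g(3) r[symmetric] by (simp add: plane_isometry_interior[OF iso])
  ultimately show ?thesis
    using planar_group_strands[OF g(1)] assms(3) g(3) unfolding pieces_iff carried_def by auto
qed

lemma carried_inverse:
  assumes "x \<in> pieces net" "carried \<rho> x y" "\<And>x. \<rho>' *v (\<rho> *v x) = x"
  shows "carried \<rho>' y x"
proof -
  obtain g where g: "induces fold_net \<rho> (fst x) (fst y) g" "snd y = g ` snd x"
    using assms(2) unfolding carried_def by blast
  have iso: "plane_isometry g" and r: "g ` region (fst x) = region (fst y)"
    and f: "\<And>z. z \<in> region (fst x) \<Longrightarrow> fold_net (g z) = \<rho> *v fold_net z" using g(1) by (auto simp: induces_def)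
  note inv = plane_isometry_inv[OF iso]
  have "induces fold_net \<rho>' (fst y) (fst x) (inv g)"
    unfolding induces_def
  proof (intro conjI ballI)
    show "inv g ` region (fst y) = region (fst x)" unfolding r[symmetric] by (simp add: image_image inv)
    fix z assume "z \<in> region (fst y)"
    then obtain w where w: "w \<in> region (fst x)" "z = g w" using r by blast
    then show "fold_net (inv g z) = \<rho>' *v fold_net z" using f assms(3) inv by simp
  qed (rule inv(1))
  moreover have "snd x = inv g ` snd y" unfolding g(2) by (simp add: image_image inv)
  ultimately show ?thesis using assms(1) pieces_iff unfolding carried_def by blast
qed

text \<open>If \<open>h\<close> lays the second region beside the first one and \<open>g\<close>,
  \<open>k\<close> are the motions of the two regions, then
  \<open>g \<circ> h \<circ> inv k\<close> does so for their images.\<close>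

lemma carried_continues:
  assumes \<rho>: "\<rho> \<in> cube_rotations radius" and c: "adjoins x y"
    and x': "carried \<rho> x x'" and y': "carried \<rho> y y'"
  shows "adjoins x' y'"
proof -
  have xp: "x \<in> pieces net" and yp: "y \<in> pieces net" using c by (auto simp: continues_def)
  obtain h where h: "unfolding_isometry fold_net (fst x) (fst y) h" "h ` snd y = snd x"
    "interior (snd x) \<inter> (region (fst x) \<inter> h ` region (fst y)) \<noteq> {}"
    using c by (auto simp: continues_def)
  obtain g where g: "induces fold_net \<rho> (fst x) (fst x') g" "snd x' = g ` snd x"
    using x' unfolding carried_def by blast
  obtain k where k: "induces fold_net \<rho> (fst y) (fst y') k" "snd y' = k ` snd y"
    using y' unfolding carried_def by blast
  have gi: "plane_isometry g" and gr: "g ` region (fst x) = region (fst x')"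
    and gf: "\<And>z. z \<in> region (fst x) \<Longrightarrow> fold_net (g z) = \<rho> *v fold_net z" using g(1) by (auto simp: induces_def)
  have ki: "plane_isometry k" and kr: "k ` region (fst y) = region (fst y')"
    and kf: "\<And>z. z \<in> region (fst y) \<Longrightarrow> fold_net (k z) = \<rho> *v fold_net z" using k(1) by (auto simp: induces_def)
  have hi: "plane_isometry h" and hA: "fst x \<noteq> fst y" and hm: "fold_net ` region (fst x) \<inter> fold_net ` region (fst y) \<noteq> {}"
    and hf: "\<And>z. z \<in> region (fst y) \<Longrightarrow> fold_net z \<in> fold_net ` region (fst x) \<Longrightarrow> h z \<in> region (fst x) \<and> fold_net (h z) = fold_net z"
    and hr: "region (fst x) \<inter> h ` region (fst y) = {z \<in> region (fst x). fold_net z \<in> fold_net ` region (fst y)}"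
    using h(1) by (auto simp: unfolding_isometry_def)
  note kv = plane_isometry_inv[OF ki]
  obtain \<rho>' where \<rho>': "\<And>x. \<rho>' *v (\<rho> *v x) = x" by (rule cube_rotation_inverse[OF \<rho>]) blast
  have \<rho>inj: "\<rho> *v a = \<rho> *v b \<longleftrightarrow> a = b" for a b by (metis \<rho>')
  have \<rho>in: "\<rho> *v a \<in> (\<lambda>x. \<rho> *v x) ` X \<longleftrightarrow> a \<in> X" for a X by (auto simp: image_iff \<rho>inj)
  have fx: "fold_net ` region (fst x') = (\<lambda>x. \<rho> *v x) ` fold_net ` region (fst x)"
    and fy: "fold_net ` region (fst y') = (\<lambda>x. \<rho> *v x) ` fold_net ` region (fst y)"
    using induces_face g(1) k(1) by blast+
  have ginj: "inj g" using plane_isometry_bij[OF gi] by (simp add: bij_def)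
  define h' where "h' = g \<circ> h \<circ> inv k"
  have h'k: "h' (k z) = g (h z)" for z by (simp add: h'_def kv)
  have h'im: "h' ` k ` X = g ` h ` X" for X by (simp add: image_image h'k)
  have reg: "region (fst x') \<inter> h' ` region (fst y') = g ` (region (fst x) \<inter> h ` region (fst y))"
    unfolding gr[symmetric] kr[symmetric] h'im by (simp add: image_Int[OF ginj])
  have "unfolding_isometry fold_net (fst x') (fst y') h'"
    unfolding unfolding_isometry_def
  proof (intro conjI ballI impI)
    show "fst x' \<noteq> fst y'"
    proof
      assume "fst x' = fst y'"
      then have "(\<lambda>x. \<rho> *v x) ` fold_net ` region (fst x) = (\<lambda>x. \<rho> *v x) ` fold_net ` region (fst y)"
        using fx fy by simp
      then have "fold_net ` region (fst x) = fold_net ` region (fst y)"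
        using inj_image_eq_iff[of "\<lambda>x. \<rho> *v x"] \<rho>inj by (simp add: inj_def)
      then show False using net_face_inj hA xp yp pieces_iff by blast
    qed
    show "fold_net ` region (fst x') \<inter> fold_net ` region (fst y') \<noteq> {}"
      using hm unfolding fx fy by blast
    show "plane_isometry h'" unfolding h'_def using gi hi kv(1) by (intro plane_isometry_comp)
    show "h' z \<in> region (fst x')" "fold_net (h' z) = fold_net z"
      if z: "z \<in> region (fst y')" "fold_net z \<in> fold_net ` region (fst x')" for z
    proof -
      obtain w where w: "w \<in> region (fst y)" "z = k w" using z(1) kr by blast
      then have "fold_net w \<in> fold_net ` region (fst x)" using z(2) kf \<rho>in unfolding fx by simp
      then have "h w \<in> region (fst x)" "fold_net (h w) = fold_net w" using hf w(1) by auto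
      then show "h' z \<in> region (fst x')" "fold_net (h' z) = fold_net z"
        using gr gf kf w h'k by auto
    qed
    show "region (fst x') \<inter> h' ` region (fst y') = {z \<in> region (fst x'). fold_net z \<in> fold_net ` region (fst y')}"
      unfolding reg hr
    proof (intro subset_antisym subsetI)
      fix z assume "z \<in> g ` {z \<in> region (fst x). fold_net z \<in> fold_net ` region (fst y)}"
      then show "z \<in> {z \<in> region (fst x'). fold_net z \<in> fold_net ` region (fst y')}"
        using gr gf unfolding fy by auto
    next
      fix z assume z: "z \<in> {z \<in> region (fst x'). fold_net z \<in> fold_net ` region (fst y')}"
      then obtain w where w: "w \<in> region (fst x)" "z = g w" using gr by blast
      then have "fold_net w \<in> fold_net ` region (fst y)" using z gf \<rho>in unfolding fy by simp
      then show "z \<in> g ` {z \<in> region (fst x). fold_net z \<in> fold_net ` region (fst y)}" using w by blast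
    qed
  qed
  moreover have "h' ` snd y' = snd x'" unfolding k(2) h'im h(2) g(2) ..
  moreover have "interior (snd x') \<inter> (region (fst x') \<inter> h' ` region (fst y')) \<noteq> {}"
    unfolding reg g(2) plane_isometry_interior[OF gi] using h(3) by blast
  ultimately show ?thesis
    unfolding continues_def using carried_pieces[OF xp \<rho> x'] carried_pieces[OF yp \<rho> y'] by blast
qed

lemma continues_sym:
  assumes "adjoins x y" shows "adjoins y x"
proof -
  have xp: "x \<in> pieces net" and yp: "y \<in> pieces net" using assms by (auto simp: continues_def)
  obtain h where h: "unfolding_isometry fold_net (fst x) (fst y) h" "h ` snd y = snd x"
    "interior (snd x) \<inter> (region (fst x) \<inter> h ` region (fst y)) \<noteq> {}"
    using assms by (auto simp: continues_def)
  have hi: "plane_isometry h" and hA: "fst x \<noteq> fst y" and hm: "fold_net ` region (fst x) \<inter> fold_net ` region (fst y) \<noteq> {}"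
    and hf: "\<And>z. z \<in> region (fst y) \<Longrightarrow> fold_net z \<in> fold_net ` region (fst x) \<Longrightarrow> h z \<in> region (fst x) \<and> fold_net (h z) = fold_net z"
    and hr: "region (fst x) \<inter> h ` region (fst y) = {z \<in> region (fst x). fold_net z \<in> fold_net ` region (fst y)}"
    using h(1) by (auto simp: unfolding_isometry_def)
  note hv = plane_isometry_inv[OF hi]
  have xA: "fst x \<in> net" using xp pieces_iff by blast
  have returns: "\<exists>w\<in>region (fst y). h w = z \<and> fold_net w = fold_net z"
    if z: "z \<in> region (fst x)" "fold_net z \<in> fold_net ` region (fst y)" for z
  proof -
    obtain w where w: "w \<in> region (fst y)" "fold_net w = fold_net z" using z(2) by force
    then have "h w \<in> region (fst x)" "fold_net (h w) = fold_net z" using hf[of w] z(1) by auto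
    then have "h w = z" using fold_net_inj[OF xA _ z(1)] by blast
    then show ?thesis using w by blast
  qed
  have "unfolding_isometry fold_net (fst y) (fst x) (inv h)"
    unfolding unfolding_isometry_def
  proof (intro conjI ballI impI)
    show "fst y \<noteq> fst x" using hA by simp
    show "fold_net ` region (fst y) \<inter> fold_net ` region (fst x) \<noteq> {}" using hm by blast
    show "plane_isometry (inv h)" by (rule hv(1))
    show "inv h z \<in> region (fst y)" "fold_net (inv h z) = fold_net z"
      if z: "z \<in> region (fst x)" "fold_net z \<in> fold_net ` region (fst y)" for z
      using returns[OF z] hv by auto
    show "region (fst y) \<inter> inv h ` region (fst x) = {z \<in> region (fst y). fold_net z \<in> fold_net ` region (fst x)}"
    proof (intro subset_antisym subsetI)
      fix z assume "z \<in> region (fst y) \<inter> inv h ` region (fst x)"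
      then have z: "z \<in> region (fst y)" "h z \<in> region (fst x)" using hv by auto
      then have "fold_net (h z) \<in> fold_net ` region (fst y)" using hr by blast
      then obtain w where w: "h w = h z" "fold_net w = fold_net (h z)" using returns z(2) by blast
      then have "w = z" using hv(2) by metis
      then have "fold_net z = fold_net (h z)" using w by simp
      then have "fold_net z \<in> fold_net ` region (fst x)" using z(2) by simp
      then show "z \<in> {z \<in> region (fst y). fold_net z \<in> fold_net ` region (fst x)}" using z(1) by simp
    next
      fix z assume "z \<in> {z \<in> region (fst y). fold_net z \<in> fold_net ` region (fst x)}"
      then have z: "z \<in> region (fst y)" "h z \<in> region (fst x)" using hf by auto
      then have "inv h (h z) \<in> inv h ` region (fst x)" by blast
      then show "z \<in> region (fst y) \<inter> inv h ` region (fst x)" using z(1) hv(2) by simp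
    qed
  qed
  moreover have "inv h ` snd x = snd y" unfolding h(2)[symmetric] by (simp add: image_image hv)
  moreover have "interior (snd y) \<inter> (region (fst y) \<inter> inv h ` region (fst x)) \<noteq> {}"
  proof -
    obtain z where z: "z \<in> interior (snd x)" "z \<in> region (fst x)" "z \<in> h ` region (fst y)" using h(3) by blast
    have "inv h z \<in> inv h ` interior (snd x)" "inv h z \<in> inv h ` region (fst x)" "inv h z \<in> region (fst y)"
      using z hv by auto
    moreover have "inv h ` interior (snd x) = interior (snd y)"
      unfolding plane_isometry_interior[OF hv(1), symmetric] h(2)[symmetric] by (simp add: image_image hv)
    ultimately show ?thesis by blast
  qed
  ultimately show ?thesis unfolding continues_def using xp yp by blast
qed

lemma continues_rtranclp_sym:
  "joined x y \<Longrightarrow> joined y x"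
  by (induction rule: rtranclp_induct) (auto intro: converse_rtranclp_into_rtranclp continues_sym)

lemma carried_class:
  assumes "\<rho> \<in> cube_rotations radius" "x \<in> pieces net" "carried \<rho> x x'" "joined x y"
  shows "y \<in> pieces net \<and> (\<exists>y'. carried \<rho> y y' \<and> joined x' y')"
  using assms(4)
proof (induction rule: rtranclp_induct)
  case base
  then show ?case using assms(2,3) by blast
next
  case (step y z)
  obtain y' where y': "carried \<rho> y y'" "joined x' y'" using step.IH by blast
  have z: "z \<in> pieces net" using step.hyps(2) by (simp add: continues_def)
  obtain z' where z': "carried \<rho> z z'" by (rule carried_exists[OF z assms(1)])
  have "adjoins y' z'" using carried_continues[OF assms(1) step.hyps(2) y'(1) z'] .
  then show ?case using y'(2) z z' by (meson rtranclp.rtrancl_into_rtrancl)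
qed

text \<open>One inclusion applies the rotation along a chain of pieces; the other one applies the inverse
  rotation.\<close>

lemma rotate_class:
  assumes "\<rho> \<in> cube_rotations radius" "x \<in> pieces net" "carried \<rho> x x'"
  shows "rotate_strand net fold_net \<rho> {y. joined x y} = {y. joined x' y}"
  unfolding rotate_strand_eq
proof (intro subset_antisym subsetI)
  fix w assume "w \<in> {y. \<exists>x\<in>{y. joined x y}. carried \<rho> x y}"
  then obtain z where z: "joined x z" "carried \<rho> z w" by blast
  have c: "z \<in> pieces net" "\<exists>w'. carried \<rho> z w' \<and> joined x' w'"
    using carried_class[OF assms z(1)] by blast+
  obtain w' where "carried \<rho> z w'" "joined x' w'" using c(2) by blast
  then show "w \<in> {y. joined x' y}" using carried_unique[OF c(1) z(2)] by auto
next
  fix w assume w: "w \<in> {y. joined x' y}"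
  obtain \<rho>' where \<rho>': "\<rho>' \<in> cube_rotations radius" "\<And>x. \<rho>' *v (\<rho> *v x) = x" "\<And>x. \<rho> *v (\<rho>' *v x) = x"
    by (rule cube_rotation_inverse[OF assms(1)]) blast
  have x': "x' \<in> pieces net" using carried_pieces[OF assms(2,1,3)] .
  have "carried \<rho>' x' x" using carried_inverse[OF assms(2,3) \<rho>'(2)] .
  moreover have "joined x' w" using w by simp
  ultimately obtain z where z: "carried \<rho>' w z" "joined x z" "w \<in> pieces net"
    using carried_class[OF \<rho>'(1) x'] by blast
  have "carried \<rho> z w" using carried_inverse[OF z(3,1) \<rho>'(3)] .
  then show "w \<in> {y. \<exists>x\<in>{y. joined x y}. carried \<rho> x y}" using z(2) by blast
qed

text \<open>Rolling the cube along \<open>t\<close> over the square grid: \<open>sq q\<close> is the face on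
  which the cube rests on the square in position \<open>Q\<close>, and \<open>move q Q c\<close>
  identifies the two. Crossing a side of \<open>sq Q\<close> on \<open>t\<close> rolls the cube
  over the corresponding edge, where the strand of the cube continues.\<close>

lemma roll_along_strand:
  assumes F0: "(q0, e0, n0) \<in> net_faces" and t: "(sq q0, t) \<in> pieces net"
    and walk: "(q0, Q) \<in> (strand_steps (interior t))\<^sup>*"
  shows "\<exists>q e n c s. (q, e, n) \<in> net_faces \<and> c \<in> units \<and> Q \<in> cell_corners \<and> s \<in> strands \<and>
    move q Q c ` s = t \<and> joined (sq q0, t) (sq q, s)"
  using walk
proof (induction rule: rtrancl_induct)
  case base
  have "t \<in> strands" using t by (simp add: pieces_iff)
  then show ?case
    using F0 net_faces_frame(2)[OF F0] by (intro exI[of _ q0] exI[of _ e0] exI[of _ n0] exI[of _ 1] exI[of _ t]) (simp add: move_id)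
next
  case (step Q Q')
  obtain q e n c s where IH: "(q, e, n) \<in> net_faces" "c \<in> units" "Q \<in> cell_corners" "s \<in> strands"
    "move q Q c ` s = t" "joined (sq q0, t) (sq q, s)" using step.IH by blast
  define \<delta> where "\<delta> = Q' - Q"
  have \<delta>: "\<delta> \<in> units" and Q': "Q' = Q + \<delta>" using step.hyps(2) by (auto simp: strand_steps_def \<delta>_def)
  obtain z where z: "z \<in> interior t" "z \<in> region (sq Q)" "z \<in> region (sq Q')" using step.hyps(2) by (auto simp: strand_steps_def)
  define d where "d = cnj c * \<delta>"
  have d: "d \<in> units" "c * d = \<delta>" using IH(2) \<delta> by (simp_all add: d_def mult.assoc[symmetric])
  have "along e n d \<in> axes" using along_frame[OF net_faces_frame(1)[OF IH(1)] d(1)] by (simp add: frame_def)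
  then obtain q' e' where F': "(q', e', along e n d) \<in> net_faces" using net_faces_cover by blast
  obtain c' where c': "c' \<in> units" "unfolding_isometry fold_net (sq q) (sq q') (move q' (q + d) c')"
    by (rule unfolding_exists[OF IH(1) F' d(1) refl]) blast
  have qc: "q \<in> cell_corners" "q' \<in> cell_corners" "q + d \<in> cell_corners"
    using net_faces_frame(2) IH(1) F' d(1) by blast+
  define s' where "s' = move (q + d) q' (cnj c') ` s"
  have s': "s' \<in> strands"
    unfolding s'_def using IH(4) qc c'(1) by (intro planar_group_strands[OF move_in_group]) auto
  have hs: "move q' (q + d) c' ` s' = s"
    unfolding s'_def image_comp move_comp using c'(1) by (simp add: move_id)
  have k: "move q' Q' (c * c') = move q Q c \<circ> move q' (q + d) c'"
  proof (rule move_eqI[symmetric])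
    fix u
    have "(move q Q c \<circ> move q' (q + d) c') (chart q' u) = chart Q (2 * (c * d) + c * c' * u)"
      by (simp add: chart_shift distrib_left mult.left_commute mult.assoc)
    then show "(move q Q c \<circ> move q' (q + d) c') (chart q' u) = chart Q' (c * c' * u)"
      by (simp add: Q' d(2) chart_shift)
  qed
  have ks: "move q' Q' (c * c') ` s' = t" unfolding k image_comp[symmetric] hs IH(5) ..
  have iso: "plane_isometry (move q Q c)" using IH(2) by (intro move_isometry) simp
  have iso': "plane_isometry (move q' Q' (c * c'))" using IH(2) c'(1) by (intro move_isometry) (simp add: norm_mult)
  have inj: "inj (move q Q c)" using plane_isometry_bij[OF iso] by (simp add: bij_def)
  have "z \<in> move q Q c ` interior s" using z(1) unfolding IH(5)[symmetric] plane_isometry_interior[OF iso] .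
  then obtain z1 where z1: "z1 \<in> interior s" "z = move q Q c z1" by blast
  have "z \<in> move q Q c ` region (sq q)" using z(2) move_region[OF IH(2)] by simp
  then have z1r: "z1 \<in> region (sq q)" using z1(2) inj by (auto simp: inj_def)
  have cc: "c * c' \<in> units" using IH(2) c'(1) by blast
  have "z \<in> move q' Q' (c * c') ` region (sq q')" using z(3) move_region[OF cc] by simp
  then have "z \<in> move q Q c ` (move q' (q + d) c' ` region (sq q'))" unfolding k image_comp .
  then have z1h: "z1 \<in> move q' (q + d) c' ` region (sq q')" using z1(2) inj by (auto simp: inj_def)
  have "z \<in> move q' Q' (c * c') ` interior s'" using z(1) unfolding ks[symmetric] plane_isometry_interior[OF iso'] .
  then obtain z2 where z2: "z2 \<in> interior s'" "z = move q' Q' (c * c') z2" by blast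
  have inj': "inj (move q' Q' (c * c'))" using plane_isometry_bij[OF iso'] by (simp add: bij_def)
  have z2r: "z2 \<in> region (sq q')"
    using \<open>z \<in> move q' Q' (c * c') ` region (sq q')\<close> z2(2) inj' by (auto simp: inj_def)
  have meets: "interior a \<inter> interior (region (sq b)) \<noteq> {}" if "x \<in> interior a" "x \<in> region (sq b)" for x a b
    using open_meets_region[OF side_nonzero, of x "p + b * v" "interior a"] that by (simp add: sq_def)
  have "(sq q, s) \<in> pieces net" "(sq q', s') \<in> pieces net"
    using meets z1(1) z1r z2(1) z2r IH(1,4) s' F' net_iff unfolding pieces_iff by auto
  then have "adjoins (sq q, s) (sq q', s')"
    unfolding continues_def using c'(2) hs z1(1) z1r z1h by auto
  then have "joined (sq q0, t) (sq q', s')" using IH(6) by (rule rtranclp.rtrancl_into_rtrancl[rotated])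
  moreover have "Q' \<in> cell_corners" using Q' IH(3) \<delta> by blast
  ultimately show ?case using F' cc s' ks by blast
qed

text \<open>A symmetry \<open>g\<close> of the prefabric takes the strand of the piece \<open>x\<close> to
  that of \<open>y\<close>, and the region of \<open>x\<close> to a square on the latter.
  Rolling the cube there along the strand of \<open>y\<close> shows a piece of the same strand
  of the cube on this square. The two pieces differ by a motion between two regions of the net,
  and this motion comes from a rotation of the cube.\<close>

lemma strands_transitive:
  assumes "isonemal P" "x \<in> pieces net" "y \<in> pieces net"
  shows "\<exists>\<rho>\<in>cube_rotations radius. rotate_strand net fold_net \<rho> {z. joined x z}
    = {z. joined y z}"
proof -
  obtain q1 e1 n1 where F1: "(q1, e1, n1) \<in> net_faces" "fst x = sq q1" using assms(2) net_iff pieces_iff by metis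
  obtain q0 e0 n0 where F0: "(q0, e0, n0) \<in> net_faces" "fst y = sq q0" using assms(3) net_iff pieces_iff by metis
  define s t where "s = snd x" and "t = snd y"
  have st: "s \<in> strands" "t \<in> strands" using assms(2,3) pieces_iff s_def t_def by auto
  have qc: "q1 \<in> cell_corners" "q0 \<in> cell_corners" using net_faces_frame(2) F1 F0 by blast+
  obtain g where g: "g \<in> planar_group P" "g ` s = t" using assms(1) st unfolding isonemal_def by blast
  obtain Q c where Q: "Q \<in> cell_corners" "c \<in> units" "g = move q1 Q c" by (rule group_is_move[OF g(1) qc(1)])
  have iso: "plane_isometry g" using planar_group_iso g(1) by blast
  have "interior s \<inter> interior (region (sq q1)) \<noteq> {}" using assms(2) F1(2) by (simp add: pieces_iff s_def)
  then have "interior s \<inter> region (sq q1) \<noteq> {}" using interior_subset by blast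
  then have "g ` interior s \<inter> g ` region (sq q1) \<noteq> {}" by blast
  moreover have "g ` interior s = interior t" using plane_isometry_interior[OF iso] g(2) by metis
  moreover have "g ` region (sq q1) = region (sq Q)" unfolding Q(3) by (rule move_region[OF Q(2)])
  ultimately have "interior t \<inter> region (sq Q) \<noteq> {}" using image_Int_subset by auto
  moreover have "interior t \<inter> region (sq q0) \<noteq> {}"
    using assms(3) F0(2) interior_subset by (auto simp: pieces_iff t_def)
  ultimately have "(q0, Q) \<in> (strand_steps (interior t))\<^sup>*"
    using strand_walk[OF convex_strand[OF st(2)] qc(2) Q(1)] by blast
  moreover have yt: "y = (sq q0, t)" using F0(2) by (simp add: t_def prod_eq_iff)
  ultimately obtain q e n c' s' where R: "(q, e, n) \<in> net_faces" "c' \<in> units" "s' \<in> strands"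
    "move q Q c' ` s' = t" "joined y (sq q, s')"
    using roll_along_strand[OF F0(1), of t Q] assms(3) by blast
  define b where "b = cnj c' * c"
  have b: "b \<in> units" using Q(2) R(2) by (auto simp: b_def)
  have "s' = move Q q (cnj c') ` move q Q c' ` s'"
    unfolding image_comp move_comp using R(2) by (simp add: move_id)
  also have "\<dots> = move Q q (cnj c') ` move q1 Q c ` s" unfolding R(4) Q(3)[symmetric] g(2) ..
  finally have s': "s' = move q1 q b ` s" unfolding image_comp move_comp b_def .
  note f1 = net_faces_frame(1)[OF F1(1)] and f = net_faces_frame(1)[OF R(1)]
  obtain \<rho> where \<rho>: "\<rho> \<in> cube_rotations radius" "\<rho> *v e1 = along e n b" "\<rho> *v n1 = n"
    using cube_rotation_exists[OF f1 along_frame[OF f b]] by blast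
  have "induces fold_net \<rho> (sq q1) (sq q) (move q1 q b)"
    using move_induces[OF F1(1) R(1) \<rho>(1,3,2) b] .
  then have "carried \<rho> x (sq q, s')"
    unfolding carried_def using R(1) net_iff F1(2) s' s_def by auto
  then have "rotate_strand net fold_net \<rho> {z. joined x z} = {z. joined (sq q, s') z}"
    using rotate_class[OF \<rho>(1) assms(2)] by blast
  also have "\<dots> = {z. joined y z}"
    using R(5) continues_rtranclp_sym[OF R(5)] by (auto intro: rtranclp_trans)
  finally show ?thesis using \<rho>(1) by blast
qed

end

section \<open>The woven cube of a unit with preserving corners\<close>

context preserving_unit
begin

lemma square_lattice_unit:
  assumes "q \<in> cell_corners" shows "lattice_unit P (sq q)"
proof -
  have "(1 - \<i>) * ((1 + \<i>) / 2) = 1" by (simp add: complex_eq_iff field_simps)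
  then have "(1 - \<i>) * q * ((1 + \<i>) / 2 * v) = q * v" by (metis mult.assoc mult.commute mult_1)
  moreover have "(1 - \<i>) * q \<in> cell_corners" using assms by blast
  ultimately show ?thesis unfolding sq_def using lattice_unitI[OF unit, of "(1 - \<i>) * q"] by metis
qed

lemma square_corners: "q \<in> cell_corners \<Longrightarrow> corners (sq q) \<subseteq> cell_corners"
  unfolding sq_def using p_v_corners by (intro corners_subset(1)) auto

lemma square_midpoints:
  assumes "q \<in> cell_corners" "m \<in> midpoints (sq q)" shows "half_turn m \<in> planar_group P"
proof -
  have "\<exists>k\<in>cell_corners. 2 * m = 2 * (p + q * v) + k * v"
  proof -
    have "m \<in> {p + q * v + v / 2, p + q * v + v + \<i> * v / 2, p + q * v + v / 2 + \<i> * v, p + q * v + \<i> * v / 2}"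
      using assms(2) by (simp add: midpoints_def sq_def)
    then show ?thesis
    proof (elim insertE emptyE)
      assume "m = p + q * v + v / 2"
      then show ?thesis by (intro bexI[of _ 1]) auto
    next
      assume "m = p + q * v + v + \<i> * v / 2"
      then show ?thesis by (intro bexI[of _ "of_int 2 + \<i>"] cell_corners_closed) (auto simp: algebra_simps)
    next
      assume "m = p + q * v + v / 2 + \<i> * v"
      then show ?thesis by (intro bexI[of _ "1 + of_int 2 * \<i>"] cell_corners_closed) (auto simp: algebra_simps)
    next
      assume "m = p + q * v + \<i> * v / 2"
      then show ?thesis by (intro bexI[of _ \<i>]) auto
    qed
  qed
  then obtain k where k: "k \<in> cell_corners" "2 * m = 2 * (p + q * v) + k * v" by blast
  show ?thesis
  proof (rule planar_groupI[OF unit, of "-1" "of_int 2 * q + k"])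
    show "of_int 2 * q + k \<in> cell_corners" using assms(1) k(1) by blast
    show "half_turn m z = p + - 1 * (z - p) + (of_int 2 * q + k) * v" for z
    proof -
      have "half_turn m z = 2 * m - z" by (simp add: rotation_def)
      then show ?thesis unfolding k(2) by (simp add: algebra_simps)
    qed
  qed simp
qed

text \<open>The centre satisfies \<open>(1 - u) * (c - p) = m * v\<close> with \<open>u\<close> one of
  \<open>\<i>\<close>, \<open>- 1\<close>, \<open>- \<i>\<close>, and in each case
  \<open>1 - u\<close> divides 2.\<close>

lemma rotation_centre_half_lattice:
  assumes "c \<in> rotation_centres P"
  shows "\<exists>m\<in>cell_corners. 2 * (c - p) = m * v"
proof -
  obtain u where u: "u \<noteq> 1" "rotation c u \<in> planar_group P"
    using assms unfolding rotation_centres_def by blast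
  obtain u' m where u': "u' \<in> units" "m \<in> cell_corners" "\<And>z. rotation c u z = p + u' * (z - p) + m * v"
    by (rule planar_groupD[OF unit u(2)]) blast
  have "u = rotation c u (c + 1) - rotation c u c" by (simp add: rotation_def)
  also have "\<dots> = u'" unfolding u'(3) by (simp add: algebra_simps)
  finally have "u = u'" .
  have "(1 - u) * (c - p) = m * v" using u'(3)[of p] unfolding rotation_def by (simp add: algebra_simps)
  moreover obtain k where "k \<in> cell_corners" "k * (1 - u) = 2"
  proof -
    have "1 * (1 - - 1) = (2 :: complex)" "(1 + \<i>) * (1 - \<i>) = 2" "(1 - \<i>) * (1 - - \<i>) = 2"
      by (simp_all add: algebra_simps)
    then show thesis
      using that u(1) u'(1) unfolding \<open>u = u'\<close> units_def
      by (metis cell_corners_closed(2,3,7,8) empty_iff insert_iff)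
  qed
  ultimately have "2 * (c - p) = k * m * v" by (metis mult.assoc)
  then show ?thesis using \<open>k \<in> cell_corners\<close> u'(2) by blast
qed

lemma half_lattice_in_square:
  assumes "c \<in> region (sq q)" "m \<in> cell_corners" "2 * (c - p) = m * v" "q \<in> cell_corners"
  shows "c \<in> {centre (sq q)} \<union> corners (sq q) \<union> midpoints (sq q)"
proof -
  obtain w where w: "c = p + q * v + w * v" "0 \<le> Re w" "Re w \<le> 1" "0 \<le> Im w" "Im w \<le> 1"
    using assms(1) unfolding sq_def region_eq by blast
  have "2 * (c - p) = (2 * q + 2 * w) * v" by (simp add: w(1) algebra_simps)
  then have "2 * q + 2 * w = m" using assms(3) side_nonzero by simp
  then have "2 * w = m - (q + q)" by (simp add: eq_diff_eq add.commute)
  moreover have "m - (q + q) \<in> cell_corners" using assms(2,4) by blast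
  ultimately obtain x y where xy: "2 * w = Complex (of_int x) (of_int y)" unfolding cell_corners_def by auto
  then have r: "2 * Re w = of_int x" "2 * Im w = of_int y" by (auto simp: complex_eq_iff)
  then have "0 \<le> x" "x \<le> 2" "0 \<le> y" "y \<le> 2" using w by linarith+
  then have "x = 0 \<or> x = 1 \<or> x = 2" "y = 0 \<or> y = 1 \<or> y = 2" by auto
  then have "w \<in> {(1 + \<i>) / 2} \<union> {0, 1, 1 + \<i>, \<i>} \<union> {1/2, 1 + \<i>/2, 1/2 + \<i>, \<i>/2}"
    using r by (elim disjE) (simp_all add: complex_eq_iff)
  then have "p + q * v + w * v \<in> (\<lambda>w. p + q * v + w * v) `
      ({(1 + \<i>) / 2} \<union> {0, 1, 1 + \<i>, \<i>} \<union> {1/2, 1 + \<i>/2, 1/2 + \<i>, \<i>/2})"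
    by (rule imageI)
  moreover have "midpoints (a, v) = (\<lambda>w. a + w * v) ` {1/2, 1 + \<i>/2, 1/2 + \<i>, \<i>/2}" for a
    by (simp add: midpoints_def algebra_simps)
  moreover have "centre (a, v) = a + (1 + \<i>) / 2 * v" for a
    by (simp add: centre_eq)
  ultimately show ?thesis unfolding w(1) sq_def corners_eq by (simp only: image_Un image_insert image_empty)
qed

text \<open>Faces that meet have orthogonal normals, since opposite faces are disjoint.\<close>

lemma net_matches: "matches_across_edges P net fold_net"
  unfolding matches_across_edges_def
proof (intro ballI impI, elim conjE)
  fix A B assume AB: "A \<in> net" "B \<in> net" "A \<noteq> B" "fold_net ` region A \<inter> fold_net ` region B \<noteq> {}"
  obtain q e n where F: "(q, e, n) \<in> net_faces" "A = sq q" using AB(1) unfolding net_iff by blast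
  obtain q' e' n' where F': "(q', e', n') \<in> net_faces" "B = sq q'" using AB(2) unfolding net_iff by blast
  note fr = net_faces_frame(1)[OF F(1)] and fr' = net_faces_frame(1)[OF F'(1)]
  have ax: "n \<in> axes" "n' \<in> axes" using fr fr' by (auto simp: frame_def)
  have "n \<noteq> n'" using net_faces_unique(1)[OF F(1) F'(1)] AB(3) F(2) F'(2) by auto
  moreover obtain x where x: "x \<bullet> n = radius" "x \<bullet> n' = radius"
    using AB(4) unfolding F(2) F'(2) fold_face[OF F(1)] fold_face[OF F'(1)] face_def by blast
  then have "n' \<noteq> - n" using radius_pos by auto
  ultimately have "n' \<bullet> n = 0" using axes_inner(1,3,4)[OF ax] by (auto simp: inner_commute)
  then have "frame n' n" using ax by (simp add: frame_def)
  then obtain d where d: "d \<in> units" "n' = along e n d" using along_unit_exists[OF fr] by metis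
  obtain c where c: "c \<in> units" "unfolding_isometry fold_net (sq q) (sq q') (move q' (q + d) c)"
    "checker q' * checker (q + d) * Re (c\<^sup>2) = 1"
    by (rule unfolding_exists[OF F(1) F'(1) d]) blast
  have qc: "q' \<in> cell_corners" "q + d \<in> cell_corners" using net_faces_frame(2) F(1) F'(1) d(1) by blast+
  have K: "(move q' (q + d) c, Keep) \<in> symmetries P" using move_kind[OF qc c(1)] c(3) by simp
  show "\<exists>h. unfolding_isometry fold_net A B h \<and>
      (\<forall>t\<in>strands. interior t \<inter> {y \<in> region B. fold_net y \<in> fold_net ` region A} \<noteq> {} \<longrightarrow> h ` t \<in> strands) \<and>
      (\<forall>i j. interior (cell i j) \<inter> {y \<in> region B. fold_net y \<in> fold_net ` region A} \<noteq> {} \<longrightarrow> carries P h Keep i j)"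
    using c(2) planar_group_strands[OF symmetriesD(4)[OF K]] symmetriesD(3)[OF K]
    unfolding F(2) F'(2) by blast
qed

lemma net_woven_alike: "woven_alike P net"
  unfolding woven_alike_def
proof (intro ballI)
  fix A B assume "A \<in> net" "B \<in> net"
  then obtain q q' where q: "q \<in> cell_corners" "A = sq q" "q' \<in> cell_corners" "B = sq q'"
    using net_positions by metis
  have "move q q' 1 = translation ((q' - q) * v)"
    by (auto simp: move_affine translation_def algebra_simps)
  then show "\<exists>g\<in>planar_group P. ((\<exists>t. g = translation t) \<or> (\<exists>c u. cmod u = 1 \<and> g = rotation c u)) \<and>
      g ` region A = region B"
    using move_in_group[OF q(1,3), of 1] move_region[of 1 q q'] q by auto
qed

lemma net_weaving_invariant:
  assumes "\<rho> \<in> cube_rotations radius"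
  shows "\<exists>\<epsilon>. weaving_invariant P net fold_net \<rho> \<epsilon>"
proof -
  define \<epsilon> where "\<epsilon> = (if vertex_colour (\<rho> *v vector [1, 1, 1]) = 1 then Keep else swap_kind)"
  have "\<exists>B\<in>net. \<exists>g. induces fold_net \<rho> A B g \<and> (\<forall>i j. carries P g \<epsilon> i j)" if A: "A \<in> net" for A
  proof -
    obtain q e n where F: "(q, e, n) \<in> net_faces" "A = sq q" using A unfolding net_iff by blast
    obtain q' e' n' c where M: "(q', e', n') \<in> net_faces" "c \<in> units"
      "induces fold_net \<rho> (sq q) (sq q') (move q q' c)"
      "checker q * checker q' * Re (c\<^sup>2) = vertex_colour (\<rho> *v vector [1, 1, 1])"
      by (rule move_exists[OF F(1) assms]) blast
    have "(move q q' c, \<epsilon>) \<in> symmetries P"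
      using move_kind[OF net_faces_frame(2)[OF F(1)] net_faces_frame(2)[OF M(1)] M(2)] M(4) by (simp add: \<epsilon>_def)
    then show ?thesis using M(1,3) F(2) net_iff symmetriesD(3) by blast
  qed
  then show ?thesis unfolding weaving_invariant_def by blast
qed

lemma isonemal_woven_cube_net:
  assumes "isonemal P" shows "isonemal_woven_cube P net radius fold_net"
proof -
  have strands: "\<exists>\<rho>\<in>cube_rotations radius. rotate_strand net fold_net \<rho> S = T"
    if "S \<in> cube_strands net fold_net" "T \<in> cube_strands net fold_net" for S T
    using that strands_transitive[OF assms] unfolding cube_strands_def by blast
  have regions: "quarter_turn (centre A) \<in> planar_group P \<and> (\<forall>m\<in>midpoints A. half_turn m \<in> planar_group P) \<and>
      corners A \<subseteq> cell_corners \<and> lattice_unit P A" if A: "A \<in> net" for A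
  proof -
    obtain q where q: "q \<in> cell_corners" "A = sq q" using net_positions[OF A] by blast
    have "quarter_turn (centre (sq q)) \<in> planar_group P"
      using centre_in_group square_lattice_unit[OF q(1)] unfolding sq_def by blast
    then show ?thesis using q square_midpoints square_corners square_lattice_unit by blast
  qed
  have centres: "c \<in> (\<Union>A\<in>net. {centre A} \<union> corners A \<union> midpoints A)"
    if c: "c \<in> rotation_centres P \<inter> (\<Union>A\<in>net. region A)" for c
  proof -
    obtain A where A: "A \<in> net" "c \<in> region A" using c by blast
    obtain q where q: "q \<in> cell_corners" "A = sq q" using net_positions[OF A(1)] by blast
    obtain m where m: "m \<in> cell_corners" "2 * (c - p) = m * v" using rotation_centre_half_lattice c by blast
    show ?thesis using half_lattice_in_square[OF _ m q(1)] A q(2) by blast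
  qed
  show ?thesis
    unfolding isonemal_woven_cube_def
  proof (intro conjI)
    show "rotation_centres P \<inter> (\<Union>A\<in>net. region A) \<subseteq> (\<Union>A\<in>net. {centre A} \<union> corners A \<union> midpoints A)"
      using centres by (rule subsetI)
  qed (use strands regions net_folds_to_cube net_matches net_woven_alike net_weaving_invariant in auto)
qed

end

theorem theorem11:
  fixes P :: prefabric and n :: nat
  assumes "isonemal P" and "has_order P n" and "n > 4"
  shows "(\<exists>N r f. (\<forall>A\<in>N. lattice_unit P A) \<and> isonemal_woven_cube P N r f) \<longleftrightarrow>
         species33 P \<or> species34 P \<or> species37 P \<or> species38 P \<or> species39 P"
proof
  assume "\<exists>N r f. (\<forall>A\<in>N. lattice_unit P A) \<and> isonemal_woven_cube P N r f"
  then obtain N r f where W: "isonemal_woven_cube P N r f" by blast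
  obtain p v where "lattice_unit P (p, v)" "corners (p, v) \<subseteq> cell_corners" "preserving P p"
    by (rule preserving_corner_of_woven_cube[OF W assms])
  then show "species33 P \<or> species34 P \<or> species37 P \<or> species38 P \<or> species39 P"
    using assms by (rule species_of_preserving_corner)
next
  assume "species33 P \<or> species34 P \<or> species37 P \<or> species38 P \<or> species39 P"
  then obtain p v where *: "lattice_unit P (p, v)" "corners (p, v) \<subseteq> cell_corners" "preserving P p"
    by (rule preserving_corner_of_species)
  interpret preserving_unit P p v using * by unfold_locales
  have "isonemal_woven_cube P net radius fold_net"
    using assms(1) by (rule isonemal_woven_cube_net)
  moreover from this have "\<forall>A\<in>net. lattice_unit P A"
    unfolding isonemal_woven_cube_def by (elim conjE)
  ultimately show "\<exists>N r f. (\<forall>A\<in>N. lattice_unit P A) \<and> isonemal_woven_cube P N r f"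
    by (intro exI conjI)
qed

end
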